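(* Let $H$ be a Hilbert space, and let $A$ be a self-adjoint nonnegative operator on $H$ with dense domain $D(A)$. Assume that the spectrum of $A$ is an increasing unbounded sequence of positive real numbers $\{\lambda_k^2\}_{k\ge 1}$, with $\lambda_k>0$ for every $k\ge 1$. Then there exist a function $\delta:[0,+\infty)\to[0,+\infty)$ and a nonincreasing function $\varphi:[0,+\infty)\to(0,+\infty)$ such that $$\lim_{t\to+\infty}\varphi(t)e^{Rt}=0\qquad\forall R>0,$$ and such that every weak solution $u$ to $$u''(t)+2\delta(t)u'(t)+Au(t)=0$$ satisfies $$|u'(t)|^2+|A^{1/2}u(t)|^2\le\left(|u'(0)|^2+|A^{1/2}u(0)|^2\right)\cdot\varphi(t)\qquad\forall t\ge 0.$$ Moreover, $\delta$ can be chosen of class $C^\infty$, and it can alternatively be chosen piecewise constant (i.e. the statement holds with $\delta$ of class $C^\infty$, and it also holds with $\delta$ piecewise constant).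
   Context: $|\cdot|$ is the norm of $H$. The spectrum is regarded as a set, so the $\lambda_k^2$ are distinct eigenvalues listed in increasing order. A weak solution is a function $u\in C^0([0,+\infty),D(A^{1/2}))\cap C^1([0,+\infty),H)$ (with initial data $u(0)\in D(A^{1/2})$, $u'(0)\in H$) satisfying the equation in the usual weak sense: for every $\phi\in D(A^{1/2})$ the function $t\mapsto\langle u'(t),\phi\rangle$ is locally absolutely continuous and $\frac{d}{dt}\langle u'(t),\phi\rangle+2\delta(t)\langle u'(t),\phi\rangle+\langle A^{1/2}u(t),A^{1/2}\phi\rangle=0$ for almost every $t$. Piecewise constant means having finitely many constancy intervals on each bounded interval. *)

theory Defs
  imports "HOL-Analysis.Analysis"
begin

text \<open>
  Possibly unbounded, partially defined operators on a Hilbert space are represented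
  by their graphs, so that the domain is \<^const>\<open>Domain\<close>, equality of operators includes equality of
  domains, and composition with its natural domain is relation composition.
\<close>

type_synonym 'a operator = "('a \<times> 'a) set"

definition linear_operator :: "'a::real_vector operator \<Rightarrow> bool" where
  "linear_operator A \<longleftrightarrow> subspace A \<and> single_valued A"

definition op_apply :: "'a operator \<Rightarrow> 'a \<Rightarrow> 'a" where
  "op_apply A x = (THE y. (x, y) \<in> A)"

definition densely_defined :: "'a::topological_space operator \<Rightarrow> bool" where
  "densely_defined A \<longleftrightarrow> closure (Domain A) = UNIV"

text \<open>The graph of the Hilbert space adjoint; it is single-valued when \<open>A\<close> is densely defined.\<close>

definition adjoint_operator :: "'a::real_inner operator \<Rightarrow> 'a operator" where
  "adjoint_operator A = {(y, z). \<forall>(x, w)\<in>A. inner w y = inner x z}"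

definition self_adjoint_operator :: "'a::real_inner operator \<Rightarrow> bool" where
  "self_adjoint_operator A \<longleftrightarrow>
     linear_operator A \<and> densely_defined A \<and> adjoint_operator A = A"

definition nonnegative_operator :: "'a::real_inner operator \<Rightarrow> bool" where
  "nonnegative_operator A \<longleftrightarrow> (\<forall>(x, y)\<in>A. inner y x \<ge> 0)"

text \<open>
  \<open>R\<close> below is a bounded two-sided inverse of \<open>A - \<mu>I : D(A) \<rightarrow> H\<close>. The spectrum of a self-adjoint
  operator contains no nonreal number, so that only real \<open>\<mu>\<close> are considered.
\<close>

definition resolvent_set :: "'a::real_normed_vector operator \<Rightarrow> real set" where
  "resolvent_set A = {\<mu>. \<exists>R. bounded_linear R \<and>
      (\<forall>y. (R y, y + \<mu> *\<^sub>R R y) \<in> A) \<and>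
      (\<forall>(x, y)\<in>A. R (y - \<mu> *\<^sub>R x) = x)}"

definition spectrum :: "'a::real_normed_vector operator \<Rightarrow> real set" where
  "spectrum A = - resolvent_set A"

text \<open>The unique nonnegative self-adjoint square root of a nonnegative self-adjoint operator.\<close>

definition sqrt_operator :: "'a::real_inner operator \<Rightarrow> 'a operator" where
  "sqrt_operator A =
     (THE B. self_adjoint_operator B \<and> nonnegative_operator B \<and> B O B = A)"

definition absolutely_continuous_fun_on :: "real set \<Rightarrow> (real \<Rightarrow> real) \<Rightarrow> bool" where
  "absolutely_continuous_fun_on S f \<longleftrightarrow>
     (\<forall>\<epsilon>>0. \<exists>\<eta>>0. \<forall>(n::nat) a b.
        (\<forall>i<n. a i \<le> b i \<and> {a i..b i} \<subseteq> S) \<and>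
        disjoint_family_on (\<lambda>i. {a i<..<b i}) {..<n} \<and>
        (\<Sum>i<n. b i - a i) < \<eta>
        \<longrightarrow> (\<Sum>i<n. \<bar>f (b i) - f (a i)\<bar>) < \<epsilon>)"

text \<open>
  \<open>u\<close> is a weak solution of \<open>u'' + 2 \<delta> u' + A u = 0\<close> on the half-line with (necessarily unique)
  derivative \<open>v = u'\<close>. Continuity into \<open>D(A\<^sup>1\<^sup>/\<^sup>2)\<close> refers to the graph norm.
\<close>

definition weak_solution ::
  "'a::real_inner operator \<Rightarrow> (real \<Rightarrow> real) \<Rightarrow> (real \<Rightarrow> 'a) \<Rightarrow> (real \<Rightarrow> 'a) \<Rightarrow> bool" where
  "weak_solution A \<delta> u v \<longleftrightarrow>
     (\<forall>t\<ge>0. u t \<in> Domain (sqrt_operator A)) \<and>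
     continuous_on {0..} u \<and>
     continuous_on {0..} (\<lambda>t. op_apply (sqrt_operator A) (u t)) \<and>
     (\<forall>t\<ge>0. (u has_vector_derivative v t) (at t within {0..})) \<and>
     continuous_on {0..} v \<and>
     (\<forall>\<phi>\<in>Domain (sqrt_operator A).
        (\<forall>T\<ge>0. absolutely_continuous_fun_on {0..T} (\<lambda>t. inner (v t) \<phi>)) \<and>
        (AE t in lebesgue. t \<ge> 0 \<longrightarrow>
           (\<exists>d. ((\<lambda>s. inner (v s) \<phi>) has_real_derivative d) (at t within {0..}) \<and>
                d + 2 * \<delta> t * inner (v t) \<phi>
                  + inner (op_apply (sqrt_operator A) (u t)) (op_apply (sqrt_operator A) \<phi>) = 0)))"

text \<open>Class \<open>C\<^sup>\<infinity>\<close> on the closed half-line, with one-sided derivatives at the origin.\<close>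

definition smooth_on_halfline :: "(real \<Rightarrow> real) \<Rightarrow> bool" where
  "smooth_on_halfline f \<longleftrightarrow>
     (\<exists>d :: nat \<Rightarrow> real \<Rightarrow> real. d 0 = f \<and>
        (\<forall>n. \<forall>t\<ge>0. (d n has_real_derivative d (Suc n) t) (at t within {0..})))"

definition piecewise_constant_on_halfline :: "(real \<Rightarrow> real) \<Rightarrow> bool" where
  "piecewise_constant_on_halfline f \<longleftrightarrow>
     (\<forall>T\<ge>0. \<exists>P. finite P \<and> partition_on {0..T} P \<and> (\<forall>I\<in>P. is_interval I \<and> f constant_on I))"

definition ultra_exponential_damping ::
  "'a::real_inner operator \<Rightarrow> (real \<Rightarrow> real) \<Rightarrow> (real \<Rightarrow> real) \<Rightarrow> bool" where
  "ultra_exponential_damping A \<delta> \<phi> \<longleftrightarrow>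
     (\<forall>t\<ge>0. \<delta> t \<ge> 0) \<and>
     (\<forall>t\<ge>0. \<phi> t > 0) \<and>
     antimono_on {0..} \<phi> \<and>
     (\<forall>R>0. ((\<lambda>t. \<phi> t * exp (R * t)) \<longlongrightarrow> 0) at_top) \<and>
     (\<forall>u v. weak_solution A \<delta> u v \<longrightarrow>
        (\<forall>t\<ge>0. (norm (v t))\<^sup>2 + (norm (op_apply (sqrt_operator A) (u t)))\<^sup>2
           \<le> ((norm (v 0))\<^sup>2 + (norm (op_apply (sqrt_operator A) (u 0)))\<^sup>2) * \<phi> t))"

end

theory Submission
  imports Defs
begin

text \<open>
  Eigenvectors of \<open>A\<close> are total, so that the energy of a weak solution is the sum of the energies of its
  components in the eigenspaces, and each component solves \<open>w'' + 2 \<delta> w' + \<lambda>\<^sup>2 w = 0\<close>. The energy of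
  every component is nonincreasing whatever \<open>\<delta> \<ge> 0\<close> is. A single mode can be reduced by an arbitrary factor
  in a time depending on \<open>\<lambda>\<close> only: a strong short pulse kills the kinetic energy, a free quarter of a period
  turns the remaining potential energy into kinetic energy, and a second pulse kills that. All modes
  \<open>\<lambda> \<ge> 6 R\<close> are reduced together by a long plateau \<open>\<delta> = 3 R\<close>. Treating the finitely many modes below \<open>6 R\<close>
  one after the other and choosing the plateau long enough to absorb the time this takes yields a block of
  some length \<open>T\<close> which contracts every mode by \<open>e\<^bsup>-R T\<^esup>\<close>. Concatenating blocks with \<open>R \<rightarrow> \<infinity>\<close> slowly gives \<open>\<delta>\<close>.
  Pulses and plateaus only have to be constant on their middle thirds, so that they can be taken
  smooth or piecewise constant.
\<close>

section \<open>Absolutely continuous functions\<close>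

text \<open>A constant damping cannot work: if \<open>\<delta> = c\<close> is much larger than
  \<lambda>, the slow root decays only at a rate of about \<open>\<lambda>\<^sup>2 / (2 c)\<close>,
  so a friction strong enough for the high modes freezes the low ones, while pulses tuned to one
  quarter period do not suit another. Plateau and pulses are compatible because the time spent on
  the low modes is bounded before the reduction factor is prescribed: the plateau length is fixed
  from that time, the factor afterwards.

  On the operator side only the spectrum as a set is known. Eigenspaces may have infinite dimension,
  so the resolvent need not be compact, and completeness of the eigenvectors is drawn from resolvent
  bounds in spectral gaps. The square root is a definite description, so its uniqueness has to be
  shown as well.

  Weak solutions give absolutely continuous components with an equation almost everywhere, and
  \<delta> may jump; all scalar estimates therefore come from one monotonicity principle for
  absolutely continuous functionals.\<close>

lemma absolutely_continuous_fun_onD: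
  fixes f :: "real \<Rightarrow> real"
  assumes "absolutely_continuous_fun_on S f" "\<epsilon> > 0"
  shows "\<exists>\<eta>>0. \<forall>(I :: 'i set) a b. finite I \<and> (\<forall>i\<in>I. a i \<le> b i \<and> {a i..b i} \<subseteq> S) \<and>
       disjoint_family_on (\<lambda>i. {a i<..<b i}) I \<and> (\<Sum>i\<in>I. b i - a i) < \<eta>
       \<longrightarrow> (\<Sum>i\<in>I. \<bar>f (b i) - f (a i)\<bar>) < \<epsilon>"
proof -
  from assms obtain \<eta> where "\<eta> > 0" and \<eta>: "\<And>(n::nat) a b.
        (\<forall>i<n. a i \<le> b i \<and> {a i..b i} \<subseteq> S) \<and>
        disjoint_family_on (\<lambda>i. {a i<..<b i}) {..<n} \<and>
        (\<Sum>i<n. b i - a i) < \<eta>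
        \<Longrightarrow> (\<Sum>i<n. \<bar>f (b i) - f (a i)\<bar>) < \<epsilon>"
    unfolding absolutely_continuous_fun_on_def by meson
  have "(\<Sum>i\<in>I. \<bar>f (b i) - f (a i)\<bar>) < \<epsilon>"
    if *: "finite I" "\<forall>i\<in>I. a i \<le> b i \<and> {a i..b i} \<subseteq> S"
       "disjoint_family_on (\<lambda>i. {a i<..<b i}) I" "(\<Sum>i\<in>I. b i - a i) < \<eta>" for I :: "'i set" and a b
  proof -
    obtain g where g: "bij_betw g {0..<card I} I"
      using ex_bij_betw_nat_finite[OF \<open>finite I\<close>] by blast
    then have g': "bij_betw g {..<card I} I" by (simp add: atLeast0LessThan)
    have "(\<Sum>i<card I. \<bar>f (b (g i)) - f (a (g i))\<bar>) < \<epsilon>"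
    proof (rule \<eta>, intro conjI allI impI)
      fix i assume "i < card I"
      then have "g i \<in> I" using g' by (auto simp: bij_betw_def)
      then show "a (g i) \<le> b (g i)" "{a (g i)..b (g i)} \<subseteq> S" using *(2) by auto
    next
      show "disjoint_family_on (\<lambda>i. {a (g i)<..<b (g i)}) {..<card I}"
        using *(3) g' unfolding disjoint_family_on_def bij_betw_def inj_on_def
        by (metis imageI)
      show "(\<Sum>i<card I. b (g i) - a (g i)) < \<eta>"
        using *(4) sum.reindex_bij_betw[OF g', of "\<lambda>i. b i - a i"] by simp
    qed
    then show ?thesis
      using sum.reindex_bij_betw[OF g', of "\<lambda>i. \<bar>f (b i) - f (a i)\<bar>"] by simp
  qed
  then show ?thesis using \<open>\<eta> > 0\<close> by blast
qed

text \<open>Gauge argument: tags in the exceptional null set are confined to an open set of small measure,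
  where absolute continuity controls the increments; all other increments are controlled by the
  derivative.\<close>

lemma absolutely_continuous_antimono:
  fixes f :: "real \<Rightarrow> real"
  assumes ac: "absolutely_continuous_fun_on {a..b} f" and "a \<le> b"
    and ae: "AE t in lebesgue. t \<in> {a..b} \<longrightarrow>
      (\<exists>d\<le>0. (f has_real_derivative d) (at t within {a..b}))"
  shows "f b \<le> f a"
proof -
  obtain N where N: "N \<in> null_sets lebesgue"
    and der: "\<And>t. t \<notin> N \<Longrightarrow> t \<in> {a..b} \<Longrightarrow> \<exists>d\<le>0. (f has_real_derivative d) (at t within {a..b})"
    using AE_E3[OF ae] by (metis (no_types, lifting) DiffI UNIV_I space_completion space_lborel space_borel)
  have "f b - f a \<le> \<epsilon> * (b - a) + \<epsilon>" if \<epsilon>: "\<epsilon> > 0" for \<epsilon> :: real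
  proof -
    \<comment> \<open>The index type is that of the tagged pairs, since the intervals tagged in
      \<open>N\<close> will be indexed by the division itself.\<close>
    obtain \<eta> where "\<eta> > 0" and \<eta>: "\<forall>(I :: (real \<times> real set) set) a' b'.
        finite I \<and> (\<forall>i\<in>I. a' i \<le> b' i \<and> {a' i..b' i} \<subseteq> {a..b}) \<and>
        disjoint_family_on (\<lambda>i. {a' i<..<b' i}) I \<and> (\<Sum>i\<in>I. b' i - a' i) < \<eta>
        \<longrightarrow> (\<Sum>i\<in>I. \<bar>f (b' i) - f (a' i)\<bar>) < \<epsilon>"
      using absolutely_continuous_fun_onD[OF ac \<epsilon>] by blast
    obtain U where U: "open U" "N \<subseteq> U" "U - N \<in> lmeasurable" "emeasure lebesgue (U - N) < ennreal \<eta>"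
      using sets_lebesgue_outer_open[of N \<eta>] N \<open>\<eta> > 0\<close> by (metis null_setsD2)
    have Um: "U \<in> lmeasurable"
    proof -
      have "U = (U - N) \<union> N" using U(2) by auto
      moreover have "N \<in> lmeasurable"
        using N by (simp add: fmeasurableI_null_sets)
      ultimately show ?thesis using U(3) by (metis fmeasurable.Un)
    qed
    have Uless: "measure lebesgue U < \<eta>"
    proof -
      have "measure lebesgue U = measure lebesgue (U - N)"
        by (metis N Um fmeasurableD measure_Diff_null_set)
      moreover have "measure lebesgue (U - N) < \<eta>"
        using U(3,4) \<open>\<eta> > 0\<close> by (simp add: emeasure_eq_measure2 ennreal_less_iff)
      ultimately show ?thesis by simp
    qed
    have ex1: "\<exists>\<rho>>0. \<forall>y\<in>{a..b}. \<bar>y - t\<bar> < \<rho> \<longrightarrow> (t \<le> y \<longrightarrow> f y - f t \<le> \<epsilon> * (y - t)) \<and>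
       (y \<le> t \<longrightarrow> f t - f y \<le> \<epsilon> * (t - y))" if t: "t \<notin> N" "t \<in> {a..b}" for t
    proof -
      obtain d where d: "d \<le> 0" "(f has_real_derivative d) (at t within {a..b})"
        using der[OF t] by auto
      then obtain \<rho> where "\<rho> > 0" and \<rho>: "\<And>y. y \<in> {a..b} \<Longrightarrow> norm (y - t) < \<rho> \<Longrightarrow>
          norm (f y - f t - d * (y - t)) \<le> \<epsilon> * norm (y - t)"
        using \<open>\<epsilon> > 0\<close> unfolding has_field_derivative_def has_derivative_within_alt
        by meson
      have "(t \<le> y \<longrightarrow> f y - f t \<le> \<epsilon> * (y - t)) \<and> (y \<le> t \<longrightarrow> f t - f y \<le> \<epsilon> * (t - y))"
        if y: "y \<in> {a..b}" "\<bar>y - t\<bar> < \<rho>" for y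
      proof -
        have *: "\<bar>f y - f t - d * (y - t)\<bar> \<le> \<epsilon> * \<bar>y - t\<bar>" using \<rho>[of y] y by simp
        have "t \<le> y \<Longrightarrow> d * (y - t) \<le> 0" "y \<le> t \<Longrightarrow> d * (y - t) \<ge> 0"
          using d(1) by (auto simp: mult_nonpos_nonneg mult_nonpos_nonpos)
        then show ?thesis using * by (auto simp: abs_if split: if_splits)
      qed
      then show ?thesis using \<open>\<rho> > 0\<close> by blast
    qed
    have ex2: "\<exists>\<rho>>0. ball t \<rho> \<subseteq> U" if "t \<in> N" for t
      using open_contains_ball[of U] U(1,2) that by blast
    have "\<exists>r>0. (t \<in> N \<longrightarrow> ball t r \<subseteq> U) \<and> (t \<notin> N \<longrightarrow> t \<in> {a..b} \<longrightarrow>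
       (\<forall>y\<in>{a..b}. \<bar>y - t\<bar> < r \<longrightarrow> (t \<le> y \<longrightarrow> f y - f t \<le> \<epsilon> * (y - t)) \<and>
       (y \<le> t \<longrightarrow> f t - f y \<le> \<epsilon> * (t - y))))" for t
    proof (cases "t \<in> N")
      case True
      then show ?thesis using ex2 by blast
    next
      case False
      then show ?thesis using ex1 by (cases "t \<in> {a..b}") (blast, meson zero_less_one)
    qed
    then obtain \<rho> where \<rho>: "\<And>t. \<rho> t > 0" and \<rho>N: "\<And>t. t \<in> N \<Longrightarrow> ball t (\<rho> t) \<subseteq> U"
      and \<rho>D: "\<And>t. t \<notin> N \<Longrightarrow> t \<in> {a..b} \<Longrightarrow> \<forall>y\<in>{a..b}. \<bar>y - t\<bar> < \<rho> t \<longrightarrow>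
        (t \<le> y \<longrightarrow> f y - f t \<le> \<epsilon> * (y - t)) \<and> (y \<le> t \<longrightarrow> f t - f y \<le> \<epsilon> * (t - y))"
      by metis
    from \<rho> have "gauge (\<lambda>t. ball t (\<rho> t))" by (simp add: gauge_def)
    then obtain p where p: "p tagged_division_of {a..b}" "(\<lambda>t. ball t (\<rho> t)) fine p"
      using fine_division_exists_real by blast
    note pD = tagged_division_ofD[OF p(1)]
    have K: "Inf K \<le> x \<and> x \<le> Sup K \<and> interior K = {Inf K<..<Sup K} \<and>
        {Inf K..Sup K} \<subseteq> {a..b} \<and> {Inf K..Sup K} \<subseteq> ball x (\<rho> x)" if xK: "(x, K) \<in> p" for x K
    proof -
      obtain u v where uv: "K = cbox u v" using pD(4)[OF xK] by blast
      have "x \<in> K" "K \<subseteq> {a..b}" using pD(2,3)[OF xK] by auto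
      moreover have "K \<subseteq> ball x (\<rho> x)" using p(2) xK unfolding fine_def by auto
      ultimately show ?thesis using uv by auto
    qed
    define q where "q = {(x, K) \<in> p. x \<in> N}"
    have "q \<subseteq> p" "finite q" using pD(1) by (auto simp: q_def intro: finite_subset)
    have dis: "disjoint_family_on (\<lambda>i. {Inf (snd i)<..<Sup (snd i)}) q"
      unfolding disjoint_family_on_def
    proof (intro ballI impI)
      fix i j assume *: "i \<in> q" "j \<in> q" "i \<noteq> j"
      then have "interior (snd i) \<inter> interior (snd j) = {}"
        using pD(5)[of "fst i" "snd i" "fst j" "snd j"] \<open>q \<subseteq> p\<close> by auto
      moreover have "i \<in> p" "j \<in> p" using * \<open>q \<subseteq> p\<close> by auto
      then have "interior (snd i) = {Inf (snd i)<..<Sup (snd i)}"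
        "interior (snd j) = {Inf (snd j)<..<Sup (snd j)}"
        using K[of "fst i" "snd i"] K[of "fst j" "snd j"] by simp_all
      ultimately show "{Inf (snd i)<..<Sup (snd i)} \<inter> {Inf (snd j)<..<Sup (snd j)} = {}" by (simp only:)
    qed
    have "(\<Sum>i\<in>q. Sup (snd i) - Inf (snd i)) = (\<Sum>i\<in>q. measure lebesgue {Inf (snd i)<..<Sup (snd i)})"
    proof (rule sum.cong)
      fix i assume "i \<in> q"
      then have "Inf (snd i) \<le> Sup (snd i)"
        using K[of "fst i" "snd i"] \<open>q \<subseteq> p\<close> by auto
      then show "Sup (snd i) - Inf (snd i) = measure lebesgue {Inf (snd i)<..<Sup (snd i)}" by simp
    qed simp
    also have "\<dots> = measure lebesgue (\<Union>i\<in>q. {Inf (snd i)<..<Sup (snd i)})"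
    proof (rule measure_finite_Union[symmetric, OF \<open>finite q\<close> _ dis])
      show "emeasure lebesgue {Inf (snd i)<..<Sup (snd i)} \<noteq> \<infinity>" for i :: "real \<times> real set"
        by (cases "Inf (snd i) \<le> Sup (snd i)") auto
    qed auto
    also have "\<dots> \<le> measure lebesgue U"
    proof (rule measure_mono_fmeasurable)
      show "(\<Union>i\<in>q. {Inf (snd i)<..<Sup (snd i)}) \<subseteq> U"
      proof (intro UN_least subsetI)
        fix i y assume *: "i \<in> q" "y \<in> {Inf (snd i)<..<Sup (snd i)}"
        then have "(fst i, snd i) \<in> p" "y \<in> {Inf (snd i)..Sup (snd i)}" using \<open>q \<subseteq> p\<close> by auto
        then have "y \<in> ball (fst i) (\<rho> (fst i))" using K by blast
        moreover have "fst i \<in> N" using * by (auto simp: q_def)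
        ultimately show "y \<in> U" using \<rho>N by blast
      qed
    qed (use Um \<open>finite q\<close> in auto)
    finally have "(\<Sum>i\<in>q. Sup (snd i) - Inf (snd i)) < \<eta>" using Uless by linarith
    then have "(\<Sum>i\<in>q. \<bar>f (Sup (snd i)) - f (Inf (snd i))\<bar>) < \<epsilon>"
    proof (intro \<eta>[rule_format] conjI dis \<open>finite q\<close> ballI)
      fix i assume "i \<in> q"
      then show "Inf (snd i) \<le> Sup (snd i)" "{Inf (snd i)..Sup (snd i)} \<subseteq> {a..b}"
        using K[of "fst i" "snd i"] \<open>q \<subseteq> p\<close> by auto
    qed
    moreover have "(\<Sum>i\<in>q. f (Sup (snd i)) - f (Inf (snd i))) \<le> (\<Sum>i\<in>q. \<bar>f (Sup (snd i)) - f (Inf (snd i))\<bar>)"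
      by (intro sum_mono) auto
    moreover have "(\<Sum>i\<in>p - q. f (Sup (snd i)) - f (Inf (snd i))) \<le> (\<Sum>i\<in>p - q. \<epsilon> * (Sup (snd i) - Inf (snd i)))"
    proof (intro sum_mono, clarsimp)
      fix x K' assume *: "(x, K') \<in> p" "(x, K') \<notin> q"
      then have x: "x \<notin> N" "x \<in> {a..b}" using pD(2,3)[OF *(1)] by (auto simp: q_def)
      have "Inf K' \<in> {Inf K'..Sup K'}" "Sup K' \<in> {Inf K'..Sup K'}" using K[OF *(1)] by auto
      then have "Inf K' \<in> {a..b}" "Sup K' \<in> {a..b}" "\<bar>Inf K' - x\<bar> < \<rho> x" "\<bar>Sup K' - x\<bar> < \<rho> x"
        using K[OF *(1)] by (auto simp: dist_real_def abs_minus_commute subset_iff simp del: atLeastAtMost_iff)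
      \<comment> \<open>The tag lies between the endpoints, so the one-sided bounds at the tag add
        up to the bound for the whole interval.\<close>
      then have "f (Sup K') - f x \<le> \<epsilon> * (Sup K' - x)" "f x - f (Inf K') \<le> \<epsilon> * (x - Inf K')"
        using \<rho>D[OF x] K[OF *(1)] by auto
      then show "f (Sup K') - f (Inf K') \<le> \<epsilon> * (Sup K' - Inf K')" by (simp add: algebra_simps)
    qed
    moreover have "(\<Sum>i\<in>p - q. \<epsilon> * (Sup (snd i) - Inf (snd i))) \<le> (\<Sum>i\<in>p. \<epsilon> * (Sup (snd i) - Inf (snd i)))"
    proof (rule sum_mono2)
      fix i assume "i \<in> p - (p - q)"
      then have "Inf (snd i) \<le> Sup (snd i)" using K[of "fst i" "snd i"] by auto
      then show "0 \<le> \<epsilon> * (Sup (snd i) - Inf (snd i))" using \<epsilon> by simp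
    qed (use pD(1) in auto)
    moreover have "(\<Sum>i\<in>p. \<epsilon> * (Sup (snd i) - Inf (snd i))) = \<epsilon> * (b - a)"
      using additive_tagged_division_1[OF \<open>a \<le> b\<close> p(1), of "\<lambda>x. x"]
      by (simp add: sum_distrib_left[symmetric] case_prod_beta)
    moreover have "(\<Sum>i\<in>p. f (Sup (snd i)) - f (Inf (snd i))) = f b - f a"
      using additive_tagged_division_1[OF \<open>a \<le> b\<close> p(1), of f] by (simp add: case_prod_beta)
    moreover have "(\<Sum>i\<in>p. f (Sup (snd i)) - f (Inf (snd i))) =
       (\<Sum>i\<in>p - q. f (Sup (snd i)) - f (Inf (snd i))) + (\<Sum>i\<in>q. f (Sup (snd i)) - f (Inf (snd i)))"
      using sum.subset_diff[OF \<open>q \<subseteq> p\<close> pD(1)] .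
    ultimately show ?thesis by linarith
  qed
  then have *: "f b - f a \<le> \<epsilon> * (b - a + 1)" if "\<epsilon> > 0" for \<epsilon> :: real
    using that by (simp add: algebra_simps)
  show ?thesis
  proof (rule ccontr)
    assume "\<not> ?thesis"
    then have pos: "0 < f b - f a" by simp
    define D where "D = b - a + 1"
    have "D > 0" using \<open>a \<le> b\<close> by (simp add: D_def)
    then have "f b - f a \<le> (f b - f a) / (2 * D) * D"
      using *[of "(f b - f a) / (2 * D)"] pos by (simp add: D_def)
    also have "\<dots> = (f b - f a) / 2" using \<open>D > 0\<close> by simp
    finally show False using pos by simp
  qed
qed

lemma absolutely_continuous_fun_on_subset:
  "absolutely_continuous_fun_on S f \<Longrightarrow> T \<subseteq> S \<Longrightarrow> absolutely_continuous_fun_on T f"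
  unfolding absolutely_continuous_fun_on_def by (meson subset_trans)

text \<open>A single comparison of increments serves sums, products and \<open>C\<^sup>1\<close>
  functions; for the last both \<open>f\<close> and \<open>g\<close> are the identity.\<close>

lemma absolutely_continuous_dominated:
  assumes "absolutely_continuous_fun_on S f" "absolutely_continuous_fun_on S g" "M \<ge> 0"
    and le: "\<And>x y. x \<in> S \<Longrightarrow> y \<in> S \<Longrightarrow> \<bar>F y - F x\<bar> \<le> M * (\<bar>f y - f x\<bar> + \<bar>g y - g x\<bar>)"
  shows "absolutely_continuous_fun_on S F"
  unfolding absolutely_continuous_fun_on_def
proof (intro allI impI)
  fix \<epsilon> :: real assume "\<epsilon> > 0"
  \<comment> \<open>Two sums below \<open>\<epsilon>'\<close> give
    \<open>2 M \<epsilon>' = M \<epsilon> / (M + 1)\<close>; the summand 1 makes this strictly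
    smaller than \<epsilon> and covers \<open>M = 0\<close>.\<close>
  define \<epsilon>' where "\<epsilon>' = \<epsilon> / (2 * (M + 1))"
  have "\<epsilon>' > 0" using \<open>\<epsilon> > 0\<close> \<open>M \<ge> 0\<close> by (simp add: \<epsilon>'_def)
  obtain \<eta>1 where 1: "\<eta>1 > 0" "\<forall>(I :: nat set) a b. finite I \<and> (\<forall>i\<in>I. a i \<le> b i \<and> {a i..b i} \<subseteq> S) \<and>
       disjoint_family_on (\<lambda>i. {a i<..<b i}) I \<and> (\<Sum>i\<in>I. b i - a i) < \<eta>1
       \<longrightarrow> (\<Sum>i\<in>I. \<bar>f (b i) - f (a i)\<bar>) < \<epsilon>'"
    using absolutely_continuous_fun_onD[OF assms(1) \<open>\<epsilon>' > 0\<close>] by blast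
  obtain \<eta>2 where 2: "\<eta>2 > 0" "\<forall>(I :: nat set) a b. finite I \<and> (\<forall>i\<in>I. a i \<le> b i \<and> {a i..b i} \<subseteq> S) \<and>
       disjoint_family_on (\<lambda>i. {a i<..<b i}) I \<and> (\<Sum>i\<in>I. b i - a i) < \<eta>2
       \<longrightarrow> (\<Sum>i\<in>I. \<bar>g (b i) - g (a i)\<bar>) < \<epsilon>'"
    using absolutely_continuous_fun_onD[OF assms(2) \<open>\<epsilon>' > 0\<close>] by blast
  have main: "(\<Sum>i<n. \<bar>F (b i) - F (a i)\<bar>) < \<epsilon>"
    if *: "\<forall>i<n. a i \<le> b i \<and> {a i..b i} \<subseteq> S" "disjoint_family_on (\<lambda>i. {a i<..<b i}) {..<n}"
      "(\<Sum>i<n. b i - a i) < min \<eta>1 \<eta>2" for n :: nat and a b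
  proof -
    have "(\<Sum>i<n. \<bar>F (b i) - F (a i)\<bar>) \<le> (\<Sum>i<n. M * (\<bar>f (b i) - f (a i)\<bar> + \<bar>g (b i) - g (a i)\<bar>))"
      using *(1) by (intro sum_mono le) (fastforce simp: subset_iff)+
    also have "\<dots> = M * ((\<Sum>i<n. \<bar>f (b i) - f (a i)\<bar>) + (\<Sum>i<n. \<bar>g (b i) - g (a i)\<bar>))"
      by (simp only: sum_distrib_left[symmetric] sum.distrib)
    also have "\<dots> \<le> M * (2 * \<epsilon>')"
    proof -
      have "(\<Sum>i<n. \<bar>f (b i) - f (a i)\<bar>) < \<epsilon>'" "(\<Sum>i<n. \<bar>g (b i) - g (a i)\<bar>) < \<epsilon>'"
        using * by (auto intro!: 1(2)[rule_format] 2(2)[rule_format])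
      then show ?thesis using \<open>M \<ge> 0\<close> by (intro mult_left_mono) auto
    qed
    also have "\<dots> < \<epsilon>" using \<open>\<epsilon> > 0\<close> \<open>M \<ge> 0\<close> by (simp add: \<epsilon>'_def field_simps)
    finally show ?thesis .
  qed
  show "\<exists>\<eta>>0. \<forall>(n::nat) a b. (\<forall>i<n. a i \<le> b i \<and> {a i..b i} \<subseteq> S) \<and>
        disjoint_family_on (\<lambda>i. {a i<..<b i}) {..<n} \<and> (\<Sum>i<n. b i - a i) < \<eta>
        \<longrightarrow> (\<Sum>i<n. \<bar>F (b i) - F (a i)\<bar>) < \<epsilon>"
  proof (intro exI[of _ "min \<eta>1 \<eta>2"] conjI allI impI; (elim conjE)?)
    show "0 < min \<eta>1 \<eta>2" using 1(1) 2(1) by simp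
  qed (rule main)
qed

lemma absolutely_continuous_ident: "absolutely_continuous_fun_on S (\<lambda>x. x)"
  unfolding absolutely_continuous_fun_on_def
proof (intro allI impI exI conjI; (elim conjE)?)
  fix \<epsilon> :: real and n :: nat and a b :: "nat \<Rightarrow> real"
  assume "\<forall>i<n. a i \<le> b i \<and> {a i..b i} \<subseteq> S" "(\<Sum>i<n. b i - a i) < \<epsilon>"
  moreover from this(1) have "(\<Sum>i<n. \<bar>b i - a i\<bar>) = (\<Sum>i<n. b i - a i)"
    by (intro sum.cong) auto
  ultimately show "(\<Sum>i<n. \<bar>b i - a i\<bar>) < \<epsilon>" by simp
qed

lemma absolutely_continuous_add:
  assumes "absolutely_continuous_fun_on S f" "absolutely_continuous_fun_on S g"
  shows "absolutely_continuous_fun_on S (\<lambda>x. f x + g x)"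
  by (rule absolutely_continuous_dominated[OF assms, of 1]) auto

lemma absolutely_continuous_mult:
  assumes "absolutely_continuous_fun_on {a..b} f" "absolutely_continuous_fun_on {a..b} g"
    "continuous_on {a..b} f" "continuous_on {a..b} g"
  shows "absolutely_continuous_fun_on {a..b} (\<lambda>x. f x * g x)"
proof -
  obtain Mf Mg where M: "\<And>x. x \<in> {a..b} \<Longrightarrow> \<bar>f x\<bar> \<le> Mf" "\<And>x. x \<in> {a..b} \<Longrightarrow> \<bar>g x\<bar> \<le> Mg"
    using compact_imp_bounded[OF compact_continuous_image[OF assms(3)]]
      compact_imp_bounded[OF compact_continuous_image[OF assms(4)]]
    by (fastforce simp: bounded_iff)
  define M where "M = max \<bar>Mf\<bar> \<bar>Mg\<bar>"
  show ?thesis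
  proof (rule absolutely_continuous_dominated[OF assms(1,2), of M])
    fix x y assume xy: "x \<in> {a..b}" "y \<in> {a..b}"
    have "f y * g y - f x * g x = g y * (f y - f x) + f x * (g y - g x)" by (simp add: algebra_simps)
    also have "\<bar>\<dots>\<bar> \<le> \<bar>g y\<bar> * \<bar>f y - f x\<bar> + \<bar>f x\<bar> * \<bar>g y - g x\<bar>"
      by (metis abs_mult abs_triangle_ineq)
    also have "\<dots> \<le> M * \<bar>f y - f x\<bar> + M * \<bar>g y - g x\<bar>"
      using M(1)[OF xy(1)] M(2)[OF xy(2)] by (intro add_mono mult_right_mono) (auto simp: M_def)
    finally show "\<bar>f y * g y - f x * g x\<bar> \<le> M * (\<bar>f y - f x\<bar> + \<bar>g y - g x\<bar>)" by (simp add: algebra_simps)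
  qed (simp add: M_def)
qed

lemma absolutely_continuous_C1:
  fixes f :: "real \<Rightarrow> real"
  assumes der: "\<And>x. x \<in> {a..b} \<Longrightarrow> (f has_real_derivative f' x) (at x within {a..b})"
    and "continuous_on {a..b} f'"
  shows "absolutely_continuous_fun_on {a..b} f"
proof -
  obtain M where M: "\<And>x. x \<in> {a..b} \<Longrightarrow> \<bar>f' x\<bar> \<le> M"
    using compact_imp_bounded[OF compact_continuous_image[OF assms(2)]] by (fastforce simp: bounded_iff)
  show ?thesis
  proof (rule absolutely_continuous_dominated[OF absolutely_continuous_ident absolutely_continuous_ident, of "\<bar>M\<bar>"])
    fix x y assume "x \<in> {a..b}" "y \<in> {a..b}"
    then have "\<bar>f y - f x\<bar> \<le> \<bar>M\<bar> * \<bar>y - x\<bar>"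
      using field_differentiable_bound[of "{a..b}" f f' "\<bar>M\<bar>" y x] der M by (force simp: abs_le_iff)
    also have "\<dots> \<le> \<bar>M\<bar> * (\<bar>y - x\<bar> + \<bar>y - x\<bar>)" by (intro mult_left_mono) auto
    finally show "\<bar>f y - f x\<bar> \<le> \<bar>M\<bar> * (\<bar>y - x\<bar> + \<bar>y - x\<bar>)" .
  qed simp
qed

section \<open>The scalar damped oscillator\<close>

text \<open>Exactly what a weak solution tested against an eigenvector provides, with
  \<open>h\<close> in the role of \<open>w'\<close>. The equation for \<open>h'\<close> holds almost
  everywhere and is supplemented by absolute continuity of \<open>h\<close>, which also suits a
  damping with jumps.\<close>

definition oscillator :: "real \<Rightarrow> (real \<Rightarrow> real) \<Rightarrow> (real \<Rightarrow> real) \<Rightarrow> (real \<Rightarrow> real) \<Rightarrow> bool" where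
  "oscillator l \<delta> w h \<longleftrightarrow>
     (\<forall>t\<ge>0. (w has_real_derivative h t) (at t within {0..})) \<and>
     continuous_on {0..} h \<and>
     (\<forall>T\<ge>0. absolutely_continuous_fun_on {0..T} h) \<and>
     (AE t in lebesgue. t \<ge> 0 \<longrightarrow>
        (h has_real_derivative - 2 * \<delta> t * h t - l\<^sup>2 * w t) (at t within {0..}))"

definition energy :: "real \<Rightarrow> (real \<Rightarrow> real) \<Rightarrow> (real \<Rightarrow> real) \<Rightarrow> real \<Rightarrow> real" where
  "energy l w h t = (h t)\<^sup>2 + l\<^sup>2 * (w t)\<^sup>2"

lemma energy_nonneg: "energy l w h t \<ge> 0"
  by (simp add: energy_def)

context
  fixes l \<delta> w h
  assumes osc: "oscillator l \<delta> w h"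
begin

text \<open>The functional is absolutely continuous, hence the sign of its almost everywhere derivative
  suffices; no regularity of \<open>\<delta>\<close> is involved.\<close>

lemma oscillator_antimono:
  fixes a b c d :: "real \<Rightarrow> real"
  assumes st: "0 \<le> s" "s \<le> t"
    and coeff: "\<And>x. (a has_real_derivative a' x) (at x)" "\<And>x. (b has_real_derivative b' x) (at x)"
      "\<And>x. (c has_real_derivative c' x) (at x)" "\<And>x. (d has_real_derivative d' x) (at x)"
    and cont: "continuous_on UNIV a'" "continuous_on UNIV b'" "continuous_on UNIV c'" "continuous_on UNIV d'"
    and le: "\<And>x h'. \<lbrakk>s \<le> x; x \<le> t; h' = - 2 * \<delta> x * h x - l\<^sup>2 * w x\<rbrakk> \<Longrightarrow>
        a' x * (h x)\<^sup>2 + a x * (2 * h x * h') + b' x * (w x)\<^sup>2 + b x * (2 * w x * h x)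
        + c' x * (w x * h x) + c x * ((h x)\<^sup>2 + w x * h') + d' x \<le> 0"
  shows "a t * (h t)\<^sup>2 + b t * (w t)\<^sup>2 + c t * (w t * h t) + d t \<le>
         a s * (h s)\<^sup>2 + b s * (w s)\<^sup>2 + c s * (w s * h s) + d s"
proof -
  let ?F = "\<lambda>x. a x * (h x * h x) + (b x * (w x * w x) + (c x * (w x * h x) + d x))"
  have sub: "{s..t} \<subseteq> {0..}" using st by auto
  have dw: "(w has_real_derivative h x) (at x within {s..t})" if "x \<in> {s..t}" for x
    using osc that st has_field_derivative_subset[OF _ sub] unfolding oscillator_def by auto
  have ch: "continuous_on {s..t} h"
    using osc sub continuous_on_subset unfolding oscillator_def by blast
  have cw: "continuous_on {s..t} w"
    using dw by (intro DERIV_continuous_on) auto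
  have ach: "absolutely_continuous_fun_on {s..t} h"
    using osc st absolutely_continuous_fun_on_subset[of "{0..t}" h "{s..t}"] unfolding oscillator_def by auto
  have acw: "absolutely_continuous_fun_on {s..t} w"
    by (rule absolutely_continuous_C1[OF dw ch])
  have C1: "absolutely_continuous_fun_on {s..t} f \<and> continuous_on {s..t} f"
    if "\<And>x. (f has_real_derivative f' x) (at x)" "continuous_on UNIV f'" for f f' :: "real \<Rightarrow> real"
  proof
    show "absolutely_continuous_fun_on {s..t} f"
      using that(1) continuous_on_subset[OF that(2)]
      by (intro absolutely_continuous_C1[of s t f f']) (auto intro: has_field_derivative_at_within)
    show "continuous_on {s..t} f"
      using that(1) by (intro DERIV_continuous_on) (auto intro: has_field_derivative_at_within)
  qed
  have "absolutely_continuous_fun_on {s..t} ?F"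
    using C1[OF coeff(1) cont(1)] C1[OF coeff(2) cont(2)] C1[OF coeff(3) cont(3)] C1[OF coeff(4) cont(4)]
      ach acw ch cw
    by (intro absolutely_continuous_add absolutely_continuous_mult continuous_on_mult) auto
  moreover have "AE x in lebesgue. x \<in> {s..t} \<longrightarrow> (\<exists>D\<le>0. (?F has_real_derivative D) (at x within {s..t}))"
  proof -
    have "AE x in lebesgue. x \<ge> 0 \<longrightarrow>
        (h has_real_derivative - 2 * \<delta> x * h x - l\<^sup>2 * w x) (at x within {0..})"
      using osc unfolding oscillator_def by blast
    then show ?thesis
    proof eventually_elim
      case (elim x)
      show ?case
      proof
        assume x: "x \<in> {s..t}"
        define h' where "h' = - 2 * \<delta> x * h x - l\<^sup>2 * w x"
        have dh: "(h has_real_derivative h') (at x within {s..t})"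
          using elim x st has_field_derivative_subset[OF _ sub] by (auto simp: h'_def)
        note D = dh dw[OF x] coeff[THEN has_field_derivative_at_within, of x "{s..t}"]
        let ?D = "a' x * (h x)\<^sup>2 + a x * (2 * h x * h') + b' x * (w x)\<^sup>2 + b x * (2 * w x * h x)
            + c' x * (w x * h x) + c x * ((h x)\<^sup>2 + w x * h') + d' x"
        have "(?F has_real_derivative ?D) (at x within {s..t})"
          by (rule derivative_eq_intros D refl)+ (simp add: algebra_simps power2_eq_square)
        moreover have "?D \<le> 0" using le[of x h'] x by (simp add: h'_def)
        ultimately show "\<exists>D\<le>0. (?F has_real_derivative D) (at x within {s..t})" by blast
      qed
    qed
  qed
  ultimately have "?F t \<le> ?F s"
    by (intro absolutely_continuous_antimono[of s t ?F] st)
  then show ?thesis by (simp add: power2_eq_square)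
qed

context
  assumes \<delta>: "\<And>t. t \<ge> 0 \<Longrightarrow> \<delta> t \<ge> 0"
begin

text \<open>The exchange terms cancel: the derivative of the energy is
  \<open>- 4 \<delta> h\<^sup>2\<close>.\<close>

lemma energy_antimono:
  assumes "0 \<le> s" "s \<le> t"
  shows "energy l w h t \<le> energy l w h s"
proof -
  have "1 * (h t)\<^sup>2 + l\<^sup>2 * (w t)\<^sup>2 + 0 * (w t * h t) + 0 \<le> 1 * (h s)\<^sup>2 + l\<^sup>2 * (w s)\<^sup>2 + 0 * (w s * h s) + 0"
  proof (rule oscillator_antimono[OF assms, where a="\<lambda>_. 1" and b="\<lambda>_. l\<^sup>2" and c="\<lambda>_. 0" and d="\<lambda>_. 0"
        and a'="\<lambda>_. 0" and b'="\<lambda>_. 0" and c'="\<lambda>_. 0" and d'="\<lambda>_. 0"])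
    fix x h' assume x: "s \<le> x" "x \<le> t" "h' = - 2 * \<delta> x * h x - l\<^sup>2 * w x"
    have "\<delta> x * (h x)\<^sup>2 \<ge> 0" using \<delta>[of x] x assms by simp
    then show "0 * (h x)\<^sup>2 + 1 * (2 * h x * h') + 0 * (w x)\<^sup>2 + l\<^sup>2 * (2 * w x * h x)
        + 0 * (w x * h x) + 0 * ((h x)\<^sup>2 + w x * h') + 0 \<le> 0"
      unfolding x(3) by (simp add: algebra_simps power2_eq_square)
  qed auto
  then show ?thesis by (simp add: energy_def)
qed

text \<open>\<open>2 l\<^sup>2 w h\<close> is the rate at which kinetic energy turns into potential
  energy and back. Its bound by the energy at an earlier time is the constant drift in the next
  three estimates.\<close>

lemma cross_term_le:
  assumes "0 \<le> s" "s \<le> x" "l > 0"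
  shows "\<bar>2 * l\<^sup>2 * (w x * h x)\<bar> \<le> l * energy l w h s"
proof -
  have "\<bar>2 * (l * w x) * h x\<bar> \<le> energy l w h x"
    using sum_squares_bound[of "\<bar>l * w x\<bar>" "\<bar>h x\<bar>"]
    by (simp add: energy_def abs_mult power_mult_distrib)
  also have "\<dots> \<le> energy l w h s" using energy_antimono assms by simp
  finally have "l * \<bar>2 * (l * w x) * h x\<bar> \<le> l * energy l w h s" using assms by simp
  then show ?thesis using \<open>l > 0\<close> by (simp add: abs_mult power2_eq_square ac_simps)
qed

text \<open>Damping only lowers \<open>h\<^sup>2\<close>, so its growth is at most the exchange
  rate. This covers stretches of a pulse on which the value of \<delta> is not known.\<close>

lemma kinetic_growth:
  assumes "0 \<le> s" "s \<le> t" "l > 0"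
  shows "(h t)\<^sup>2 \<le> (h s)\<^sup>2 + l * energy l w h s * (t - s)"
proof -
  let ?E = "l * energy l w h s"
  have "1 * (h t)\<^sup>2 + 0 * (w t)\<^sup>2 + 0 * (w t * h t) + - (?E * (t - s)) \<le>
     1 * (h s)\<^sup>2 + 0 * (w s)\<^sup>2 + 0 * (w s * h s) + - (?E * (s - s))"
  proof (rule oscillator_antimono[OF assms(1,2), where a="\<lambda>_. 1" and b="\<lambda>_. 0" and c="\<lambda>_. 0"
        and d="\<lambda>t. - (?E * (t - s))" and a'="\<lambda>_. 0" and b'="\<lambda>_. 0" and c'="\<lambda>_. 0" and d'="\<lambda>_. - ?E"])
    fix x h' assume x: "s \<le> x" "x \<le> t" "h' = - 2 * \<delta> x * h x - l\<^sup>2 * w x"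
    have "\<delta> x * (h x)\<^sup>2 \<ge> 0" using \<delta>[of x] x assms by simp
    moreover have "- (2 * l\<^sup>2 * (w x * h x)) \<le> ?E" using cross_term_le[of s x] x assms by simp
    ultimately show "0 * (h x)\<^sup>2 + 1 * (2 * h x * h') + 0 * (w x)\<^sup>2 + 0 * (2 * w x * h x)
        + 0 * (w x * h x) + 0 * ((h x)\<^sup>2 + w x * h') + - ?E \<le> 0"
      unfolding x(3) by (simp add: algebra_simps power2_eq_square)
  qed (auto intro!: derivative_eq_intros)
  then show ?thesis by simp
qed

lemma potential_growth:
  assumes "0 \<le> s" "s \<le> t" "l > 0"
  shows "l\<^sup>2 * (w t)\<^sup>2 \<le> l\<^sup>2 * (w s)\<^sup>2 + l * energy l w h s * (t - s)"
proof -
  let ?E = "l * energy l w h s"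
  have "0 * (h t)\<^sup>2 + l\<^sup>2 * (w t)\<^sup>2 + 0 * (w t * h t) + - (?E * (t - s)) \<le>
     0 * (h s)\<^sup>2 + l\<^sup>2 * (w s)\<^sup>2 + 0 * (w s * h s) + - (?E * (s - s))"
  proof (rule oscillator_antimono[OF assms(1,2), where a="\<lambda>_. 0" and b="\<lambda>_. l\<^sup>2" and c="\<lambda>_. 0"
        and d="\<lambda>t. - (?E * (t - s))" and a'="\<lambda>_. 0" and b'="\<lambda>_. 0" and c'="\<lambda>_. 0" and d'="\<lambda>_. - ?E"])
    fix x h' assume x: "s \<le> x" "x \<le> t" "h' = - 2 * \<delta> x * h x - l\<^sup>2 * w x"
    have "2 * l\<^sup>2 * (w x * h x) \<le> ?E" using cross_term_le[of s x] x assms by simp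
    then show "0 * (h x)\<^sup>2 + 0 * (2 * h x * h') + 0 * (w x)\<^sup>2 + l\<^sup>2 * (2 * w x * h x)
        + 0 * (w x * h x) + 0 * ((h x)\<^sup>2 + w x * h') + - ?E \<le> 0"
      by (simp add: algebra_simps)
  qed (auto intro!: derivative_eq_intros)
  then show ?thesis by simp
qed

text \<open>Integrating factor \<open>exp (4 * c * (x - s))\<close>. The exchange term is weighted
  by the largest value \<open>?e t\<close>, which makes the correction \<open>d\<close> linear and
  costs only \<open>l * (t - s)\<close>, harmless for a short pulse.\<close>

lemma kinetic_decay:
  assumes "0 \<le> s" "s \<le> t" "l > 0" "c \<ge> 0" and c: "\<And>x. s \<le> x \<Longrightarrow> x \<le> t \<Longrightarrow> \<delta> x = c"
  shows "(h t)\<^sup>2 \<le> (exp (- 4 * c * (t - s)) + l * (t - s)) * energy l w h s"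
proof -
  let ?E = "l * energy l w h s" and ?e = "\<lambda>x. exp (4 * c * (x - s))"
  have "?e t * (h t)\<^sup>2 + 0 * (w t)\<^sup>2 + 0 * (w t * h t) + - (?e t * ?E * (t - s)) \<le>
     ?e s * (h s)\<^sup>2 + 0 * (w s)\<^sup>2 + 0 * (w s * h s) + - (?e t * ?E * (s - s))"
  proof (rule oscillator_antimono[OF assms(1,2), where a="?e" and b="\<lambda>_. 0" and c="\<lambda>_. 0"
        and d="\<lambda>x. - (?e t * ?E * (x - s))" and a'="\<lambda>x. 4 * c * ?e x" and b'="\<lambda>_. 0" and c'="\<lambda>_. 0" and d'="\<lambda>_. - (?e t * ?E)"])
    fix x h' assume x: "s \<le> x" "x \<le> t" "h' = - 2 * \<delta> x * h x - l\<^sup>2 * w x"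
    have "- (2 * l\<^sup>2 * (w x * h x)) \<le> ?E" using cross_term_le[of s x] x assms by simp
    then have "?e x * - (2 * l\<^sup>2 * (w x * h x)) \<le> ?e x * ?E" by (intro mult_left_mono) auto
    also have "\<dots> \<le> ?e t * ?E"
    proof (rule mult_right_mono)
      show "?e x \<le> ?e t" using x(1,2) \<open>c \<ge> 0\<close> by (simp add: mult_left_mono)
      show "0 \<le> ?E" using energy_nonneg[of l w h s] \<open>l > 0\<close> by simp
    qed
    finally show "4 * c * ?e x * (h x)\<^sup>2 + ?e x * (2 * h x * h') + 0 * (w x)\<^sup>2 + 0 * (2 * w x * h x)
        + 0 * (w x * h x) + 0 * ((h x)\<^sup>2 + w x * h') + - (?e t * ?E) \<le> 0"
      unfolding x(3) c[OF x(1,2)] by (simp add: algebra_simps power2_eq_square)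
  qed (auto intro!: derivative_eq_intros continuous_intros)
  then have "?e t * (h t)\<^sup>2 \<le> (h s)\<^sup>2 + ?e t * ?E * (t - s)" by simp
  also have "\<dots> \<le> energy l w h s + ?e t * ?E * (t - s)" by (simp add: energy_def)
  finally have "exp (- 4 * c * (t - s)) * (?e t * (h t)\<^sup>2) \<le> exp (- 4 * c * (t - s)) * (energy l w h s + ?e t * ?E * (t - s))"
    by (intro mult_left_mono) auto
  moreover have e: "exp (- 4 * c * (t - s)) * (?e t * y) = y" for y
    by (simp add: mult.assoc[symmetric] exp_add[symmetric])
  moreover have "exp (- 4 * c * (t - s)) * (energy l w h s + ?e t * ?E * (t - s)) =
    exp (- 4 * c * (t - s)) * energy l w h s + exp (- 4 * c * (t - s)) * (?e t * (?E * (t - s)))"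
    by (simp add: distrib_left mult.assoc)
  ultimately have "(h t)\<^sup>2 \<le> exp (- 4 * c * (t - s)) * energy l w h s + ?E * (t - s)"
    by (simp only:)
  then show ?thesis by (simp add: distrib_left mult_ac)
qed

text \<open>For \<open>\<delta> \<equiv> c\<close> the functional \<open>F = h\<^sup>2 + l\<^sup>2 w\<^sup>2 + 2 c w h\<close> satisfies \<open>F' = -2 c F\<close> exactly,
  and it is comparable to the energy if \<open>l \<ge> 2 c\<close>.\<close>

lemma energy_decay:
  assumes "0 \<le> s" "s \<le> t" "c \<ge> 0" "l > 0" "l \<ge> 2 * c" and c: "\<And>x. s \<le> x \<Longrightarrow> x \<le> t \<Longrightarrow> \<delta> x = c"
  shows "energy l w h t \<le> 3 * exp (- 2 * c * (t - s)) * energy l w h s"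
proof -
  let ?e = "\<lambda>x. exp (2 * c * (x - s))" and ?F = "\<lambda>x. energy l w h x + 2 * c * (w x * h x)"
  have "?e t * (h t)\<^sup>2 + ?e t * l\<^sup>2 * (w t)\<^sup>2 + ?e t * (2 * c) * (w t * h t) + 0 \<le>
     ?e s * (h s)\<^sup>2 + ?e s * l\<^sup>2 * (w s)\<^sup>2 + ?e s * (2 * c) * (w s * h s) + 0"
  proof (rule oscillator_antimono[OF assms(1,2), where a="?e" and b="\<lambda>x. ?e x * l\<^sup>2" and c="\<lambda>x. ?e x * (2 * c)"
        and d="\<lambda>_. 0" and a'="\<lambda>x. 2 * c * ?e x" and b'="\<lambda>x. 2 * c * ?e x * l\<^sup>2" and c'="\<lambda>x. 2 * c * ?e x * (2 * c)" and d'="\<lambda>_. 0"])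
    fix x h' assume x: "s \<le> x" "x \<le> t" "h' = - 2 * \<delta> x * h x - l\<^sup>2 * w x"
    show "2 * c * ?e x * (h x)\<^sup>2 + ?e x * (2 * h x * h') + 2 * c * ?e x * l\<^sup>2 * (w x)\<^sup>2 + ?e x * l\<^sup>2 * (2 * w x * h x)
        + 2 * c * ?e x * (2 * c) * (w x * h x) + ?e x * (2 * c) * ((h x)\<^sup>2 + w x * h') + 0 \<le> 0"
      unfolding x(3) c[OF x(1,2)] by (simp add: algebra_simps power2_eq_square)
  qed (auto intro!: derivative_eq_intros continuous_intros)
  then have F: "?e t * ?F t \<le> ?F s" by (simp add: energy_def algebra_simps)
  \<comment> \<open>With \<open>l \<ge> 2 * c\<close> one gets
    \<open>E / 2 \<le> F \<le> 3 E / 2\<close>, the origin of the factor 3.\<close>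
  have comp: "\<bar>2 * c * (w x * h x)\<bar> \<le> energy l w h x / 2" for x
  proof -
    have "\<bar>2 * c * (w x * h x)\<bar> = 2 * c * \<bar>w x * h x\<bar>" using assms by (simp add: abs_mult)
    also have "\<dots> \<le> l * \<bar>w x * h x\<bar>" using assms by (intro mult_right_mono) auto
    also have "\<dots> = \<bar>l * w x\<bar> * \<bar>h x\<bar>" using assms by (simp add: abs_mult)
    also have "\<dots> \<le> energy l w h x / 2"
      using sum_squares_bound[of "\<bar>l * w x\<bar>" "\<bar>h x\<bar>"] by (simp add: energy_def power_mult_distrib)
    finally show ?thesis .
  qed
  have "?e t * energy l w h t \<le> ?e t * (2 * ?F t)"
    using comp[of t] by (intro mult_left_mono) (auto simp: abs_le_iff)
  also have "\<dots> = 2 * (?e t * ?F t)" by (rule mult.left_commute)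
  also have "\<dots> \<le> 2 * ?F s" using F by (rule mult_left_mono) simp
  also have "\<dots> \<le> 3 * energy l w h s" using comp[of s] by (auto simp: abs_le_iff)
  finally have "exp (- 2 * c * (t - s)) * (?e t * energy l w h t) \<le> exp (- 2 * c * (t - s)) * (3 * energy l w h s)"
    by (intro mult_left_mono) auto
  moreover have "exp (- 2 * c * (t - s)) * (?e t * y) = y" for y
    by (simp add: mult.assoc[symmetric] exp_add[symmetric])
  ultimately have "energy l w h t \<le> exp (- 2 * c * (t - s)) * (3 * energy l w h s)"
    by (simp only:)
  then show ?thesis by (simp add: mult_ac)
qed

end

text \<open>Without damping, \<open>(l w sin (l (x - s)) + h cos (l (x - s)))\<^sup>2\<close> is conserved.\<close>

lemma quarter_period:
  assumes "0 \<le> s" "l > 0" and c: "\<And>x. s \<le> x \<Longrightarrow> x \<le> s + pi / (2 * l) \<Longrightarrow> \<delta> x = 0"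
  shows "l\<^sup>2 * (w (s + pi / (2 * l)))\<^sup>2 \<le> (h s)\<^sup>2"
proof -
  let ?t = "s + pi / (2 * l)"
  let ?C = "\<lambda>x. cos (l * (x - s))" and ?S = "\<lambda>x. sin (l * (x - s))"
  have "?C ?t * ?C ?t * (h ?t)\<^sup>2 + l\<^sup>2 * (?S ?t * ?S ?t) * (w ?t)\<^sup>2 + 2 * l * (?S ?t * ?C ?t) * (w ?t * h ?t) + 0 \<le>
     ?C s * ?C s * (h s)\<^sup>2 + l\<^sup>2 * (?S s * ?S s) * (w s)\<^sup>2 + 2 * l * (?S s * ?C s) * (w s * h s) + 0"
  proof (rule oscillator_antimono[where a="\<lambda>x. ?C x * ?C x" and b="\<lambda>x. l\<^sup>2 * (?S x * ?S x)" and c="\<lambda>x. 2 * l * (?S x * ?C x)"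
        and d="\<lambda>_. 0" and a'="\<lambda>x. - 2 * l * (?S x * ?C x)" and b'="\<lambda>x. 2 * l * l\<^sup>2 * (?S x * ?C x)"
        and c'="\<lambda>x. 2 * l\<^sup>2 * (?C x * ?C x - ?S x * ?S x)" and d'="\<lambda>_. 0"])
    show "0 \<le> s" "s \<le> ?t" using assms by auto
    fix x h' assume x: "s \<le> x" "x \<le> ?t" "h' = - 2 * \<delta> x * h x - l\<^sup>2 * w x"
    show "- 2 * l * (?S x * ?C x) * (h x)\<^sup>2 + ?C x * ?C x * (2 * h x * h') + 2 * l * l\<^sup>2 * (?S x * ?C x) * (w x)\<^sup>2
        + l\<^sup>2 * (?S x * ?S x) * (2 * w x * h x)
        + 2 * l\<^sup>2 * (?C x * ?C x - ?S x * ?S x) * (w x * h x) + 2 * l * (?S x * ?C x) * ((h x)\<^sup>2 + w x * h') + 0 \<le> 0"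
      unfolding x(3) c[OF x(1,2)] by (simp add: algebra_simps power2_eq_square)
  qed (auto intro!: derivative_eq_intros continuous_intros simp: algebra_simps power2_eq_square)
  \<comment> \<open>\<open>?C\<close> is 1 at \<open>s\<close> and 0 at \<open>?t\<close>,
    \<open>?S\<close> the reverse: the conserved square is purely kinetic at the start and purely
    potential at the end.\<close>
  then show ?thesis using assms by simp
qed

end

section \<open>Damping profiles contracting given modes\<close>

text \<open>Vanishing on both outer half-lines, endpoints included, turns concatenation of blocks
  into a sum of translates, an operation that preserves smoothness and needs no case distinction at
  the joints.\<close>

definition profile :: "real \<Rightarrow> (real \<Rightarrow> real) \<Rightarrow> bool" where
  "profile T \<delta> \<longleftrightarrow> T > 0 \<and> (\<forall>t. \<delta> t \<ge> 0) \<and> (\<forall>t. t \<le> 0 \<or> T \<le> t \<longrightarrow> \<delta> t = 0)"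

text \<open>The window from \<open>s\<close> to \<open>s + T\<close> sits inside an arbitrary
  nonnegative damping \<open>\<delta>'\<close>, so the property of a block carries over to every
  damping assembled from it.\<close>

definition contracts :: "real \<Rightarrow> real \<Rightarrow> real \<Rightarrow> (real \<Rightarrow> real) \<Rightarrow> bool" where
  "contracts l q T \<delta> \<longleftrightarrow> (\<forall>\<delta>' w h s. oscillator l \<delta>' w h \<longrightarrow> (\<forall>t\<ge>0. \<delta>' t \<ge> 0) \<longrightarrow> s \<ge> 0 \<longrightarrow>
     (\<forall>t\<in>{0..T}. \<delta>' (s + t) = \<delta> t) \<longrightarrow> energy l w h (s + T) \<le> q * energy l w h s)"

definition append_profile :: "real \<Rightarrow> (real \<Rightarrow> real) \<Rightarrow> (real \<Rightarrow> real) \<Rightarrow> real \<Rightarrow> real" where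
  "append_profile T f g t = f t + g (t - T)"

lemma profile_append:
  "profile T f \<Longrightarrow> profile T' g \<Longrightarrow> profile (T + T') (append_profile T f g)"
  by (auto simp: profile_def append_profile_def)

lemma append_profile_left: "profile T' g \<Longrightarrow> t \<le> T \<Longrightarrow> append_profile T f g t = f t"
  by (auto simp: profile_def append_profile_def)

lemma append_profile_right: "profile T f \<Longrightarrow> t \<ge> 0 \<Longrightarrow> append_profile T f g (T + t) = g t"
  by (auto simp: profile_def append_profile_def)

lemma contractsD:
  assumes "contracts l q T \<delta>" "oscillator l \<delta>' w h" "\<And>t. t \<ge> 0 \<Longrightarrow> \<delta>' t \<ge> 0" "s \<ge> 0"
    "\<And>t. 0 \<le> t \<Longrightarrow> t \<le> T \<Longrightarrow> \<delta>' (s + t) = \<delta> t"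
  shows "energy l w h (s + T) \<le> q * energy l w h s"
  using assms unfolding contracts_def by simp

lemma contracts_mono:
  assumes "contracts l q T \<delta>" "q \<le> q'"
  shows "contracts l q' T \<delta>"
  unfolding contracts_def
proof (intro allI impI)
  fix \<delta>' w h s
  assume *: "oscillator l \<delta>' w h" "\<forall>t\<ge>0. \<delta>' t \<ge> 0" "s \<ge> 0" "\<forall>t\<in>{0..T}. \<delta>' (s + t) = \<delta> t"
  have "energy l w h (s + T) \<le> q * energy l w h s"
    using * by (intro contractsD[OF assms(1) *(1)]) auto
  also have "\<dots> \<le> q' * energy l w h s" using assms(2) energy_nonneg by (rule mult_right_mono)
  finally show "energy l w h (s + T) \<le> q' * energy l w h s" .
qed

lemma contracts_one: "T \<ge> 0 \<Longrightarrow> contracts l 1 T \<delta>"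
  unfolding contracts_def using energy_antimono by simp

lemma contracts_append:
  assumes "contracts l q T f" "contracts l q' T' g" "profile T f" "profile T' g" "q' \<ge> 0"
  shows "contracts l (q' * q) (T + T') (append_profile T f g)"
  unfolding contracts_def
proof (intro allI impI)
  fix \<delta>' w h s
  assume *: "oscillator l \<delta>' w h" "\<forall>t\<ge>0. \<delta>' t \<ge> 0" "s \<ge> 0"
    "\<forall>t\<in>{0..T + T'}. \<delta>' (s + t) = append_profile T f g t"
  have T: "T > 0" "T' > 0" using assms by (auto simp: profile_def)
  have "\<forall>t\<in>{0..T}. \<delta>' (s + t) = f t"
    using *(4) T append_profile_left[OF assms(4)] by simp
  then have 1: "energy l w h (s + T) \<le> q * energy l w h s"
    using *(2) by (intro contractsD[OF assms(1) *(1) _ *(3)]) auto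
  have "\<forall>t\<in>{0..T'}. \<delta>' ((s + T) + t) = g t"
  proof
    fix t assume "t \<in> {0..T'}"
    then show "\<delta>' ((s + T) + t) = g t"
      using *(4) T append_profile_right[OF assms(3), of t g] by (simp add: add.assoc)
  qed
  then have "energy l w h ((s + T) + T') \<le> q' * energy l w h (s + T)"
    using *(2,3) T by (intro contractsD[OF assms(2) *(1)]) auto
  also have "\<dots> \<le> q' * (q * energy l w h s)" using 1 assms(5) by (rule mult_left_mono)
  finally show "energy l w h (s + (T + T')) \<le> q' * q * energy l w h s" by (simp add: mult.assoc add.assoc)
qed

text \<open>On the outer thirds of the pulse only \<open>\<delta> \<ge> 0\<close> is known: the
  energy does not grow on the first, \<open>kinetic_decay\<close> acts on the middle one, and the
  last adds at most \<open>l * r / 3\<close> times the energy.\<close>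

lemma kinetic_after_bump:
  assumes "oscillator l \<delta> w h" "\<And>t. t \<ge> 0 \<Longrightarrow> \<delta> t \<ge> 0" "a \<ge> 0" "l > 0" "c \<ge> 0" "r > 0"
    and c: "\<And>x. r / 3 \<le> x \<Longrightarrow> x \<le> 2 * r / 3 \<Longrightarrow> \<delta> (a + x) = c"
  shows "(h (a + r))\<^sup>2 \<le> (exp (- 4 * c * r / 3) + l * r) * energy l w h a"
proof -
  let ?E = "energy l w h"
  have E: "?E (a + r / 3) \<le> ?E a" "?E (a + 2 * r / 3) \<le> ?E a"
    using assms by (auto intro!: energy_antimono[OF assms(1,2)])
  have "(h (a + r))\<^sup>2 \<le> (h (a + 2 * r / 3))\<^sup>2 + l * ?E (a + 2 * r / 3) * (a + r - (a + 2 * r / 3))"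
    using assms by (intro kinetic_growth[OF assms(1,2)]) auto
  also have "\<dots> = (h (a + 2 * r / 3))\<^sup>2 + (l * r / 3) * ?E (a + 2 * r / 3)" by (simp add: field_simps)
  also have "\<dots> \<le> (h (a + 2 * r / 3))\<^sup>2 + (l * r / 3) * ?E a"
    using E assms by (intro add_left_mono mult_left_mono) auto
  also have "(h (a + 2 * r / 3))\<^sup>2 \<le> (exp (- 4 * c * (a + 2 * r / 3 - (a + r / 3))) +
      l * (a + 2 * r / 3 - (a + r / 3))) * ?E (a + r / 3)"
  proof (rule kinetic_decay[OF assms(1,2)])
    fix x assume "a + r / 3 \<le> x" "x \<le> a + 2 * r / 3"
    then show "\<delta> x = c" using c[of "x - a"] by simp
  qed (use assms in auto)
  also have "a + 2 * r / 3 - (a + r / 3) = r / 3" by simp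
  also have "(exp (- 4 * c * (r / 3)) + l * (r / 3)) * ?E (a + r / 3) \<le> (exp (- 4 * c * (r / 3)) + l * (r / 3)) * ?E a"
    using E assms by (intro mult_left_mono add_nonneg_nonneg) auto
  finally have "(h (a + r))\<^sup>2 \<le> (exp (- 4 * c * (r / 3)) + l * (r / 3)) * ?E a + (l * r / 3) * ?E a"
    by simp
  also have "\<dots> = (exp (- 4 * c * r / 3) + l * (2 * r / 3)) * ?E a" by (simp add: algebra_simps)
  also have "\<dots> \<le> (exp (- 4 * c * r / 3) + l * r) * ?E a"
    using assms energy_nonneg by (intro mult_right_mono add_left_mono) auto
  finally show ?thesis .
qed

text \<open>The closure properties shared by smooth and piecewise constant functions, so that the
  construction is carried out once. \<open>bump\<close> leaves the outer thirds free for a smooth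
  rise and fall, and \<open>local\<close> admits an infinite concatenation, which agrees with a
  finite one on every left half-line.\<close>

locale damping_class =
  fixes C :: "(real \<Rightarrow> real) set"
  assumes zero: "(\<lambda>_. 0) \<in> C"
    and bump: "\<And>r c. r > 0 \<Longrightarrow> c \<ge> 0 \<Longrightarrow>
      \<exists>\<delta>\<in>C. profile r \<delta> \<and> (\<forall>t. r / 3 \<le> t \<and> t \<le> 2 * r / 3 \<longrightarrow> \<delta> t = c)"
    and add: "\<And>f g. f \<in> C \<Longrightarrow> g \<in> C \<Longrightarrow> (\<lambda>t. f t + g t) \<in> C"
    and shift: "\<And>f T. f \<in> C \<Longrightarrow> (\<lambda>t. f (t - T)) \<in> C"
    and local: "\<And>f. (\<And>n::nat. \<exists>g\<in>C. \<forall>t<real n. f t = g t) \<Longrightarrow> f \<in> C"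
begin

lemma append: "f \<in> C \<Longrightarrow> g \<in> C \<Longrightarrow> append_profile T f g \<in> C"
  using add[of f "\<lambda>t. g (t - T)"] shift[of g T] unfolding append_profile_def[abs_def] by simp

text \<open>The length bound does not involve \<open>q\<close>: a stronger contraction is bought by
  a larger value \<open>c\<close> on a shorter pulse, never by time.\<close>

lemma contract_one_mode:
  assumes "l > 0" "q > 0"
  shows "\<exists>T \<delta>. \<delta> \<in> C \<and> profile T \<delta> \<and> T \<le> 2 + pi / (2 * l) \<and> contracts l q T \<delta>"
proof -
  \<comment> \<open>\<open>r\<close> makes the drift \<open>l * r\<close> at most
    \<open>q / 6\<close>, and \<open>c\<close> gives \<open>4 * c * r / 3 = 6 / q\<close>, whence
    \<open>exp (- 6 / q) \<le> q / 6\<close>. In the final balance the kinetic energy gets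
    \<open>q / 3\<close> and the potential energy \<open>q / 3 + q / 6\<close>.\<close>
  define r where "r = min 1 (q / (6 * l))"
  define c where "c = 9 / (2 * q * r)"
  define P where "P = pi / (2 * l)"
  have r: "r > 0" "r \<le> 1" "l * r \<le> q / 6"
    using assms by (auto simp: r_def min_def field_simps)
  have P: "P > 0" using assms by (simp add: P_def)
  have "c > 0" using r assms by (simp add: c_def)
  have "exp (- 4 * c * r / 3) \<le> q / 6"
  proof -
    have "4 * c * r / 3 = 6 / q" using r assms by (simp add: c_def field_simps)
    then have "exp (- 4 * c * r / 3) = inverse (exp (6 / q))" by (simp add: exp_minus)
    also have "\<dots> \<le> inverse (6 / q)"
    proof (rule le_imp_inverse_le)
      show "6 / q \<le> exp (6 / q)" using exp_ge_add_one_self[of "6 / q"] by linarith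
    qed (use assms in simp)
    finally show ?thesis by simp
  qed
  then have \<epsilon>: "exp (- 4 * c * r / 3) + l * r \<le> q / 3" using r by simp
  obtain b where b: "b \<in> C" "profile r b" "\<And>t. r / 3 \<le> t \<Longrightarrow> t \<le> 2 * r / 3 \<Longrightarrow> b t = c"
    using bump[of r c] r \<open>c > 0\<close> by auto
  have z: "profile P (\<lambda>_. 0)" using P by (simp add: profile_def)
  define \<delta> where "\<delta> = append_profile r b (append_profile P (\<lambda>_. 0) b)"
  note pr = profile_append[OF z b(2)]
  have \<delta>: "\<delta> t = b t" "\<delta> (r + t') = append_profile P (\<lambda>_. 0) b t'" if "t \<le> r" "t' \<ge> 0" for t t'
    using append_profile_left[OF pr that(1)] append_profile_right[OF b(2) that(2)]
    unfolding \<delta>_def by auto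
  have \<delta>2: "\<delta> (r + t) = 0" if "0 \<le> t" "t \<le> P" for t
    using \<delta>(2)[of r t] append_profile_left[OF b(2) that(2), of "\<lambda>_. 0"] that by simp
  have \<delta>3: "\<delta> (r + P + t) = b t" if "0 \<le> t" for t
    using \<delta>(2)[of r "P + t"] append_profile_right[OF z that, of b] that P by (simp add: add.assoc)
  have "contracts l q (r + (P + r)) \<delta>"
    unfolding contracts_def
  proof (intro allI impI)
    fix \<delta>' w h s
    assume *: "oscillator l \<delta>' w h" "\<forall>t\<ge>0. \<delta>' t \<ge> 0" "s \<ge> 0"
      and eq: "\<forall>t\<in>{0..r + (P + r)}. \<delta>' (s + t) = \<delta> t"
    let ?E = "energy l w h"
    define a where "a = s + r"
    define a' where "a' = a + P"
    have nn: "\<And>t. t \<ge> 0 \<Longrightarrow> \<delta>' t \<ge> 0" using * by blast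
    have a: "a \<ge> 0" "a' \<ge> 0" "s \<le> a" "a \<le> a'" using * r P by (auto simp: a_def a'_def)
    have E: "?E a' \<le> ?E s" using a * by (intro energy_antimono[OF *(1) nn]) auto
    have "\<delta>' (s + x) = c" if "r / 3 \<le> x" "x \<le> 2 * r / 3" for x
    proof -
      have "\<delta>' (s + x) = \<delta> x" using eq[rule_format, of x] that r P by auto
      then show ?thesis using \<delta>(1)[of x 0] b(3)[OF that] that r by simp
    qed
    then have "(h (s + r))\<^sup>2 \<le> (exp (- 4 * c * r / 3) + l * r) * ?E s"
      using * assms \<open>c > 0\<close> r by (intro kinetic_after_bump[OF *(1) nn]) auto
    also have "\<dots> \<le> q / 3 * ?E s" using \<epsilon> energy_nonneg by (intro mult_right_mono) auto
    finally have 1: "(h a)\<^sup>2 \<le> q / 3 * ?E s" by (simp add: a_def)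
    have "\<delta>' x = 0" if "a \<le> x" "x \<le> a + pi / (2 * l)" for x
    proof -
      have "\<delta>' (s + (x - s)) = \<delta> (x - s)" using eq[rule_format, of "x - s"] that r P
        by (auto simp: a_def P_def)
      then show ?thesis using \<delta>2[of "x - a"] that by (simp add: a_def P_def)
    qed
    then have "l\<^sup>2 * (w (a + pi / (2 * l)))\<^sup>2 \<le> (h a)\<^sup>2"
      using a assms by (intro quarter_period[OF *(1)]) auto
    then have 2: "l\<^sup>2 * (w a')\<^sup>2 \<le> q / 3 * ?E s" using 1 by (simp add: a'_def P_def)
    have "\<delta>' (a' + x) = c" if "r / 3 \<le> x" "x \<le> 2 * r / 3" for x
    proof -
      have "\<delta>' (s + (r + P + x)) = \<delta> (r + P + x)" using eq[rule_format, of "r + P + x"] that r P by auto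
      then show ?thesis using \<delta>3[of x] b(3)[OF that] that r by (simp add: a_def a'_def add.assoc)
    qed
    then have "(h (a' + r))\<^sup>2 \<le> (exp (- 4 * c * r / 3) + l * r) * ?E a'"
      using * assms \<open>c > 0\<close> r a by (intro kinetic_after_bump[OF *(1) nn]) auto
    also have "\<dots> \<le> q / 3 * ?E s" using \<epsilon> energy_nonneg E assms by (intro mult_mono) auto
    finally have 3: "(h (a' + r))\<^sup>2 \<le> q / 3 * ?E s" .
    have "l\<^sup>2 * (w (a' + r))\<^sup>2 \<le> l\<^sup>2 * (w a')\<^sup>2 + l * ?E a' * (a' + r - a')"
      using a r assms by (intro potential_growth[OF *(1) nn]) auto
    also have "l * ?E a' * (a' + r - a') = (l * r) * ?E a'" by simp
    also have "\<dots> \<le> q / 6 * ?E s" using r energy_nonneg E assms by (intro mult_mono) auto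
    finally have "l\<^sup>2 * (w (a' + r))\<^sup>2 \<le> q / 3 * ?E s + q / 6 * ?E s" using 2 by simp
    then have "?E (a' + r) \<le> q / 3 * ?E s + (q / 3 * ?E s + q / 6 * ?E s)"
      unfolding energy_def[of l w h "a' + r"] using 3 by simp
    also have "\<dots> \<le> q * ?E s"
    proof -
      have "q / 3 + (q / 3 + q / 6) \<le> q" using assms by simp
      then have "(q / 3 + (q / 3 + q / 6)) * ?E s \<le> q * ?E s" using energy_nonneg by (rule mult_right_mono)
      then show ?thesis by (simp only: distrib_right)
    qed
    finally show "?E (s + (r + (P + r))) \<le> q * ?E s" by (simp add: a'_def a_def add.assoc)
  qed
  moreover have "\<delta> \<in> C" unfolding \<delta>_def using b(1) zero append by simp
  moreover have "profile (r + (P + r)) \<delta>" unfolding \<delta>_def using profile_append[OF b(2) pr] .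
  ultimately show ?thesis using r by (intro exI[of _ "r + (P + r)"] exI[of _ \<delta>]) (auto simp: P_def)
qed

text \<open>The order of the quantifiers matters: \<open>S\<close>, obtained by adding the durations
  over the modes, is fixed before \<open>q\<close>. By \<open>contracts_one\<close> a block made for
  one mode does no harm to the others.\<close>

lemma contract_finitely_many_modes:
  assumes "finite \<Lambda>" "\<And>l. l \<in> \<Lambda> \<Longrightarrow> l > 0"
  shows "\<exists>S\<ge>0. \<forall>q>0. \<exists>T \<delta>. \<delta> \<in> C \<and> profile T \<delta> \<and> T \<le> S \<and> (\<forall>l\<in>\<Lambda>. contracts l q T \<delta>)"
  using assms
proof (induction \<Lambda> rule: finite_induct)
  case empty
  have "profile 1 (\<lambda>_. 0)" by (simp add: profile_def)
  \<comment> \<open>A block has positive length even when there is nothing to contract, hence the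
    bound 1.\<close>
  then show ?case using zero by (intro exI[of _ 1]) auto
next
  case (insert l \<Lambda>)
  then obtain S where S: "S \<ge> 0"
    "\<And>q. q > 0 \<Longrightarrow> \<exists>T \<delta>. \<delta> \<in> C \<and> profile T \<delta> \<and> T \<le> S \<and> (\<forall>l\<in>\<Lambda>. contracts l q T \<delta>)"
    by (metis insertCI)
  have "l > 0" using insert by simp
  have "\<exists>T \<delta>. \<delta> \<in> C \<and> profile T \<delta> \<and> T \<le> S + (2 + pi / (2 * l)) \<and> (\<forall>l\<in>insert l \<Lambda>. contracts l q T \<delta>)"
    if q: "q > 0" for q
  proof -
    obtain T f where f: "f \<in> C" "profile T f" "T \<le> S" "\<forall>l\<in>\<Lambda>. contracts l q T f"
      using S(2)[OF q] by blast
    obtain T' g where g: "g \<in> C" "profile T' g" "T' \<le> 2 + pi / (2 * l)" "contracts l q T' g"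
      using contract_one_mode[OF \<open>l > 0\<close> q] by blast
    have T: "T > 0" "T' > 0" using f g by (auto simp: profile_def)
    have "contracts l (q * 1) (T + T') (append_profile T f g)"
      using f g T q by (intro contracts_append contracts_one) auto
    moreover have "contracts k (1 * q) (T + T') (append_profile T f g)" if "k \<in> \<Lambda>" for k
      using f g T that by (intro contracts_append contracts_one) auto
    ultimately have "\<forall>l\<in>insert l \<Lambda>. contracts l q (T + T') (append_profile T f g)" by simp
    then show ?thesis
      using f g append[of f g T] profile_append[OF f(2) g(2)]
      by (intro exI[of _ "T + T'"] exI[of _ "append_profile T f g"]) auto
  qed
  then show ?case using S(1) \<open>l > 0\<close> by (intro exI[of _ "S + (2 + pi / (2 * l))"]) auto
qed

text \<open>On the middle third, of length \<open>L / 3\<close>, a damping \<open>3 * R\<close>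
  yields the rate \<open>6 * R\<close>, that is \<open>exp (- 2 * R * L)\<close>: twice the exponent
  wanted for the plateau alone, which leaves room for the time \<open>T' \<le> S\<close> spent on
  the low modes. The threshold \<open>6 * R\<close> is the condition \<open>l \<ge> 2 * c\<close> of
  \<open>energy_decay\<close> with \<open>c = 3 * R\<close>.\<close>

lemma contract_all_modes:
  assumes "\<And>l. l \<in> \<Lambda> \<Longrightarrow> l > 0" "\<And>K. finite {l \<in> \<Lambda>. l < K}" "R \<ge> 1"
  shows "\<exists>T \<delta>. \<delta> \<in> C \<and> profile T \<delta> \<and> T \<ge> 1 \<and> (\<forall>l\<in>\<Lambda>. contracts l (exp (- R * T)) T \<delta>)"
proof -
  obtain S where S: "S \<ge> 0" "\<And>q. q > 0 \<Longrightarrow>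
     \<exists>T \<delta>. \<delta> \<in> C \<and> profile T \<delta> \<and> T \<le> S \<and> (\<forall>l\<in>{l \<in> \<Lambda>. l < 6 * R}. contracts l q T \<delta>)"
    using contract_finitely_many_modes[OF assms(2)[of "6 * R"]] assms(1) by auto
  \<comment> \<open>The 2 absorbs the factor 3:
    \<open>2 * R * L - R * (L + S) = 2 * R \<ge> 2\<close> and \<open>3 \<le> exp 2\<close>.\<close>
  define L where "L = S + 2"
  have L: "L \<ge> 2" using S by (simp add: L_def)
  obtain T' g where g: "g \<in> C" "profile T' g" "T' \<le> S"
    "\<forall>l\<in>{l \<in> \<Lambda>. l < 6 * R}. contracts l (exp (- R * (L + S))) T' g"
    using S(2)[of "exp (- R * (L + S))"] by auto
  obtain b where b: "b \<in> C" "profile L b" "\<And>t. L / 3 \<le> t \<Longrightarrow> t \<le> 2 * L / 3 \<Longrightarrow> b t = 3 * R"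
    using bump[of L "3 * R"] L assms by auto
  have T': "T' > 0" using g by (auto simp: profile_def)
  have le: "exp (- R * (L + S)) \<le> exp (- R * (L + T'))"
    using g assms by (simp add: mult_left_mono)
  have high: "contracts l (exp (- R * (L + S))) L b" if "l \<in> \<Lambda>" "l \<ge> 6 * R" for l
    unfolding contracts_def
  proof (intro allI impI)
    fix \<delta>' w h s
    assume *: "oscillator l \<delta>' w h" "\<forall>t\<ge>0. \<delta>' t \<ge> 0" "s \<ge> 0"
      and eq: "\<forall>t\<in>{0..L}. \<delta>' (s + t) = b t"
    let ?E = "energy l w h"
    have nn: "\<And>t. t \<ge> 0 \<Longrightarrow> \<delta>' t \<ge> 0" using * by blast
    have "?E (s + L) \<le> ?E (s + 2 * L / 3)" using L * by (intro energy_antimono[OF *(1) nn]) auto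
    also have "\<dots> \<le> 3 * exp (- 2 * (3 * R) * (s + 2 * L / 3 - (s + L / 3))) * ?E (s + L / 3)"
    proof (rule energy_decay[OF *(1) nn])
      fix x assume "s + L / 3 \<le> x" "x \<le> s + 2 * L / 3"
      then show "\<delta>' x = 3 * R" using eq[rule_format, of "x - s"] b(3)[of "x - s"] L by auto
    qed (use L * assms that in auto)
    also have "\<dots> = 3 * exp (- 2 * R * L) * ?E (s + L / 3)" by (simp add: field_simps)
    also have "\<dots> \<le> 3 * exp (- 2 * R * L) * ?E s"
      using L * by (intro mult_left_mono energy_antimono[OF *(1) nn]) auto
    also have "\<dots> \<le> exp (- R * (L + S)) * ?E s"
    proof (rule mult_right_mono[OF _ energy_nonneg])
      have "3 \<le> exp (2::real)" using exp_ge_add_one_self[of "2::real"] by simp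
      then have "3 * exp (- 2 * R * L) \<le> exp 2 * exp (- 2 * R * L)" by simp
      also have "\<dots> = exp (2 - 2 * R * L)" by (simp add: exp_add[symmetric])
      also have "\<dots> \<le> exp (- R * (L + S))"
      proof -
        have "R * L = R * S + 2 * R" by (simp add: L_def algebra_simps)
        then show ?thesis using assms(3) by (simp add: algebra_simps)
      qed
      finally show "3 * exp (- 2 * R * L) \<le> exp (- R * (L + S))" .
    qed
    finally show "?E (s + L) \<le> exp (- R * (L + S)) * ?E s" .
  qed
  have "contracts l (exp (- R * (L + T'))) (L + T') (append_profile L b g)" if "l \<in> \<Lambda>" for l
  proof (cases "l < 6 * R")
    case True
    have "contracts l (exp (- R * (L + S)) * 1) (L + T') (append_profile L b g)"
      using True that g b L by (intro contracts_append contracts_one) auto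
    then show ?thesis using le contracts_mono by simp
  next
    case False
    have "contracts l (1 * exp (- R * (L + S))) (L + T') (append_profile L b g)"
      using False that g b L T' high[of l] by (intro contracts_append contracts_one) auto
    then show ?thesis using le contracts_mono by simp
  qed
  then show ?thesis
    using append[OF b(1) g(1)] profile_append[OF b(2) g(2)] L T'
    by (intro exI[of _ "L + T'"] exI[of _ "append_profile L b g"]) auto
qed

end

section \<open>A damping for all modes\<close>

context damping_class
begin

text \<open>The block of rate \<open>m\<close> from \<open>contract_all_modes\<close> is repeated as long as the next blocks last longer
  than the number of blocks used so far; this keeps the length of each block small compared with
  the elapsed time.\<close>

lemma universal_damping:
  assumes "\<And>l. l \<in> \<Lambda> \<Longrightarrow> l > 0" "\<And>K. finite {l \<in> \<Lambda>. l < K}"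
  shows "\<exists>\<delta>\<in>C. \<exists>\<phi>. (\<forall>t. \<delta> t \<ge> 0) \<and> (\<forall>t. \<phi> t > 0) \<and> antimono_on {0..} \<phi> \<and>
     (\<forall>R>0. ((\<lambda>t. \<phi> t * exp (R * t)) \<longlongrightarrow> 0) at_top) \<and>
     (\<forall>l\<in>\<Lambda>. \<forall>w h. oscillator l \<delta> w h \<longrightarrow> (\<forall>t\<ge>0. energy l w h t \<le> \<phi> t * energy l w h 0))"
proof -
  \<comment> \<open>Rates start at 0 while \<open>contract_all_modes\<close> needs
    \<open>R \<ge> 1\<close>, so a block of rate \<open>Suc m\<close> is used at rate
    \<open>m\<close>.\<close>
  have "\<forall>m::nat. \<exists>T \<delta>. \<delta> \<in> C \<and> profile T \<delta> \<and> T \<ge> 1 \<and> (\<forall>l\<in>\<Lambda>. contracts l (exp (- real m * T)) T \<delta>)"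
  proof
    fix m :: nat
    obtain T \<delta> where *: "\<delta> \<in> C" "profile T \<delta>" "T \<ge> 1" "\<forall>l\<in>\<Lambda>. contracts l (exp (- real (Suc m) * T)) T \<delta>"
      using contract_all_modes[of \<Lambda> "real (Suc m)"] assms by auto
    have "exp (- real (Suc m) * T) \<le> exp (- real m * T)" using * by (simp add: algebra_simps)
    then have "\<forall>l\<in>\<Lambda>. contracts l (exp (- real m * T)) T \<delta>" using * contracts_mono by blast
    then show "\<exists>T \<delta>. \<delta> \<in> C \<and> profile T \<delta> \<and> T \<ge> 1 \<and> (\<forall>l\<in>\<Lambda>. contracts l (exp (- real m * T)) T \<delta>)"
      using * by blast
  qed
  then obtain T' d' where st: "\<And>m::nat. d' m \<in> C" "\<And>m. profile (T' m) (d' m)" "\<And>m. T' m \<ge> 1"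
      "\<And>m l. l \<in> \<Lambda> \<Longrightarrow> contracts l (exp (- real m * T' m)) (T' m) (d' m)"
    by metis
  \<comment> \<open>\<open>T' 0\<close> on the right keeps index 0 admissible for every
    \<open>n\<close>, and \<open>m \<le> n\<close> makes the set finite, so that the maximum exists.
    Each fixed \<open>k\<close> is admissible from some point on, hence \<open>m n\<close> tends to
    infinity.\<close>
  define M where "M n = {m. m \<le> n \<and> T' m \<le> real n + T' 0}" for n
  define m where "m n = Max (M n)" for n
  have M: "finite (M n)" "0 \<in> M n" for n by (auto simp: M_def)
  have m_le: "T' (m n) \<le> real n + T' 0" for n
  proof -
    have "m n \<in> M n" unfolding m_def using M[of n] by (intro Max_in) auto
    then show ?thesis by (simp add: M_def)
  qed
  have m_ge: "m n \<ge> k" if "real n \<ge> max (real k) (T' k)" for n k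
  proof -
    have "T' k \<le> real n + T' 0" using that st(3)[of 0] by simp
    then have "k \<in> M n" using that by (auto simp: M_def)
    then show ?thesis using M Max_ge by (simp add: m_def)
  qed
  define D where "D n = T' (m n)" for n
  define d where "d n = d' (m n)" for n
  define \<tau> where "\<tau> n = (\<Sum>j<n. D j)" for n
  \<comment> \<open>\<open>exp (- Q n)\<close> is the contraction guaranteed by the first
    \<open>n\<close> blocks, at time \<open>\<tau> n\<close>.\<close>
  define Q where "Q n = (\<Sum>j<n. real (m j) * D j)" for n
  have D: "D n \<ge> 1" for n by (simp add: D_def st)
  have pd: "profile (D n) (d n)" for n by (simp add: D_def d_def st)
  have \<tau>Suc: "\<tau> (Suc n) = \<tau> n + D n" for n by (simp add: \<tau>_def)
  have \<tau>mono: "\<tau> i \<le> \<tau> j" if "i \<le> j" for i j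
    using that by (rule lift_Suc_mono_le[rotated]) (use \<tau>Suc D in \<open>simp add: order_trans[OF zero_le_one]\<close>)
  have \<tau>ge: "\<tau> n \<ge> real n" for n
  proof (induction n)
    case (Suc n)
    then show ?case using \<tau>Suc[of n] D[of n] by simp
  qed (simp add: \<tau>_def)
  have Qmono: "Q i \<le> Q j" if "i \<le> j" for i j
    using that by (rule lift_Suc_mono_le[rotated])
      (use D in \<open>auto simp: Q_def intro!: mult_nonneg_nonneg intro: order_trans[OF zero_le_one]\<close>)
  \<comment> \<open>For \<open>t \<ge> 0\<close> this is the index of the block containing
    \<open>t\<close>; \<phi> will count completed blocks only, so it is a step function of
    \<open>t\<close>.\<close>
  define N where "N t = (LEAST n. t < \<tau> (Suc n))" for t
  have N: "t < \<tau> (Suc (N t))" for t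
  proof -
    obtain n :: nat where "t < real n" using reals_Archimedean2 by blast
    also have "\<dots> \<le> \<tau> (Suc n)" using \<tau>ge[of "Suc n"] by simp
    finally show ?thesis unfolding N_def by (rule LeastI)
  qed
  have Nle: "N t \<le> n" if "t < \<tau> (Suc n)" for n t
    using that unfolding N_def by (rule Least_le)
  have \<tau>N: "\<tau> (N t) \<le> t" if "t \<ge> 0" for t
  proof (cases "N t")
    case 0
    then show ?thesis using that by (simp add: \<tau>_def)
  next
    case (Suc n)
    then show ?thesis using Nle[of t n] by fastforce
  qed
  \<comment> \<open>Finite concatenations. Up to time \<open>\<tau> n\<close> the final damping
    coincides with \<open>G n\<close>, which is what \<open>local\<close> asks for.\<close>
  define G where "G n t = (\<Sum>j<n. d j (t - \<tau> j))" for n t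
  have d0: "d j (t - \<tau> j) = 0" if "t \<le> \<tau> j \<or> \<tau> (Suc j) \<le> t" for j t
    using pd[of j] that \<tau>Suc[of j] unfolding profile_def by (metis diff_le_eq diff_ge_0_iff_ge le_diff_eq add.commute add_0)
  have Geq: "G k' t = G k t" if "t \<le> \<tau> k" "k \<le> k'" for k k' t
    unfolding G_def
  proof (rule sum.mono_neutral_right)
    show "\<forall>i\<in>{..<k'} - {..<k}. d i (t - \<tau> i) = 0"
    proof (intro ballI d0 disjI1)
      fix i assume "i \<in> {..<k'} - {..<k}"
      then have "\<tau> k \<le> \<tau> i" by (intro \<tau>mono) auto
      then show "t \<le> \<tau> i" using that by simp
    qed
  qed (use that in auto)
  define \<delta> where "\<delta> t = G (Suc (N t)) t" for t
  have \<delta>G: "\<delta> t = G k t" if "t \<le> \<tau> k" for t k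
    using Geq[of t k "Suc (N t)"] Geq[of t "Suc (N t)" k] that N[of t] unfolding \<delta>_def
    by (cases "k \<le> Suc (N t)") auto
  have \<delta>d: "\<delta> (\<tau> n + t) = d n t" if "0 \<le> t" "t \<le> D n" for n t
  proof -
    have "\<delta> (\<tau> n + t) = G (Suc n) (\<tau> n + t)" using that \<tau>Suc by (intro \<delta>G) simp
    also have "\<dots> = (\<Sum>j<n. d j (\<tau> n + t - \<tau> j)) + d n t" by (simp add: G_def)
    also have "(\<Sum>j<n. d j (\<tau> n + t - \<tau> j)) = 0"
    proof (intro sum.neutral ballI d0 disjI2)
      fix j assume "j \<in> {..<n}"
      then have "\<tau> (Suc j) \<le> \<tau> n" by (intro \<tau>mono) auto
      then show "\<tau> (Suc j) \<le> \<tau> n + t" using that by simp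
    qed
    finally show ?thesis by simp
  qed
  have GC: "G n \<in> C" for n
  proof (induction n)
    case 0
    then show ?case using zero by (simp add: G_def[abs_def])
  next
    case (Suc n)
    have "(\<lambda>t. G n t + d n (t - \<tau> n)) \<in> C"
      using add[OF Suc shift[of "d n" "\<tau> n"]] st(1) by (simp add: d_def)
    then show ?case by (simp add: G_def[abs_def])
  qed
  have \<delta>C: "\<delta> \<in> C"
  proof (rule local)
    fix n :: nat
    have "\<forall>t<real n. \<delta> t = G n t"
    proof (intro allI impI \<delta>G)
      fix t assume "t < real n"
      then show "t \<le> \<tau> n" using \<tau>ge[of n] by simp
    qed
    then show "\<exists>g\<in>C. \<forall>t<real n. \<delta> t = g t" using GC by blast
  qed
  have \<delta>nn: "\<delta> t \<ge> 0" for t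
    unfolding \<delta>_def G_def using pd by (intro sum_nonneg) (auto simp: profile_def)
  define \<phi> where "\<phi> t = exp (- Q (N t))" for t
  have anti: "antimono_on {0..} \<phi>"
  proof (rule monotone_onI)
    fix s t :: real assume "s \<le> t"
    then have "N s \<le> N t" using N[of t] by (intro Nle) simp
    then show "\<phi> t \<le> \<phi> s" using Qmono by (simp add: \<phi>_def)
  qed
  have decay: "energy l w h t \<le> \<phi> t * energy l w h 0" if "l \<in> \<Lambda>" "oscillator l \<delta> w h" "t \<ge> 0" for l w h t
  proof -
    have *: "energy l w h (\<tau> n) \<le> exp (- Q n) * energy l w h 0" for n
    proof (induction n)
      case 0
      then show ?case by (simp add: \<tau>_def Q_def)
    next
      case (Suc n)
      have "energy l w h (\<tau> n + D n) \<le> exp (- real (m n) * D n) * energy l w h (\<tau> n)"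
      proof (rule contractsD[OF _ that(2)])
        show "contracts l (exp (- real (m n) * D n)) (D n) (d n)"
          unfolding D_def d_def using st(4)[OF that(1)] .
        show "\<tau> n \<ge> 0" using \<tau>ge[of n] by (meson of_nat_0_le_iff order_trans)
      qed (use \<delta>d \<delta>nn in auto)
      also have "\<dots> \<le> exp (- real (m n) * D n) * (exp (- Q n) * energy l w h 0)"
        using Suc by (intro mult_left_mono) auto
      also have "\<dots> = exp (- Q (Suc n)) * energy l w h 0"
        by (simp add: Q_def exp_add[symmetric] mult.assoc[symmetric])
      finally show ?case by (simp add: \<tau>Suc)
    qed
    have "energy l w h t \<le> energy l w h (\<tau> (N t))"
      using \<tau>N[OF that(3)] \<tau>ge[of "N t"] \<delta>nn
      by (intro energy_antimono[OF that(2)]) (auto intro: order_trans[OF of_nat_0_le_iff])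
    then show ?thesis using *[of "N t"] by (simp add: \<phi>_def)
  qed
  have lim: "((\<lambda>t. \<phi> t * exp (R * t)) \<longlongrightarrow> 0) at_top" if "R > 0" for R
  proof -
    define k where "k = nat \<lceil>2 * R + 1\<rceil>"
    define n0 where "n0 = nat \<lceil>max (real k) (T' k)\<rceil>"
    have mk: "real (m j) - 2 * R \<ge> 1" if "j \<ge> n0" for j
    proof -
      have "real j \<ge> real n0" using that by simp
      also have "real n0 \<ge> max (real k) (T' k)" unfolding n0_def by linarith
      finally have "m j \<ge> k" by (rule m_ge)
      then have "real (m j) \<ge> real k" by simp
      also have "real k \<ge> 2 * R + 1" unfolding k_def by linarith
      finally show ?thesis by simp
    qed
    \<comment> \<open>Since
      \<open>t \<le> \<tau> (N t) + D (N t) \<le> 2 \<tau> (N t) + T' 0\<close>, the weight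
      \<open>R t\<close> is charged as \<open>2 R \<tau>\<close>. One step changes \<open>f\<close>
      by \<open>1 - (m - 2 R) D\<close>, which is at most 0 once \<open>m \<ge> 2 R + 1\<close>; the
      term \<open>n\<close> leaves a factor \<open>exp (- N t)\<close> that tends to 0.\<close>
    define f where "f n = 2 * R * \<tau> n - Q n + real n" for n
    have f: "f n \<le> f n0" if "n \<ge> n0" for n
      using that
    proof (induction n rule: dec_induct)
      case (step n)
      have "f (Suc n) = f n - ((real (m n) - 2 * R) * D n - 1)"
        by (simp add: f_def \<tau>_def Q_def algebra_simps)
      moreover have "1 * 1 \<le> (real (m n) - 2 * R) * D n"
        using mk[OF step(1)] D[of n] by (intro mult_mono) auto
      ultimately show ?case using step.IH by simp
    qed simp
    define K where "K = R * T' 0 + f n0"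
    have bound: "\<phi> t * exp (R * t) \<le> exp (K - real (N t))" if t: "t \<ge> 0" "N t \<ge> n0" for t
    proof -
      have "t \<le> \<tau> (N t) + D (N t)" using N[of t] \<tau>Suc by simp
      also have "D (N t) \<le> \<tau> (N t) + T' 0" using m_le[of "N t"] \<tau>ge[of "N t"] by (simp add: D_def)
      finally have "R * t \<le> R * (2 * \<tau> (N t) + T' 0)" using \<open>R > 0\<close> by (intro mult_left_mono) auto
      then have "- Q (N t) + R * t \<le> K - real (N t)"
        using f[OF t(2)] by (simp add: K_def f_def algebra_simps)
      then show ?thesis by (simp add: \<phi>_def exp_add[symmetric])
    qed
    have Nge: "N t \<ge> n" if "t \<ge> \<tau> n" for n t
    proof (rule ccontr)
      assume "\<not> n \<le> N t"
      then have "\<tau> (Suc (N t)) \<le> \<tau> n" by (intro \<tau>mono) simp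
      then show False using N[of t] that by simp
    qed
    have "filterlim N at_top at_top"
      unfolding filterlim_at_top using Nge eventually_ge_at_top eventually_mono by (metis (mono_tags, lifting))
    then have "filterlim (\<lambda>t. real (N t)) at_top at_top"
      by (rule filterlim_compose[OF filterlim_real_sequentially])
    then have "filterlim (\<lambda>t. - real (N t)) at_bot at_top"
      by (rule filterlim_compose[OF filterlim_uminus_at_bot_at_top])
    then have "((\<lambda>t. exp (- real (N t))) \<longlongrightarrow> 0) at_top"
      by (rule filterlim_compose[OF exp_at_bot])
    then have "((\<lambda>t. exp K * exp (- real (N t))) \<longlongrightarrow> 0) at_top"
      by (rule tendsto_mult_right_zero)
    then have "((\<lambda>t. exp (K - real (N t))) \<longlongrightarrow> 0) at_top"
      by (simp add: exp_add[symmetric])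
    with tendsto_const show ?thesis
    proof (rule tendsto_sandwich[rotated 2])
      show "\<forall>\<^sub>F t in at_top. 0 \<le> \<phi> t * exp (R * t)" by (simp add: \<phi>_def)
      show "\<forall>\<^sub>F t in at_top. \<phi> t * exp (R * t) \<le> exp (K - real (N t))"
        using eventually_ge_at_top[of "max 0 (\<tau> n0)"] by eventually_elim (auto intro: bound Nge)
    qed
  qed
  show ?thesis
    using \<delta>C \<delta>nn anti decay lim by (intro bexI[of _ \<delta>] exI[of _ \<phi>]) (auto simp: \<phi>_def)
qed

end

section \<open>Smooth and piecewise constant dampings\<close>

text \<open>On the whole line rather than the half-line, since translates must stay in the class. An
  explicit sequence of derivatives reduces each closure property to writing down a new
  sequence.\<close>

definition smooth_on_reals :: "(real \<Rightarrow> real) \<Rightarrow> bool" where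
  "smooth_on_reals f \<longleftrightarrow> (\<exists>d :: nat \<Rightarrow> real \<Rightarrow> real. d 0 = f \<and>
     (\<forall>n x. (d n has_real_derivative d (Suc n) x) (at x)))"

lemma smooth_on_realsI:
  "d 0 = f \<Longrightarrow> (\<And>n x. (d n has_real_derivative d (Suc n) x) (at x)) \<Longrightarrow> smooth_on_reals f"
  unfolding smooth_on_reals_def by blast

lemma smooth_on_reals_imp_halfline: "smooth_on_reals f \<Longrightarrow> smooth_on_halfline f"
  unfolding smooth_on_reals_def smooth_on_halfline_def
  using has_field_derivative_at_within by blast

lemma smooth_on_reals_const: "smooth_on_reals (\<lambda>_. c)"
  by (rule smooth_on_realsI[of "\<lambda>n x. if n = 0 then c else 0"]) auto

lemma smooth_on_reals_add:
  assumes "smooth_on_reals f" "smooth_on_reals g"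
  shows "smooth_on_reals (\<lambda>x. f x + g x)"
proof -
  obtain d e where "d 0 = f" "e 0 = g" "\<And>n x. (d n has_real_derivative d (Suc n) x) (at x)"
    "\<And>n x. (e n has_real_derivative e (Suc n) x) (at x)"
    using assms unfolding smooth_on_reals_def by metis
  then show ?thesis
    by (intro smooth_on_realsI[of "\<lambda>n x. d n x + e n x"] DERIV_add) auto
qed

lemma smooth_on_reals_affine:
  assumes "smooth_on_reals f"
  shows "smooth_on_reals (\<lambda>x. c * f (a * x + b))"
proof -
  obtain d where "d 0 = f" and d: "\<And>n x. (d n has_real_derivative d (Suc n) x) (at x)"
    using assms unfolding smooth_on_reals_def by metis
  show ?thesis
  proof (rule smooth_on_realsI[of "\<lambda>n x. c * a ^ n * d n (a * x + b)"])
    show "((\<lambda>x. c * a ^ n * d n (a * x + b)) has_real_derivative c * a ^ Suc n * d (Suc n) (a * x + b)) (at x)" for n x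
      by (rule derivative_eq_intros DERIV_chain2[OF d] refl)+ simp
  qed (simp add: \<open>d 0 = f\<close>)
qed

lemma smooth_on_reals_mult:
  assumes "smooth_on_reals f" "smooth_on_reals g"
  shows "smooth_on_reals (\<lambda>x. f x * g x)"
proof -
  obtain d e where 0: "d 0 = f" "e 0 = g" and d: "\<And>n x. (d n has_real_derivative d (Suc n) x) (at x)"
    and e: "\<And>n x. (e n has_real_derivative e (Suc n) x) (at x)"
    using assms unfolding smooth_on_reals_def by metis
  \<comment> \<open>Differentiating the Leibniz sum of order \<open>n\<close> gives that of order
    \<open>Suc n\<close>, by Pascal's identity.\<close>
  have leibniz: "(\<Sum>i\<le>n. real (n choose i) * (d (Suc i) x * e (n - i) x + d i x * e (Suc (n - i)) x)) =
    (\<Sum>i\<le>Suc n. real (Suc n choose i) * (d i x * e (Suc n - i) x))" for n x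
  proof -
    have "(\<Sum>i\<le>Suc n. real (Suc n choose i) * (d i x * e (Suc n - i) x)) =
       d 0 x * e (Suc n) x + (\<Sum>i\<le>n. real (Suc n choose Suc i) * (d (Suc i) x * e (n - i) x))"
      by (subst sum.atMost_Suc_shift) simp
    also have "(\<Sum>i\<le>n. real (Suc n choose Suc i) * (d (Suc i) x * e (n - i) x)) =
      (\<Sum>i\<le>n. real (n choose i) * (d (Suc i) x * e (n - i) x)) +
      (\<Sum>i\<le>n. real (n choose Suc i) * (d (Suc i) x * e (n - i) x))"
      by (simp add: sum.distrib[symmetric] distrib_right)
    also have "(\<Sum>i\<le>n. real (n choose i) * (d i x * e (Suc (n - i)) x)) =
       (\<Sum>i\<le>Suc n. real (n choose i) * (d i x * e (Suc n - i) x))"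
      by (simp add: Suc_diff_le)
    then have "(\<Sum>i\<le>n. real (n choose Suc i) * (d (Suc i) x * e (n - i) x)) + d 0 x * e (Suc n) x =
       (\<Sum>i\<le>n. real (n choose i) * (d i x * e (Suc (n - i)) x))"
      by (simp add: sum.atMost_Suc_shift del: sum.atMost_Suc)
    ultimately show ?thesis by (simp add: distrib_left sum.distrib)
  qed
  show ?thesis
  proof (rule smooth_on_realsI[of "\<lambda>n x. \<Sum>i\<le>n. real (n choose i) * (d i x * e (n - i) x)"])
    show "((\<lambda>x. \<Sum>i\<le>n. real (n choose i) * (d i x * e (n - i) x)) has_real_derivative
       (\<Sum>i\<le>Suc n. real (Suc n choose i) * (d i x * e (Suc n - i) x))) (at x)" for n x
      unfolding leibniz[symmetric]
      by (rule derivative_eq_intros d e refl)+ (simp add: algebra_simps)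
  qed (simp add: 0)
qed

lemma smooth_on_reals_integral:
  assumes "smooth_on_reals f" "\<And>x. (F has_real_derivative f x) (at x)"
  shows "smooth_on_reals F"
proof -
  obtain d where 0: "d 0 = f" and d: "\<And>n x. (d n has_real_derivative d (Suc n) x) (at x)"
    using assms unfolding smooth_on_reals_def by metis
  have "((case n of 0 \<Rightarrow> F | Suc m \<Rightarrow> d m) has_real_derivative d n x) (at x)" for n x
    using 0 d assms(2) by (cases n) auto
  then show ?thesis
    by (intro smooth_on_realsI[of "\<lambda>n. case n of 0 \<Rightarrow> F | Suc m \<Rightarrow> d m"]) auto
qed

text \<open>Two local representatives agree on an open half-line, hence so do all their derivatives
  there. The derivatives at a point may thus be read off from any representative valid beyond
  it.\<close>

lemma smooth_on_reals_local:
  assumes "\<And>n::nat. \<exists>g. smooth_on_reals g \<and> (\<forall>t<real n. f t = g t)"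
  shows "smooth_on_reals f"
proof -
  have "\<forall>n::nat. \<exists>d. (\<forall>t<real n. f t = d 0 t) \<and> (\<forall>k x. (d k has_real_derivative d (Suc k) x) (at x))"
    using assms unfolding smooth_on_reals_def by metis
  then obtain d where d0: "\<And>n t. t < real n \<Longrightarrow> f t = d n 0 t"
    and d: "\<And>n k x. (d n k has_real_derivative d n (Suc k) x) (at x)"
    by metis
  have agree: "d n k t = d n' k t" if "t < real n" "t < real n'" for n n' k t
    using that
  proof (induction k arbitrary: t)
    case 0
    then show ?case using d0 by metis
  next
    case (Suc k)
    have "(d n' k has_real_derivative d n (Suc k) t) (at t)"
    proof (rule has_field_derivative_transform_within_open[OF d[of n k t]])
      show "open {..<min (real n) (real n')}" "t \<in> {..<min (real n) (real n')}"
        using Suc.prems by auto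
      show "d n k x = d n' k x" if "x \<in> {..<min (real n) (real n')}" for x
        using that by (intro Suc.IH) auto
    qed
    then show ?case using DERIV_unique[OF d[of n' k t]] by simp
  qed
  define N where "N t = nat \<lceil>t\<rceil> + 1" for t :: real
  have N: "t < real (N t)" for t unfolding N_def by linarith
  show ?thesis
  proof (rule smooth_on_realsI[of "\<lambda>k t. d (N t) k t"])
    show "(\<lambda>t. d (N t) 0 t) = f" using d0[OF N] by auto
    show "((\<lambda>t. d (N t) k t) has_real_derivative d (N x) (Suc k) x) (at x)" for k x
    proof (rule has_field_derivative_transform_within_open[OF d[of "N x" k x]])
      show "open {..<real (N x)}" "x \<in> {..<real (N x)}" using N by auto
      show "d (N x) k y = d (N y) k y" if "y \<in> {..<real (N x)}" for y
        using that by (intro agree N) simp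
    qed
  qed
qed

section \<open>Flat exponentials and a smooth plateau\<close>

definition flat_exp :: "real poly \<Rightarrow> real \<Rightarrow> real" where
  "flat_exp p x = (if x \<le> 0 then 0 else poly p (1 / x) * exp (- (1 / x)))"

lemma flat_exp_tendsto: "((\<lambda>x. poly p (1 / x) * exp (- (1 / x))) \<longlongrightarrow> 0) (at_right (0::real))"
proof -
  have "((\<lambda>y. \<Sum>i\<le>degree p. coeff p i * (y ^ i / exp y)) \<longlongrightarrow> (\<Sum>i\<le>degree p. coeff p i * 0)) at_top"
    by (intro tendsto_sum tendsto_mult tendsto_const tendsto_power_div_exp_0)
  then have "((\<lambda>y. poly p y * exp (- y)) \<longlongrightarrow> 0) at_top"
    by (simp add: poly_altdef sum_distrib_right exp_minus divide_inverse mult.assoc)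
  then have "((\<lambda>x. poly p (inverse x) * exp (- (inverse x))) \<longlongrightarrow> 0) (at_right (0::real))"
    by (rule filterlim_compose[OF _ filterlim_inverse_at_top_right])
  then show ?thesis by (simp add: inverse_eq_divide)
qed

text \<open>With \<open>y = 1 / x\<close> the derivative of \<open>p(y) exp (- y)\<close> is
  \<open>y\<^sup>2 (p(y) - p'(y)) exp (- y)\<close>, so the family indexed by polynomials is closed
  under differentiation; \<open>[:0, 0, 1:]\<close> is the factor \<open>y\<^sup>2\<close>.\<close>

lemma flat_exp_derivative:
  "(flat_exp p has_real_derivative flat_exp ([:0, 0, 1:] * (p - pderiv p)) x) (at x)"
proof -
  consider "x < 0" | "x > 0" | "x = 0" by linarith
  then show ?thesis
  proof cases
    case 1
    have "((\<lambda>_. 0) has_real_derivative 0) (at x)" by simp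
    then have "(flat_exp p has_real_derivative 0) (at x)"
      by (rule has_field_derivative_transform_within_open[where S="{..<0}"]) (use 1 in \<open>auto simp: flat_exp_def\<close>)
    then show ?thesis using 1 by (simp add: flat_exp_def)
  next
    case 2
    have "((\<lambda>x. poly p (1 / x) * exp (- (1 / x))) has_real_derivative
        flat_exp ([:0, 0, 1:] * (p - pderiv p)) x) (at x)"
      using 2 by (auto intro!: derivative_eq_intros DERIV_chain2[OF poly_DERIV]
          simp: flat_exp_def field_simps power2_eq_square)
    then show ?thesis
      by (rule has_field_derivative_transform_within_open[where S="{0<..}"]) (use 2 in \<open>auto simp: flat_exp_def\<close>)
  next
    case 3
    have "((\<lambda>h. (flat_exp p h - flat_exp p 0) / (h - 0)) \<longlongrightarrow> 0) (at 0)"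
    proof (rule filterlim_split_at)
      show "((\<lambda>h. (flat_exp p h - flat_exp p 0) / (h - 0)) \<longlongrightarrow> 0) (at_left 0)"
        by (rule tendsto_eventually) (auto simp: flat_exp_def eventually_at_left_field intro: exI[of _ "-1"])
      \<comment> \<open>The difference quotient at 0 is again of this form, with the polynomial
        \<open>y p(y)\<close> in place of \<open>p(y)\<close>.\<close>
      have "\<forall>\<^sub>F h in at_right 0. poly (pCons 0 p) (1 / h) * exp (- (1 / h)) = (flat_exp p h - flat_exp p 0) / (h - 0)"
        by (auto simp: flat_exp_def eventually_at_right_field intro!: exI[of _ 1])
      then show "((\<lambda>h. (flat_exp p h - flat_exp p 0) / (h - 0)) \<longlongrightarrow> 0) (at_right 0)"
        using flat_exp_tendsto by (rule Lim_transform_eventually[rotated])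
    qed
    then show ?thesis using 3 by (simp add: has_field_derivative_iff flat_exp_def)
  qed
qed

lemma smooth_on_reals_flat_exp: "smooth_on_reals (flat_exp p)"
  by (rule smooth_on_realsI[of "\<lambda>n. flat_exp (((\<lambda>p. [:0, 0, 1:] * (p - pderiv p)) ^^ n) p)"])
    (simp_all add: flat_exp_derivative del: mult_pCons_left)

text \<open>A bump \<open>b\<close> on the unit interval has a primitive \<open>B\<close> that
  climbs from one constant to another; \<open>B (3 * x) - B (3 * x - 2)\<close>, normalised by
  \<open>k\<close>, rises on the first third, is constant on the middle one and falls on the last.
  Monotonicity of \<open>B\<close> gives the sign.\<close>

lemma smooth_plateau_exists:
  "\<exists>\<psi>. smooth_on_reals \<psi> \<and> (\<forall>x. \<psi> x \<ge> 0) \<and> (\<forall>x. x \<le> 0 \<or> x \<ge> 1 \<longrightarrow> \<psi> x = 0) \<and>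
     (\<forall>x. 1 / 3 \<le> x \<and> x \<le> 2 / 3 \<longrightarrow> \<psi> x = 1)"
proof -
  \<comment> \<open>\<open>flat_exp 1 x * flat_exp 1 (1 - x)\<close>, with trivial coefficients to
    match \<open>smooth_on_reals_affine\<close>.\<close>
  define b where "b x = flat_exp 1 x * (1 * flat_exp 1 (- 1 * x + 1))" for x
  have b: "smooth_on_reals b"
    unfolding b_def[abs_def] by (intro smooth_on_reals_mult smooth_on_reals_affine smooth_on_reals_flat_exp)
  have bpos: "b x > 0" if "0 < x" "x < 1" for x using that by (simp add: b_def flat_exp_def)
  have b0: "b x = 0" if "x \<le> 0 \<or> x \<ge> 1" for x using that by (auto simp: b_def flat_exp_def)
  have bnn: "b x \<ge> 0" for x by (cases "x \<le> 0 \<or> x \<ge> 1") (simp_all add: b0 bpos less_imp_le)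
  obtain b' where b': "\<And>x. (b has_real_derivative b' x) (at x)"
    using b unfolding smooth_on_reals_def by metis
  then have cont: "continuous_on S b" for S
    by (intro continuous_at_imp_continuous_on ballI DERIV_isCont)
  define B where "B x = (LBINT y=0..x. b y)" for x :: real
  have B: "(B has_real_derivative b x) (at x)" for x
  proof -
    \<comment> \<open>The interval must contain the base point 0 and have \<open>x\<close> in its
      interior, so that the derivative within it is a full one.\<close>
    let ?l = "min 0 x - 1" and ?u = "max 0 x + 1"
    have "((\<lambda>u. LBINT y=0..u. b y) has_vector_derivative b x) (at x within {?l..?u})"
      by (rule interval_integral_FTC2[of ?l 0 ?u b x, unfolded zero_ereal_def[symmetric]]) (auto intro: cont)
    moreover have "at x within {?l..?u} = at x" by (rule at_within_interior) auto
    ultimately show ?thesis by (simp add: B_def[abs_def] has_real_derivative_iff_has_vector_derivative)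
  qed
  have Bmono: "B x \<le> B y" if "x \<le> y" for x y
  proof (rule DERIV_nonneg_imp_nondecreasing[OF that, of B])
    show "\<exists>y. (B has_real_derivative y) (at z) \<and> 0 \<le> y" for z using B[of z] bnn[of z] by blast
  qed
  have Bconst: "B y = B x" if "x \<le> y" "y \<le> 0 \<or> 1 \<le> x" for x y
  proof (rule antisym[OF _ Bmono[OF that(1)]])
    show "B y \<le> B x"
    proof (rule DERIV_nonpos_imp_nonincreasing[OF that(1), of B])
      fix z assume "x \<le> z" "z \<le> y"
      then have "b z = 0" using that by (intro b0) auto
      then show "\<exists>d. (B has_real_derivative d) (at z) \<and> d \<le> 0" using B[of z] by auto
    qed
  qed
  have "B 0 < B 1"
  proof -
    have "B 0 < B (1/2)"
    proof (rule DERIV_pos_imp_increasing_open[of 0 "1/2" B])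
      show "\<exists>d. (B has_real_derivative d) (at z) \<and> 0 < d" if "0 < z" "z < 1/2" for z
        using B[of z] bpos[of z] that by auto
      show "continuous_on {0..1/2} B"
        using B by (intro continuous_at_imp_continuous_on ballI DERIV_isCont)
    qed simp
    then show ?thesis using Bmono[of "1/2" 1] by simp
  qed
  define k where "k = 1 / (B 1 - B 0)"
  have k: "k > 0" "k * (B 1 - B 0) = 1" using \<open>B 0 < B 1\<close> by (auto simp: k_def)
  define \<psi> where "\<psi> x = k * B (3 * x + 0) + (- k) * B (3 * x + (- 2))" for x
  have Bl: "B x = B 0" if "x \<le> 0" for x using Bconst[of x 0] that by simp
  have Br: "B x = B 1" if "x \<ge> 1" for x using Bconst[of 1 x] that by simp
  have "smooth_on_reals \<psi>"
    unfolding \<psi>_def[abs_def]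
    by (intro smooth_on_reals_add smooth_on_reals_affine smooth_on_reals_integral[OF b B])
  moreover have "\<psi> x \<ge> 0" for x
    using Bmono[of "3 * x + (- 2)" "3 * x + 0"] k by (simp add: \<psi>_def)
  moreover have "\<psi> x = 0" if "x \<le> 0 \<or> x \<ge> 1" for x
    using that Bl[of "3 * x + 0"] Bl[of "3 * x + (- 2)"] Br[of "3 * x + 0"] Br[of "3 * x + (- 2)"]
    by (auto simp: \<psi>_def)
  moreover have "\<psi> x = 1" if "1 / 3 \<le> x \<and> x \<le> 2 / 3" for x
    using that Bl[of "3 * x + (- 2)"] Br[of "3 * x + 0"] k by (auto simp: \<psi>_def algebra_simps)
  ultimately show ?thesis by blast
qed

lemma damping_class_smooth: "damping_class (Collect smooth_on_reals)"
proof
  show "(\<lambda>_. 0) \<in> Collect smooth_on_reals" using smooth_on_reals_const by simp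
  show "(\<lambda>t. f t + g t) \<in> Collect smooth_on_reals" if "f \<in> Collect smooth_on_reals" "g \<in> Collect smooth_on_reals" for f g
    using that smooth_on_reals_add by simp
  show "(\<lambda>t. f (t - T)) \<in> Collect smooth_on_reals" if "f \<in> Collect smooth_on_reals" for f T
    using that smooth_on_reals_affine[of f 1 1 "- T"] by simp
  show "f \<in> Collect smooth_on_reals" if "\<And>n::nat. \<exists>g\<in>Collect smooth_on_reals. \<forall>t<real n. f t = g t" for f
    using that smooth_on_reals_local by blast
  fix r c :: real assume rc: "r > 0" "c \<ge> 0"
  obtain \<psi> where \<psi>: "smooth_on_reals \<psi>" "\<And>x. \<psi> x \<ge> 0" "\<And>x. x \<le> 0 \<or> x \<ge> 1 \<Longrightarrow> \<psi> x = 0"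
     "\<And>x. 1 / 3 \<le> x \<and> x \<le> 2 / 3 \<Longrightarrow> \<psi> x = 1"
    using smooth_plateau_exists by blast
  define \<delta> where "\<delta> t = c * \<psi> (1 / r * t + 0)" for t
  have "smooth_on_reals \<delta>" unfolding \<delta>_def[abs_def] by (intro smooth_on_reals_affine \<psi>)
  moreover have "profile r \<delta>"
    unfolding profile_def
  proof (intro conjI allI impI)
    fix t assume "t \<le> 0 \<or> r \<le> t"
    then have "1 / r * t + 0 \<le> 0 \<or> 1 / r * t + 0 \<ge> 1" using rc by (auto simp: field_simps)
    then show "\<delta> t = 0" using \<psi>(3) by (simp add: \<delta>_def)
  qed (use rc \<psi>(2) in \<open>auto simp: \<delta>_def\<close>)
  moreover have "\<delta> t = c" if "r / 3 \<le> t \<and> t \<le> 2 * r / 3" for t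
  proof -
    have "1 / 3 \<le> 1 / r * t + 0 \<and> 1 / r * t + 0 \<le> 2 / 3" using that rc by (auto simp: field_simps)
    then show ?thesis using \<psi>(4) by (simp add: \<delta>_def)
  qed
  ultimately show "\<exists>\<delta>\<in>Collect smooth_on_reals. profile r \<delta> \<and> (\<forall>t. r / 3 \<le> t \<and> t \<le> 2 * r / 3 \<longrightarrow> \<delta> t = c)"
    by blast
qed

text \<open>A monotone labelling of the constancy intervals by natural numbers encodes local finiteness;
  the sum of two labellings labels the common refinement.\<close>

definition step_function :: "(real \<Rightarrow> real) \<Rightarrow> bool" where
  "step_function f \<longleftrightarrow> (\<exists>g :: real \<Rightarrow> nat. mono g \<and> (\<forall>x y. g x = g y \<longrightarrow> f x = f y))"

lemma step_function_add:
  assumes "step_function f" "step_function f'"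
  shows "step_function (\<lambda>x. f x + f' x)"
proof -
  obtain g g' :: "real \<Rightarrow> nat" where g: "mono g" "\<And>x y. g x = g y \<Longrightarrow> f x = f y"
     "mono g'" "\<And>x y. g' x = g' y \<Longrightarrow> f' x = f' y"
    using assms unfolding step_function_def by metis
  have "g x = g y \<and> g' x = g' y" if "g x + g' x = g y + g' y" for x y
    using that monoD[OF g(1), of x y] monoD[OF g(1), of y x] monoD[OF g(3), of x y] monoD[OF g(3), of y x]
    by (cases "x \<le> y") auto
  then have "g x + g' x = g y + g' y \<longrightarrow> f x + f' x = f y + f' y" for x y
    using g(2,4) by metis
  moreover have "mono (\<lambda>x. g x + g' x)" using g by (simp add: mono_def add_mono)
  ultimately show ?thesis unfolding step_function_def by blast
qed

lemma step_function_shift: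
  assumes "step_function f"
  shows "step_function (\<lambda>x. f (x - T))"
proof -
  obtain g :: "real \<Rightarrow> nat" where g: "mono g" "\<forall>x y. g x = g y \<longrightarrow> f x = f y"
    using assms unfolding step_function_def by blast
  have "mono (\<lambda>x. g (x - T))" using g(1) by (simp add: mono_def)
  moreover have "\<forall>x y. g (x - T) = g (y - T) \<longrightarrow> f (x - T) = f (y - T)" using g(2) by blast
  ultimately show ?thesis unfolding step_function_def by (intro exI[of _ "\<lambda>x. g (x - T)"] conjI)
qed

text \<open>Agreement with a step function on each left half-line makes the gluing axiom
  \<open>local\<close> immediate, without splicing infinitely many labellings.\<close>

definition locally_step_function :: "(real \<Rightarrow> real) \<Rightarrow> bool" where
  "locally_step_function f \<longleftrightarrow> (\<forall>K. \<exists>g. step_function g \<and> (\<forall>t<K. f t = g t))"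

lemma damping_class_step: "damping_class (Collect locally_step_function)"
proof
  have step: "locally_step_function f" if "step_function f" for f
    using that unfolding locally_step_function_def by blast
  show "(\<lambda>_. 0) \<in> Collect locally_step_function"
    by (auto intro!: step exI[of _ "\<lambda>_. 0"] simp: step_function_def mono_def)
  show "(\<lambda>t. f t + g t) \<in> Collect locally_step_function"
    if fg: "f \<in> Collect locally_step_function" "g \<in> Collect locally_step_function" for f g
    unfolding locally_step_function_def mem_Collect_eq
  proof
    fix K
    obtain f' g' where "step_function f'" "\<forall>t<K. f t = f' t" "step_function g'" "\<forall>t<K. g t = g' t"
      using fg unfolding locally_step_function_def by blast
    then show "\<exists>h. step_function h \<and> (\<forall>t<K. f t + g t = h t)"
      by (intro exI[of _ "\<lambda>t. f' t + g' t"]) (simp add: step_function_add)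
  qed
  show "(\<lambda>t. f (t - T)) \<in> Collect locally_step_function" if f: "f \<in> Collect locally_step_function" for f T
    unfolding locally_step_function_def mem_Collect_eq
  proof
    fix K
    obtain g where "step_function g" "\<forall>t<K - T. f t = g t"
      using f unfolding locally_step_function_def by blast
    then show "\<exists>h. step_function h \<and> (\<forall>t<K. f (t - T) = h t)"
      by (intro exI[of _ "\<lambda>t. g (t - T)"]) (simp add: step_function_shift)
  qed
  show "f \<in> Collect locally_step_function"
    if loc: "\<And>n::nat. \<exists>g\<in>Collect locally_step_function. \<forall>t<real n. f t = g t" for f
    unfolding locally_step_function_def mem_Collect_eq
  proof
    fix K :: real
    obtain n :: nat where n: "K < real n" using reals_Archimedean2 by blast
    obtain g where g: "locally_step_function g" "\<forall>t<real n. f t = g t" using loc[of n] by blast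
    obtain h where "step_function h" "\<forall>t<K. g t = h t"
      using g(1) unfolding locally_step_function_def by blast
    then show "\<exists>h. step_function h \<and> (\<forall>t<K. f t = h t)"
      using g(2) n by (intro exI[of _ h]) auto
  qed
  fix r c :: real assume rc: "r > 0" "c \<ge> 0"
  define \<delta> where "\<delta> t = (if r / 3 \<le> t \<and> t \<le> 2 * r / 3 then c else 0)" for t
  define g :: "real \<Rightarrow> nat" where "g t = (if t < r / 3 then 0 else if t \<le> 2 * r / 3 then 1 else 2)" for t
  have "mono g" using rc by (auto simp: mono_def g_def)
  moreover have "g x = g y \<longrightarrow> \<delta> x = \<delta> y" for x y
    by (auto simp: g_def \<delta>_def split: if_splits)
  ultimately have "step_function \<delta>" unfolding step_function_def by blast
  moreover have "profile r \<delta>" using rc by (auto simp: profile_def \<delta>_def)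
  ultimately show "\<exists>\<delta>\<in>Collect locally_step_function. profile r \<delta> \<and> (\<forall>t. r / 3 \<le> t \<and> t \<le> 2 * r / 3 \<longrightarrow> \<delta> t = c)"
    using step by (intro bexI[of _ \<delta>]) (auto simp: \<delta>_def)
qed

text \<open>The pieces are the fibres of the labelling: intervals because it is monotone, finitely
  many because the labels on \<open>{0..T}\<close> are natural numbers up to
  \<open>g T\<close>.\<close>

lemma locally_step_function_imp_piecewise_constant:
  assumes "locally_step_function f"
  shows "piecewise_constant_on_halfline f"
  unfolding piecewise_constant_on_halfline_def
proof (intro allI impI)
  fix T :: real assume "T \<ge> 0"
  \<comment> \<open>\<open>T + 1\<close> because the agreement is on an open half-line and has to
    include \<open>T\<close>.\<close>
  obtain h where "step_function h" and h: "\<And>t. t < T + 1 \<Longrightarrow> f t = h t"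
    using assms unfolding locally_step_function_def by blast
  then obtain g :: "real \<Rightarrow> nat" where g: "mono g" "\<And>x y. g x = g y \<Longrightarrow> h x = h y"
    unfolding step_function_def by metis
  define P where "P = (\<lambda>k. g -` {k} \<inter> {0..T}) ` (g ` {0..T})"
  have "g ` {0..T} \<subseteq> {..g T}" using g(1) by (auto simp: mono_def)
  then have "finite (g ` {0..T})" by (rule finite_subset) simp
  then have "finite P" unfolding P_def by (rule finite_imageI)
  moreover have "partition_on {0..T} P"
    unfolding P_def by (rule partition_onI) (auto simp: disjnt_def)
  moreover have "is_interval I \<and> f constant_on I" if IP: "I \<in> P" for I
  proof -
    obtain k where I: "I = g -` {k} \<inter> {0..T}" using IP by (auto simp: P_def)
    have "is_interval I"
      unfolding is_interval_1 I
    proof (intro ballI allI impI)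
      fix a b x assume *: "a \<in> g -` {k} \<inter> {0..T}" "b \<in> g -` {k} \<inter> {0..T}" "a \<le> x \<and> x \<le> b"
      then have "g a \<le> g x" "g x \<le> g b" by (intro monoD[OF g(1)]; simp)+
      moreover have "g a = k" "g b = k" using * by auto
      ultimately have "g x = k" by simp
      then show "x \<in> g -` {k} \<inter> {0..T}" using * by auto
    qed
    moreover have "f x = f y" if "x \<in> I" "y \<in> I" for x y
    proof -
      have "x < T + 1" "y < T + 1" "g x = g y" using that by (auto simp: I)
      then show ?thesis using h g(2) by metis
    qed
    then have "f constant_on I" unfolding constant_on_def by metis
    ultimately show ?thesis by blast
  qed
  ultimately show "\<exists>P. finite P \<and> partition_on {0..T} P \<and> (\<forall>I\<in>P. is_interval I \<and> f constant_on I)" by blast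
qed

section \<open>Orthogonal projections and norms of symmetric operators\<close>

lemma polarization:
  fixes x y :: "'a::real_inner"
  shows "(norm (x + y))\<^sup>2 = (norm x)\<^sup>2 + 2 * inner x y + (norm y)\<^sup>2"
    and "(norm (x - y))\<^sup>2 = (norm x)\<^sup>2 - 2 * inner x y + (norm y)\<^sup>2"
  by (simp_all add: power2_norm_eq_inner inner_simps inner_commute)

text \<open>A minimising sequence for the distance is Cauchy by the parallelogram law, as midpoints
  stay in \<open>S\<close>; at the limit no direction in \<open>S\<close> can decrease the distance,
  which is orthogonality.\<close>

lemma orthogonal_projection_exists:
  fixes S :: "'a::{real_inner, complete_space} set"
  assumes "subspace S" "closed S"
  shows "\<exists>p\<in>S. \<forall>s\<in>S. inner (x - p) s = 0"
proof -
  define d where "d = Inf ((\<lambda>s. (norm (x - s))\<^sup>2) ` S)"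
  have bdd: "bdd_below ((\<lambda>s. (norm (x - s))\<^sup>2) ` S)" by (intro bdd_belowI2[of _ 0]) simp
  have ne: "S \<noteq> {}" using subspace_0[OF assms(1)] by auto
  have d: "d \<le> (norm (x - s))\<^sup>2" if "s \<in> S" for s
    unfolding d_def using bdd that by (rule cINF_lower)
  have "\<exists>s\<in>S. (norm (x - s))\<^sup>2 < d + 1 / real (Suc n)" for n
    using cInf_lessD[of "(\<lambda>s. (norm (x - s))\<^sup>2) ` S" "d + 1 / real (Suc n)"] ne by (auto simp: d_def)
  then obtain s where s: "\<And>n. s n \<in> S" "\<And>n. (norm (x - s n))\<^sup>2 < d + 1 / real (Suc n)"
    by metis
  have par: "(norm (s m - s n))\<^sup>2 \<le> 4 / real (Suc N)" if "N \<le> m" "N \<le> n" for m n N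
  proof -
    have "(1/2) *\<^sub>R (s m + s n) \<in> S" using s assms(1) by (simp add: subspace_add subspace_scale)
    then have "d \<le> (norm (x - (1/2) *\<^sub>R (s m + s n)))\<^sup>2" by (rule d)
    moreover have "(norm (s m - s n))\<^sup>2 + 4 * (norm (x - (1/2) *\<^sub>R (s m + s n)))\<^sup>2 =
       2 * (norm (x - s m))\<^sup>2 + 2 * (norm (x - s n))\<^sup>2"
      by (simp add: power2_norm_eq_inner inner_simps algebra_simps inner_commute)
    moreover have "1 / real (Suc m) \<le> 1 / real (Suc N)" "1 / real (Suc n) \<le> 1 / real (Suc N)"
      using that by (auto simp: field_simps)
    ultimately show ?thesis using s(2)[of m] s(2)[of n] by linarith
  qed
  have "Cauchy s"
  proof (rule metric_CauchyI)
    fix e :: real assume "e > 0"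
    then obtain N :: nat where N: "4 / e\<^sup>2 < real N" using reals_Archimedean2 by blast
    have "dist (s m) (s n) < e" if "N \<le> m" "N \<le> n" for m n
    proof -
      have "4 / real (Suc N) < e\<^sup>2" using N \<open>e > 0\<close> by (simp add: field_simps) (smt (verit) zero_less_power)
      then have "(norm (s m - s n))\<^sup>2 < e\<^sup>2" using par[OF that] by linarith
      then show ?thesis using \<open>e > 0\<close> by (simp add: dist_norm power_less_imp_less_base)
    qed
    then show "\<exists>M. \<forall>m\<ge>M. \<forall>n\<ge>M. dist (s m) (s n) < e" by blast
  qed
  then obtain p where p: "s \<longlonglongrightarrow> p" using Cauchy_convergent convergent_def by blast
  have "p \<in> S" using assms(2) s(1) p closed_sequentially by blast
  have "(\<lambda>n. d + 1 / real (Suc n)) \<longlonglongrightarrow> d + 0"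
    by (intro tendsto_add tendsto_const LIMSEQ_Suc[OF lim_1_over_n])
  moreover have "(\<lambda>n. (norm (x - s n))\<^sup>2) \<longlonglongrightarrow> (norm (x - p))\<^sup>2"
    by (intro tendsto_intros p)
  ultimately have dp: "(norm (x - p))\<^sup>2 \<le> d"
    using LIMSEQ_le[of "\<lambda>n. (norm (x - s n))\<^sup>2" _ "\<lambda>n. d + 1 / real (Suc n)" d] s(2)
    by (auto intro: less_imp_le)
  have "inner (x - p) v = 0" if "v \<in> S" for v
  proof (cases "v = 0")
    case False
    \<comment> \<open>The minimiser of \<open>norm ((x - p) - t *\<^sub>R v)\<close> over
      \<open>t\<close>.\<close>
    define t where "t = inner (x - p) v / (norm v)\<^sup>2"
    have "p + t *\<^sub>R v \<in> S" using \<open>p \<in> S\<close> that assms(1) by (simp add: subspace_add subspace_scale)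
    then have "(norm (x - p))\<^sup>2 \<le> (norm ((x - p) - t *\<^sub>R v))\<^sup>2"
      using d dp by (simp add: diff_diff_eq order_trans)
    also have "\<dots> = (norm (x - p))\<^sup>2 - 2 * t * inner (x - p) v + t\<^sup>2 * (norm v)\<^sup>2"
      by (simp add: polarization power_mult_distrib)
    also have "\<dots> = (norm (x - p))\<^sup>2 - (inner (x - p) v)\<^sup>2 / (norm v)\<^sup>2"
      using False by (simp add: t_def field_simps power2_eq_square)
    finally show ?thesis using False by (simp add: divide_le_0_iff)
  qed simp
  then show ?thesis using \<open>p \<in> S\<close> by blast
qed

text \<open>One of \<nu> and \<open>- \<nu>\<close> is an approximate eigenvalue of a symmetric
  operator of norm \<nu> on \<open>M\<close>: for a nearly maximising unit vector, \<open>(norm (T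
  (T x) - \<nu>\<^sup>2 *\<^sub>R x))\<^sup>2 \<le> \<nu>\<^sup>2 (\<nu>\<^sup>2 - (norm (T
  x))\<^sup>2)\<close> is small, while the two lower bounds compose to one for
  \<open>T\<^sup>2 - \<nu>\<^sup>2\<close>.\<close>

lemma symmetric_norm_spectral:
  fixes T :: "'a::real_inner \<Rightarrow> 'a"
  assumes "bounded_linear T" "\<And>x y. inner (T x) y = inner x (T y)" "subspace M" "\<And>x. x \<in> M \<Longrightarrow> T x \<in> M"
    and le: "\<And>x. x \<in> M \<Longrightarrow> norm (T x) \<le> \<nu> * norm x"
    and approx: "\<And>\<epsilon>. \<epsilon> > 0 \<Longrightarrow> \<exists>x\<in>M. norm x = 1 \<and> \<nu> - \<epsilon> < norm (T x)"
    and "\<nu> > 0"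
    and k1: "k1 > 0" "\<And>x. x \<in> M \<Longrightarrow> k1 * norm x \<le> norm (T x - \<nu> *\<^sub>R x)"
    and k2: "k2 > 0" "\<And>x. x \<in> M \<Longrightarrow> k2 * norm x \<le> norm (T x + \<nu> *\<^sub>R x)"
  shows False
proof -
  interpret T: bounded_linear T by fact
  \<comment> \<open>Chosen so that
    \<open>2 \<nu>\<^sup>3 \<epsilon> \<le> (k1 k2)\<^sup>2 / 2\<close>; the bound by \<nu> keeps
    \<open>\<nu> - \<epsilon>\<close> nonnegative, so that the inequality can be squared.\<close>
  define \<epsilon> where "\<epsilon> = min \<nu> ((k1 * k2)\<^sup>2 / (4 * \<nu> ^ 3))"
  have "\<epsilon> > 0" using assms by (simp add: \<epsilon>_def)
  then obtain x where x: "x \<in> M" "norm x = 1" "\<nu> - \<epsilon> < norm (T x)" using approx by blast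
  have mem: "T x + \<nu> *\<^sub>R x \<in> M" using x assms by (simp add: subspace_add subspace_scale)
  have "k1 * k2 \<le> k1 * norm (T x + \<nu> *\<^sub>R x)" using k2(2)[OF x(1)] x k1 by simp
  also have "\<dots> \<le> norm (T (T x + \<nu> *\<^sub>R x) - \<nu> *\<^sub>R (T x + \<nu> *\<^sub>R x))" by (rule k1(2)[OF mem])
  also have "T (T x + \<nu> *\<^sub>R x) - \<nu> *\<^sub>R (T x + \<nu> *\<^sub>R x) = T (T x) - \<nu>\<^sup>2 *\<^sub>R x"
    by (simp add: T.add T.scaleR algebra_simps power2_eq_square)
  finally have "(k1 * k2)\<^sup>2 \<le> (norm (T (T x) - \<nu>\<^sup>2 *\<^sub>R x))\<^sup>2"
    using k1 k2 by (intro power_mono) auto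
  also have "\<dots> = (norm (T (T x)))\<^sup>2 - 2 * \<nu>\<^sup>2 * (norm (T x))\<^sup>2 + \<nu> ^ 4"
    using x(2) by (simp add: polarization assms(2) power2_norm_eq_inner[of "T x"] power_mult_distrib flip: power_mult)
  also have "(norm (T (T x)))\<^sup>2 \<le> \<nu>\<^sup>2 * (norm (T x))\<^sup>2"
    using power_mono[OF le[OF assms(4)[OF x(1)]], of 2] by (simp add: power_mult_distrib)
  finally have "(k1 * k2)\<^sup>2 \<le> \<nu>\<^sup>2 * (\<nu>\<^sup>2 - (norm (T x))\<^sup>2)"
    by (simp add: algebra_simps power4_eq_xxxx power2_eq_square)
  also have "\<nu>\<^sup>2 - (norm (T x))\<^sup>2 < 2 * \<nu> * \<epsilon>"
  proof -
    have "(\<nu> - \<epsilon>)\<^sup>2 \<le> (norm (T x))\<^sup>2"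
      using x(3) by (intro power_mono) (auto simp: \<epsilon>_def)
    moreover have "(\<nu> - \<epsilon>)\<^sup>2 = \<nu>\<^sup>2 - 2 * \<nu> * \<epsilon> + \<epsilon>\<^sup>2" by (simp add: power2_diff)
    moreover have "\<epsilon>\<^sup>2 > 0" using \<open>\<epsilon> > 0\<close> by simp
    ultimately show ?thesis by linarith
  qed
  then have "\<nu>\<^sup>2 * (\<nu>\<^sup>2 - (norm (T x))\<^sup>2) < \<nu>\<^sup>2 * (2 * \<nu> * \<epsilon>)" using \<open>\<nu> > 0\<close> by simp
  also have "\<dots> = 2 * \<nu> ^ 3 * \<epsilon>" by (simp add: power2_eq_square power3_eq_cube)
  also have "\<dots> \<le> 2 * \<nu> ^ 3 * ((k1 * k2)\<^sup>2 / (4 * \<nu> ^ 3))"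
    using \<open>\<nu> > 0\<close> by (intro mult_left_mono) (auto simp: \<epsilon>_def)
  also have "\<dots> = (k1 * k2)\<^sup>2 / 2" using \<open>\<nu> > 0\<close> by simp
  finally have "(k1 * k2)\<^sup>2 < (k1 * k2)\<^sup>2 / 2" .
  then show False using zero_le_power2[of "k1 * k2"] by linarith
qed

text \<open>\<nu> is the operator norm of \<open>T\<close> restricted to \<open>M\<close>; the
  witness \<open>z\<close> makes the unit sphere of \<open>M\<close> nonempty and \<nu>
  positive.\<close>

lemma restricted_norm:
  fixes T :: "'a::real_inner \<Rightarrow> 'a"
  assumes "bounded_linear T" "subspace M" "z \<in> M" "T z \<noteq> 0"
  obtains \<nu> where "\<nu> > 0" "\<And>x. x \<in> M \<Longrightarrow> norm (T x) \<le> \<nu> * norm x"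
    "\<And>\<epsilon>. \<epsilon> > 0 \<Longrightarrow> \<exists>x\<in>M. norm x = 1 \<and> \<nu> - \<epsilon> < norm (T x)"
proof -
  interpret T: bounded_linear T by fact
  let ?S = "(\<lambda>x. norm (T x)) ` {x \<in> M. norm x = 1}"
  obtain K where K: "\<And>x. norm (T x) \<le> norm x * K" using T.bounded by blast
  have bdd: "bdd_above ?S" using K by (intro bdd_aboveI2[of _ _ K]) (metis (mono_tags, lifting) mem_Collect_eq mult_1)
  have z0: "z \<noteq> 0" using assms T.zero by auto
  then have z1: "z /\<^sub>R norm z \<in> {x \<in> M. norm x = 1}" using assms by (simp add: subspace_scale)
  have le: "norm (T x) \<le> Sup ?S * norm x" if "x \<in> M" for x
  proof (cases "x = 0")
    case False
    then have "x /\<^sub>R norm x \<in> {x \<in> M. norm x = 1}" using that assms by (simp add: subspace_scale)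
    then have "norm (T (x /\<^sub>R norm x)) \<le> Sup ?S" by (intro cSup_upper bdd imageI)
    then show ?thesis using False by (simp add: T.scaleR field_simps)
  qed (simp add: T.zero)
  show thesis
  proof (rule that[of "Sup ?S"])
    have "0 < Sup ?S * norm z" using le[OF assms(3)] assms(4) by (metis norm_ge_zero order_less_le_trans zero_less_norm_iff)
    then show "Sup ?S > 0" using z0 by (simp add: zero_less_mult_iff)
    show "\<exists>x\<in>M. norm x = 1 \<and> Sup ?S - \<epsilon> < norm (T x)" if "\<epsilon> > 0" for \<epsilon>
    proof -
      have "?S \<noteq> {}" using z1 by blast
      moreover have "Sup ?S - \<epsilon> < Sup ?S" using that by simp
      ultimately have "\<exists>y\<in>?S. Sup ?S - \<epsilon> < y" by (rule less_cSupD)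
      then show ?thesis by auto
    qed
  qed (use le assms in auto)
qed

section \<open>Symmetric operators, resolvents and spectral gaps\<close>

lemma closure_subspace:
  fixes S :: "'a::real_normed_vector set"
  assumes "subspace S"
  shows "subspace (closure S)"
  unfolding subspace_def
proof (intro conjI allI ballI)
  show "0 \<in> closure S" using subspace_0[OF assms] closure_subset by blast
next
  fix x y assume "x \<in> closure S" "y \<in> closure S"
  then obtain f g where "\<And>n. f n \<in> S" "f \<longlonglongrightarrow> x" "\<And>n. g n \<in> S" "g \<longlonglongrightarrow> y"
    unfolding closure_sequential by blast
  then show "x + y \<in> closure S"
    unfolding closure_sequential using assms
    by (intro exI[of _ "\<lambda>n. f n + g n"] conjI allI tendsto_add) (auto intro: subspace_add)
next
  fix c x assume "x \<in> closure S"
  then obtain f where "\<And>n. f n \<in> S" "f \<longlonglongrightarrow> x" unfolding closure_sequential by blast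
  then show "c *\<^sub>R x \<in> closure S"
    unfolding closure_sequential using assms
    by (intro exI[of _ "\<lambda>n. c *\<^sub>R f n"] conjI allI tendsto_scaleR tendsto_const) (auto intro: subspace_scale)
qed

lemma orthogonal_series_convergent:
  fixes a :: "nat \<Rightarrow> 'a::{real_inner, complete_space}"
  assumes orth: "\<And>i j. i \<noteq> j \<Longrightarrow> inner (a i) (a j) = 0"
    and bound: "\<And>n. (\<Sum>k<n. (norm (a k))\<^sup>2) \<le> B"
  shows "summable a"
proof -
  have "summable (\<lambda>k. (norm (a k))\<^sup>2)"
    using bound by (intro summableI_nonneg_bounded) auto
  then have sC: "\<exists>N. \<forall>m\<ge>N. \<forall>n. norm (sum (\<lambda>k. (norm (a k))\<^sup>2) {m..<n}) < e" if "e > 0" for e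
    using that unfolding summable_Cauchy by blast
  have py: "(norm (sum a {m..<n}))\<^sup>2 = (\<Sum>k\<in>{m..<n}. (norm (a k))\<^sup>2)" for m n
    using orth by (intro norm_sum_Pythagorean) (auto simp: pairwise_def orthogonal_def)
  have "Cauchy (\<lambda>n. sum a {..<n})"
  proof (rule CauchyI')
    fix e :: real assume "e > 0"
    then obtain N where N: "\<And>m n. m \<ge> N \<Longrightarrow> norm (sum (\<lambda>k. (norm (a k))\<^sup>2) {m..<n}) < e\<^sup>2"
      using sC[of "e\<^sup>2"] by auto
    have "dist (sum a {..<m}) (sum a {..<n}) < e" if "m \<ge> N" "n > m" for m n
    proof -
      have "sum a {..<n} - sum a {..<m} = sum a {m..<n}"
        using sum_diff_nat_ivl[of 0 m n a] that by (simp add: atLeast0LessThan)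
      then have "(norm (sum a {..<n} - sum a {..<m}))\<^sup>2 < e\<^sup>2"
        using py[of m n] N[OF that(1), of n] by (simp add: abs_if split: if_splits)
      then show ?thesis using \<open>e > 0\<close>
        by (metis dist_commute dist_norm less_imp_le power_less_imp_less_base)
    qed
    then show "\<exists>M. \<forall>m\<ge>M. \<forall>n>m. dist (sum a {..<m}) (sum a {..<n}) < e" by blast
  qed
  then show ?thesis
    unfolding summable_def sums_def using Cauchy_convergent convergent_def by blast
qed

text \<open>Gram-Schmidt for two vectors. With \<open>sgn 0 = 0\<close> the degenerate cases produce
  zero vectors instead of exceptions, so the conclusion is stated through inner products rather than
  as orthonormality.\<close>

lemma orthonormal_pair_exists:
  fixes a b :: "'a::real_inner"
  assumes "subspace S" "a \<in> S" "b \<in> S"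
  obtains e1 e2 where "e1 \<in> S" "e2 \<in> S"
    "(norm a)\<^sup>2 = (inner a e1)\<^sup>2 + (inner a e2)\<^sup>2" "(norm b)\<^sup>2 = (inner b e1)\<^sup>2 + (inner b e2)\<^sup>2"
    "\<And>x. (inner x e1)\<^sup>2 + (inner x e2)\<^sup>2 \<le> (norm x)\<^sup>2"
proof
  define e1 where "e1 = sgn a"
  define b' where "b' = b - inner b e1 *\<^sub>R e1"
  define e2 where "e2 = sgn b'"
  show S: "e1 \<in> S" using assms by (simp add: e1_def sgn_div_norm subspace_scale)
  then show "e2 \<in> S" using assms by (simp add: e2_def sgn_div_norm subspace_scale b'_def subspace_diff)
  have self: "inner x (sgn x) = norm x" for x :: 'a
    by (cases "x = 0") (simp_all add: sgn_div_norm power2_norm_eq_inner[symmetric] power2_eq_square)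
  have e1: "inner e1 e1 = 1 \<or> e1 = 0" and e2: "inner e2 e2 = 1 \<or> e2 = 0"
    by (simp_all add: e1_def e2_def norm_sgn flip: power2_norm_eq_inner)
  have "inner b' e1 = 0"
    using e1 by (auto simp: b'_def inner_diff_left)
  then have orth: "inner e1 e2 = 0" by (simp add: e2_def sgn_div_norm inner_commute)
  have a: "a = norm a *\<^sub>R e1" by (cases "a = 0") (simp_all add: e1_def sgn_div_norm)
  have "inner a e2 = 0" by (subst a) (simp add: orth)
  then show "(norm a)\<^sup>2 = (inner a e1)\<^sup>2 + (inner a e2)\<^sup>2" using self[of a] by (simp add: e1_def)
  have b: "b = inner b e1 *\<^sub>R e1 + b'" by (simp add: b'_def)
  have "inner b e2 = norm b'"
    by (subst b) (simp add: inner_add_left orth e2_def[symmetric] self[of b', folded e2_def])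
  moreover have "(norm b)\<^sup>2 = (inner b e1)\<^sup>2 + (norm b')\<^sup>2"
  proof -
    have "(norm b')\<^sup>2 = (norm b)\<^sup>2 - 2 * (inner b e1)\<^sup>2 + (inner b e1)\<^sup>2 * inner e1 e1"
      unfolding power2_norm_eq_inner
      by (simp add: b'_def inner_simps inner_commute power2_eq_square algebra_simps)
    then show ?thesis using e1 by auto
  qed
  ultimately show "(norm b)\<^sup>2 = (inner b e1)\<^sup>2 + (inner b e2)\<^sup>2" by simp
  fix x :: 'a
  have "0 \<le> (norm (x - inner x e1 *\<^sub>R e1 - inner x e2 *\<^sub>R e2))\<^sup>2" by simp
  also have "\<dots> = (norm x)\<^sup>2 - 2 * (inner x e1)\<^sup>2 - 2 * (inner x e2)\<^sup>2
      + (inner x e1)\<^sup>2 * inner e1 e1 + (inner x e2)\<^sup>2 * inner e2 e2"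
    using orth unfolding power2_norm_eq_inner
    by (simp add: inner_simps inner_commute power2_eq_square algebra_simps)
  also have "\<dots> = (norm x)\<^sup>2 - (inner x e1)\<^sup>2 - (inner x e2)\<^sup>2" using e1 e2 by auto
  finally show "(inner x e1)\<^sup>2 + (inner x e2)\<^sup>2 \<le> (norm x)\<^sup>2" by simp
qed

lemma resolvent_bounded_below:
  assumes "\<mu> \<in> resolvent_set A"
  shows "\<exists>\<kappa>>0. \<forall>(x, y)\<in>A. \<kappa> * norm x \<le> norm (y - \<mu> *\<^sub>R x)"
proof -
  obtain R where R: "bounded_linear R" "\<forall>(x, y)\<in>A. R (y - \<mu> *\<^sub>R x) = x"
    using assms unfolding resolvent_set_def by blast
  obtain K where K: "K > 0" "\<And>x. norm (R x) \<le> norm x * K"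
    using bounded_linear.pos_bounded[OF R(1)] by blast
  have "1 / K * norm x \<le> norm (y - \<mu> *\<^sub>R x)" if "(x, y) \<in> A" for x y
  proof -
    have "R (y - \<mu> *\<^sub>R x) = x" using R(2) that by auto
    then show ?thesis using K(1) K(2)[of "y - \<mu> *\<^sub>R x"] by (simp add: field_simps)
  qed
  then show ?thesis using K(1) by (intro exI[of _ "1 / K"]) auto
qed

text \<open>Spectral mapping for the resolvent \<open>R\<close> at \<mu>: applying
  \<open>A - \<mu> - 1 / \<nu>\<close> to \<open>R y\<close> gives
  \<open>- (R y - \<nu> y) / \<nu>\<close>, so a lower bound for the former operator becomes one for
  \<open>R - \<nu>\<close>. The constant \<open>k\<close> combines the resulting bound on
  \<open>norm (R y)\<close> with the triangle inequality for \<open>\<nu> y\<close>.\<close>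

lemma resolvent_shift_bounded_below:
  fixes A :: "'a::real_normed_vector operator"
  assumes R: "\<And>y. (R y, y + \<mu> *\<^sub>R R y) \<in> A" and "\<nu> \<noteq> 0" "\<mu> + 1 / \<nu> \<in> resolvent_set A"
  shows "\<exists>k>0. \<forall>y. k * norm y \<le> norm (R y - \<nu> *\<^sub>R y)"
proof -
  obtain \<kappa> where \<kappa>: "\<kappa> > 0" "\<forall>(x, y)\<in>A. \<kappa> * norm x \<le> norm (y - (\<mu> + 1 / \<nu>) *\<^sub>R x)"
    using resolvent_bounded_below[OF assms(3)] by blast
  define k where "k = \<bar>\<nu>\<bar> / (1 + 1 / (\<kappa> * \<bar>\<nu>\<bar>))"
  have pos: "1 + 1 / (\<kappa> * \<bar>\<nu>\<bar>) > 0" using \<kappa> assms(2) by (intro add_pos_pos) auto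
  have "k * norm y \<le> norm (R y - \<nu> *\<^sub>R y)" for y
  proof -
    let ?D = "norm (R y - \<nu> *\<^sub>R y)"
    have "\<kappa> * norm (R y) \<le> norm (y + \<mu> *\<^sub>R R y - (\<mu> + 1 / \<nu>) *\<^sub>R R y)" using \<kappa>(2) R[of y] by blast
    also have "y + \<mu> *\<^sub>R R y - (\<mu> + 1 / \<nu>) *\<^sub>R R y = (- 1 / \<nu>) *\<^sub>R (R y - \<nu> *\<^sub>R y)"
      using assms(2) by (simp add: scaleR_left_distrib scaleR_right_diff_distrib)
    also have "norm \<dots> = ?D / \<bar>\<nu>\<bar>" by simp
    finally have "norm (R y) \<le> ?D * (1 / (\<kappa> * \<bar>\<nu>\<bar>))" using \<kappa>(1) assms(2) by (simp add: field_simps)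
    moreover have "\<bar>\<nu>\<bar> * norm y \<le> norm (R y) + ?D"
      using norm_triangle_ineq4[of "R y" "R y - \<nu> *\<^sub>R y"] by simp
    ultimately have "\<bar>\<nu>\<bar> * norm y \<le> ?D * (1 + 1 / (\<kappa> * \<bar>\<nu>\<bar>))" by (simp add: distrib_left)
    then show ?thesis unfolding k_def using pos by (simp add: field_simps)
  qed
  moreover have "k > 0" unfolding k_def using pos assms(2) by simp
  ultimately show ?thesis by blast
qed

locale symmetric_operator =
  fixes A :: "'a::{real_inner, complete_space} operator"
  assumes self_adjoint: "self_adjoint_operator A"
begin

lemma subspace: "subspace A" and single_valued: "single_valued A"
  using self_adjoint unfolding self_adjoint_operator_def linear_operator_def by auto

lemma zero_mem: "(0, 0) \<in> A"
  using subspace_0[OF subspace] by (simp add: zero_prod_def)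

lemma add_mem: "(x, y) \<in> A \<Longrightarrow> (x', y') \<in> A \<Longrightarrow> (x + x', y + y') \<in> A"
  using subspace_add[OF subspace] by fastforce

lemma scale_mem: "(x, y) \<in> A \<Longrightarrow> (c *\<^sub>R x, c *\<^sub>R y) \<in> A"
  using subspace_scale[OF subspace] by fastforce

lemma symmetric:
  assumes "(x, y) \<in> A" "(x', y') \<in> A"
  shows "inner y x' = inner x y'"
proof -
  have "(x', y') \<in> adjoint_operator A"
    using assms(2) self_adjoint unfolding self_adjoint_operator_def by simp
  then show ?thesis using assms(1) unfolding adjoint_operator_def by blast
qed

text \<open>A self-adjoint operator has no proper symmetric extension: membership in
  \<open>A\<close> can be tested by pairing, which later yields the reverse inclusions between
  operators.\<close>

lemma memI: "(\<And>a w. (a, w) \<in> A \<Longrightarrow> inner w x = inner a y) \<Longrightarrow> (x, y) \<in> A"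
proof -
  assume "\<And>a w. (a, w) \<in> A \<Longrightarrow> inner w x = inner a y"
  then have "(x, y) \<in> adjoint_operator A" unfolding adjoint_operator_def by blast
  then show "(x, y) \<in> A" using self_adjoint unfolding self_adjoint_operator_def by simp
qed

lemma resolvent_symmetric:
  assumes "\<And>y. (R y, y + \<mu> *\<^sub>R R y) \<in> A"
  shows "inner (R y) z = inner y (R z)"
  using symmetric[OF assms[of y] assms[of z]] by (simp add: inner_add_left inner_add_right)

text \<open>The resolvent at the centre of a gap of radius \<open>r\<close> has norm at most
  \<open>1 / r\<close>. A larger norm \<nu> would make \<nu> or \<open>- \<nu>\<close> an
  approximate eigenvalue of \<open>R\<close>, hence \<open>c + 1 / \<nu>\<close> or
  \<open>c - 1 / \<nu>\<close> a spectral point inside the gap.\<close>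

lemma spectral_gap:
  assumes gap: "\<And>m. \<bar>m - c\<bar> < r \<Longrightarrow> m \<in> resolvent_set A" and "r > 0" "(x, y) \<in> A"
  shows "r * norm x \<le> norm (y - c *\<^sub>R x)"
proof (rule ccontr)
  assume neg: "\<not> ?thesis"
  have "c \<in> resolvent_set A" using gap[of c] assms by simp
  then obtain R where R: "bounded_linear R" "\<And>y. (R y, y + c *\<^sub>R R y) \<in> A"
      "\<forall>(x, y)\<in>A. R (y - c *\<^sub>R x) = x"
    unfolding resolvent_set_def by blast
  interpret R: bounded_linear R by fact
  define z where "z = y - c *\<^sub>R x"
  have Rz: "R z = x" using R(3) assms(3) by (auto simp: z_def)
  have lt: "norm z < r * norm x" using neg by (simp add: z_def)
  then have "x \<noteq> 0" using norm_ge_zero[of z] by auto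
  then have "R z \<noteq> 0" using Rz by simp
  then obtain \<nu> where \<nu>: "\<nu> > 0" "\<And>x. x \<in> UNIV \<Longrightarrow> norm (R x) \<le> \<nu> * norm x"
    "\<And>\<epsilon>. \<epsilon> > 0 \<Longrightarrow> \<exists>x\<in>UNIV. norm x = 1 \<and> \<nu> - \<epsilon> < norm (R x)"
    by (rule restricted_norm[OF R(1) subspace_UNIV UNIV_I]) (rule that)
  have "r * norm x \<le> r * (\<nu> * norm z)"
    using \<nu>(2)[of z] \<open>r > 0\<close> Rz by (intro mult_left_mono) auto
  with lt have "norm z < r * (\<nu> * norm z)" by linarith
  moreover have "norm z > 0" using R.zero Rz \<open>x \<noteq> 0\<close> by auto
  ultimately have "1 / \<nu> < r" using \<nu>(1) by (simp add: field_simps)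
  then have "c + 1 / \<nu> \<in> resolvent_set A" "c + 1 / (- \<nu>) \<in> resolvent_set A"
    using \<nu>(1) by (auto intro!: gap)
  then obtain k1 k2 where k1: "k1 > 0" "\<forall>y. k1 * norm y \<le> norm (R y - \<nu> *\<^sub>R y)"
     and k2: "k2 > 0" "\<forall>y. k2 * norm y \<le> norm (R y - (- \<nu>) *\<^sub>R y)"
    using resolvent_shift_bounded_below[OF R(2), of \<nu>] resolvent_shift_bounded_below[OF R(2), of "- \<nu>"] \<nu>(1)
    by (metis less_irrefl neg_equal_0_iff_equal)
  show False
  proof (rule symmetric_norm_spectral[OF R(1) resolvent_symmetric[OF R(2)] subspace_UNIV _ \<nu>(2,3,1) k1(1) _ k2(1)])
    show "k2 * norm y \<le> norm (R y + \<nu> *\<^sub>R y)" for y using k2(2)[rule_format, of y] by simp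
  qed (use k1(2) in auto)
qed

definition eigenspace :: "real \<Rightarrow> 'a set" where
  "eigenspace \<mu> = {x. (x, \<mu> *\<^sub>R x) \<in> A}"

lemma subspace_eigenspace: "subspace (eigenspace \<mu>)"
  unfolding subspace_def
proof (intro conjI allI ballI)
  show "0 \<in> eigenspace \<mu>" using zero_mem by (simp add: eigenspace_def)
  show "x + y \<in> eigenspace \<mu>" if "x \<in> eigenspace \<mu>" "y \<in> eigenspace \<mu>" for x y
    using add_mem that by (simp add: eigenspace_def scaleR_right_distrib)
  show "c *\<^sub>R x \<in> eigenspace \<mu>" if "x \<in> eigenspace \<mu>" for c x
    using scale_mem[of x "\<mu> *\<^sub>R x" c] that by (simp add: eigenspace_def mult.commute)
qed

lemma closed_eigenspace: "closed (eigenspace \<mu>)"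
proof -
  have "eigenspace \<mu> = (\<Inter>p\<in>A. {x. inner (snd p) x = inner (fst p) (\<mu> *\<^sub>R x)})"
  proof (intro set_eqI iffI)
    fix x assume "x \<in> eigenspace \<mu>"
    then show "x \<in> (\<Inter>p\<in>A. {x. inner (snd p) x = inner (fst p) (\<mu> *\<^sub>R x)})"
      unfolding eigenspace_def mem_Collect_eq
      by (intro INT_I CollectI symmetric) simp_all
  next
    fix x assume x: "x \<in> (\<Inter>p\<in>A. {x. inner (snd p) x = inner (fst p) (\<mu> *\<^sub>R x)})"
    have "(x, \<mu> *\<^sub>R x) \<in> A"
    proof (rule memI)
      fix a w assume "(a, w) \<in> A"
      then show "inner w x = inner a (\<mu> *\<^sub>R x)" using x by fastforce
    qed
    then show "x \<in> eigenspace \<mu>" by (simp add: eigenspace_def)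
  qed
  also have "closed \<dots>"
    by (intro closed_INT ballI closed_Collect_eq continuous_intros)
  finally show ?thesis .
qed

lemma eigenspace_orthogonal:
  assumes "x \<in> eigenspace \<mu>" "y \<in> eigenspace \<mu>'" "\<mu> \<noteq> \<mu>'"
  shows "inner x y = 0"
  using symmetric[of x "\<mu> *\<^sub>R x" y "\<mu>' *\<^sub>R y"] assms by (simp add: eigenspace_def)

end

section \<open>Self-adjoint operators with discrete spectrum\<close>

locale discrete_operator = symmetric_operator A
  for A :: "'a::{real_inner, complete_space} operator" +
  fixes \<mu> :: "nat \<Rightarrow> real"
  assumes nonnegative: "nonnegative_operator A"
    and \<mu>_pos: "\<And>k. \<mu> k > 0"
    and \<mu>_mono: "strict_mono (\<lambda>k. (\<mu> k)\<^sup>2)"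
    and spectrum_eq: "spectrum A = range (\<lambda>k. (\<mu> k)\<^sup>2)"
begin

abbreviation E :: "nat \<Rightarrow> 'a set" where
  "E k \<equiv> eigenspace ((\<mu> k)\<^sup>2)"

lemma E_orthogonal: "x \<in> E i \<Longrightarrow> y \<in> E j \<Longrightarrow> i \<noteq> j \<Longrightarrow> inner x y = 0"
  using strict_mono_eq[OF \<mu>_mono] by (intro eigenspace_orthogonal) auto

lemma mem_resolvent_setI: "(\<And>k. m \<noteq> (\<mu> k)\<^sup>2) \<Longrightarrow> m \<in> resolvent_set A"
  using spectrum_eq unfolding spectrum_def by blast

text \<open>On the complement \<open>M\<close> of all eigenvectors let \<open>\<nu>\<close> be the norm of \<open>A\<inverse>\<close> and \<open>T = \<nu> - A\<inverse> \<ge> 0\<close>.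
  The spectral gap above \<open>1 / \<nu>\<close> gives \<open>T\<^sup>2 \<ge> g T\<close>, so that \<open>T\<close> is bounded below on the closure of
  its range, which is \<open>M\<close> because \<open>T\<close> has no kernel in \<open>M\<close>. This contradicts that \<open>\<nu>\<close> is an
  approximate eigenvalue of \<open>A\<inverse>\<close> on \<open>M\<close>.\<close>

lemma eigenvectors_total:
  assumes z: "\<And>k e. e \<in> E k \<Longrightarrow> inner z e = 0"
  shows "z = 0"
proof (rule ccontr)
  assume "z \<noteq> 0"
  define M where "M = {x. \<forall>k. \<forall>e\<in>E k. inner x e = 0}"
  have subM: "subspace M"
    unfolding subspace_def M_def by (auto simp: inner_add_left)
  have "M = (\<Inter>k. \<Inter>e\<in>E k. {x. inner x e = 0})" by (auto simp: M_def)
  also have "closed \<dots>" by (intro closed_INT ballI closed_Collect_eq continuous_intros)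
  finally have clM: "closed M" .
  have "z \<in> M" using z by (simp add: M_def)
  have "0 \<in> resolvent_set A" using \<mu>_pos by (intro mem_resolvent_setI) (metis less_irrefl zero_less_power)
  then obtain R where R: "bounded_linear R" "\<And>y. (R y, y + 0 *\<^sub>R R y) \<in> A" "\<forall>(x, y)\<in>A. R (y - 0 *\<^sub>R x) = x"
    unfolding resolvent_set_def by blast
  interpret R: bounded_linear R by fact
  have RA: "(R y, y) \<in> A" for y using R(2)[of y] by simp
  have RL: "R y = x" if "(x, y) \<in> A" for x y using R(3) that by auto
  have Rsym: "inner (R x) y = inner x (R y)" for x y by (rule resolvent_symmetric[OF R(2)])
  have Rpos: "inner (R x) x \<ge> 0" for x
    using nonnegative RA[of x] unfolding nonnegative_operator_def by (auto simp: inner_commute)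
  have RM: "R x \<in> M" if "x \<in> M" for x
    unfolding M_def
  proof (clarify)
    fix k e assume e: "e \<in> E k"
    then have "(\<mu> k)\<^sup>2 *\<^sub>R R e = e" using RL[of e "(\<mu> k)\<^sup>2 *\<^sub>R e"] by (simp add: eigenspace_def R.scaleR)
    moreover have "inner x e = 0" using that e by (simp add: M_def)
    ultimately have "(\<mu> k)\<^sup>2 * inner (R x) e = 0" by (metis Rsym inner_scaleR_right)
    then show "inner (R x) e = 0" using \<mu>_pos[of k] by simp
  qed
  have "R z \<noteq> 0"
  proof
    assume "R z = 0"
    then have "(0, z) \<in> A" using RA[of z] by simp
    then show False using zero_mem single_valued \<open>z \<noteq> 0\<close> by (auto dest: single_valuedD)
  qed
  then obtain \<nu> where \<nu>: "\<nu> > 0" "\<And>x. x \<in> M \<Longrightarrow> norm (R x) \<le> \<nu> * norm x"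
    "\<And>\<epsilon>. \<epsilon> > 0 \<Longrightarrow> \<exists>x\<in>M. norm x = 1 \<and> \<nu> - \<epsilon> < norm (R x)"
    by (rule restricted_norm[OF R(1) subM \<open>z \<in> M\<close>]) (rule that)
  \<comment> \<open>\<open>R\<close> is nonnegative, so \<open>- \<nu>\<close> is not an approximate
    eigenvalue; only \<nu> remains to be excluded.\<close>
  have plus: "\<nu> * norm x \<le> norm (R x + \<nu> *\<^sub>R x)" for x
  proof (rule power2_le_imp_le)
    show "(\<nu> * norm x)\<^sup>2 \<le> (norm (R x + \<nu> *\<^sub>R x))\<^sup>2"
      using Rpos[of x] \<nu>(1) by (simp add: polarization power_mult_distrib)
  qed simp
  have "\<exists>k>0. \<forall>x\<in>M. k * norm x \<le> norm (R x - \<nu> *\<^sub>R x)"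
  proof (cases "1 / \<nu> \<in> resolvent_set A")
    case True
    then show ?thesis using resolvent_shift_bounded_below[OF R(2), of \<nu>] \<nu>(1) by auto
  next
    case False
    then obtain k where k: "1 / \<nu> = (\<mu> k)\<^sup>2" using mem_resolvent_setI by blast
    \<comment> \<open>Half-width and centre of the gap between consecutive spectral points;
      \<open>c - r\<close> is \<open>1 / \<nu>\<close>.\<close>
    define r where "r = ((\<mu> (Suc k))\<^sup>2 - (\<mu> k)\<^sup>2) / 2"
    define c where "c = (\<mu> k)\<^sup>2 + r"
    have "r > 0" using strict_monoD[OF \<mu>_mono, of k "Suc k"] by (simp add: r_def)
    have "c > 0" using \<open>r > 0\<close> by (simp add: c_def add_nonneg_pos)
    have gap: "m \<in> resolvent_set A" if "\<bar>m - c\<bar> < r" for m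
    proof (rule mem_resolvent_setI)
      fix j
      have "(\<mu> k)\<^sup>2 < m" "m < (\<mu> (Suc k))\<^sup>2" using that by (auto simp: c_def r_def abs_if field_simps split: if_splits)
      then show "m \<noteq> (\<mu> j)\<^sup>2"
        using strict_mono_less[OF \<mu>_mono, of k j] strict_mono_less[OF \<mu>_mono, of j "Suc k"] by auto
    qed
    define T where "T x = \<nu> *\<^sub>R x - R x" for x
    interpret T: bounded_linear T
      unfolding T_def[abs_def]
      by (intro bounded_linear_sub bounded_linear_scaleR_right R(1))
    have Tsym: "inner (T x) y = inner x (T y)" for x y
      by (simp add: T_def inner_diff_left inner_diff_right Rsym)
    have TM: "T x \<in> M" if "x \<in> M" for x
      unfolding T_def using that subM RM by (simp add: subspace_diff subspace_scale)
    have Tpos: "inner (T x) x \<ge> 0" if "x \<in> M" for x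
    proof -
      have "inner (R x) x \<le> norm (R x) * norm x" by (rule norm_cauchy_schwarz)
      also have "\<dots> \<le> \<nu> * norm x * norm x" using \<nu>(2)[OF that] by (rule mult_right_mono) simp
      finally show ?thesis by (simp add: T_def inner_diff_left power2_norm_eq_inner[symmetric] power2_eq_square mult.assoc)
    qed
    \<comment> \<open>\<open>c + r\<close> is the next spectral point, so
      \<open>g = \<nu> - 1 / (\<mu> (Suc k))\<^sup>2\<close>, the expected gap of \<open>T\<close>
      above 0.\<close>
    define g where "g = 2 * r * \<nu> / (c + r)"
    have "g > 0" using \<open>r > 0\<close> \<open>c > 0\<close> \<nu>(1) by (simp add: g_def)
    have TT: "g * inner (T x) x \<le> (norm (T x))\<^sup>2" for x
    proof -
      have "r * norm (R x) \<le> norm (x - c *\<^sub>R R x)"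
        by (rule spectral_gap[OF gap \<open>r > 0\<close> RA])
      then have "(r * norm (R x))\<^sup>2 \<le> (norm (x - c *\<^sub>R R x))\<^sup>2"
        using \<open>r > 0\<close> by (intro power_mono) auto
      moreover have "R x = \<nu> *\<^sub>R x - T x" by (simp add: T_def)
      moreover have "x - c *\<^sub>R (\<nu> *\<^sub>R x - T x) = c *\<^sub>R T x - (r * \<nu>) *\<^sub>R x"
      proof -
        have "c * \<nu> = 1 + r * \<nu>" using k \<nu>(1) by (simp add: c_def field_simps)
        then show ?thesis by (simp add: scaleR_right_diff_distrib scaleR_left_distrib)
      qed
      ultimately have "(r * norm (\<nu> *\<^sub>R x - T x))\<^sup>2 \<le> (norm (c *\<^sub>R T x - (r * \<nu>) *\<^sub>R x))\<^sup>2" by simp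
      then have "r\<^sup>2 * (\<nu>\<^sup>2 * (norm x)\<^sup>2 - 2 * \<nu> * inner (T x) x + (norm (T x))\<^sup>2) \<le>
        c\<^sup>2 * (norm (T x))\<^sup>2 - 2 * c * (r * \<nu>) * inner (T x) x + (r * \<nu>)\<^sup>2 * (norm x)\<^sup>2"
        by (simp add: polarization power_mult_distrib inner_commute[of x] mult_ac)
      \<comment> \<open>The terms in \<open>(norm x)\<^sup>2\<close> cancel because
        \<open>1 / \<nu>\<close> is an endpoint of the gap; what remains is divisible by
        \<open>c - r\<close>.\<close>
      then have "(c - r) * (2 * r * \<nu> * inner (T x) x) \<le> (c - r) * ((c + r) * (norm (T x))\<^sup>2)"
        by (simp add: algebra_simps power2_eq_square)
      moreover have "c - r > 0" using \<mu>_pos[of k] by (simp add: c_def)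
      ultimately have "2 * r * \<nu> * inner (T x) x \<le> (c + r) * (norm (T x))\<^sup>2"
        by (simp only: mult_le_cancel_left_pos)
      then show ?thesis using \<open>r > 0\<close> \<open>c > 0\<close> by (simp add: g_def field_simps)
    qed
    have low: "g * norm y \<le> norm (T y)" if yM: "y \<in> T ` M" for y
    proof -
      obtain w where w: "w \<in> M" "y = T w" using yM by blast
      \<comment> \<open>Nonnegativity of \<open>T\<close> at \<open>w - y / g\<close>, where
        \<open>y = T w\<close>, turns \<open>T\<^sup>2 \<ge> g T\<close> into
        \<open>T \<ge> g\<close> on the range.\<close>
      define t where "t = 1 / g"
      have "t > 0" using \<open>g > 0\<close> by (simp add: t_def)
      have "w - t *\<^sub>R y \<in> M" using w TM subM by (simp add: subspace_diff subspace_scale)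
      then have "0 \<le> inner (T (w - t *\<^sub>R y)) (w - t *\<^sub>R y)" by (rule Tpos)
      also have "\<dots> = inner (T w) w - 2 * t * (norm y)\<^sup>2 + t\<^sup>2 * inner (T y) y"
        using Tsym[of y w] unfolding power2_norm_eq_inner
        by (simp add: T.diff T.scaleR w(2)[symmetric] inner_simps inner_commute power2_eq_square algebra_simps)
      also have "inner (T w) w \<le> t * (norm y)\<^sup>2"
        using TT[of w] \<open>g > 0\<close> by (simp add: t_def w field_simps)
      finally have "0 \<le> t * (t * inner (T y) y - (norm y)\<^sup>2)" by (simp add: algebra_simps power2_eq_square)
      then have "(norm y)\<^sup>2 \<le> t * inner (T y) y" using \<open>t > 0\<close> by (simp add: zero_le_mult_iff)
      then have "g * (norm y)\<^sup>2 \<le> inner (T y) y" using \<open>g > 0\<close> by (simp add: t_def field_simps)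
      also have "\<dots> \<le> norm (T y) * norm y" by (rule norm_cauchy_schwarz)
      finally show ?thesis by (cases "y = 0") (simp_all add: power2_eq_square T.zero)
    qed
    define Z where "Z = closure (T ` M)"
    have "subspace (T ` M)"
      using T.linear subM by (rule linear_subspace_image)
    then have subZ: "subspace Z" unfolding Z_def by (rule closure_subspace)
    have "closed {y. g * norm y \<le> norm (T y)}"
      by (intro closed_Collect_le continuous_intros T.continuous_on)
    then have lowZ: "Z \<subseteq> {y. g * norm y \<le> norm (T y)}"
      unfolding Z_def using low by (intro closure_minimal) auto
    have ZM: "Z \<subseteq> M" unfolding Z_def using TM clM by (intro closure_minimal) auto
    have "x \<in> Z" if xM: "x \<in> M" for x
    proof -
      have "closed Z" by (simp add: Z_def)
      then obtain p where p: "p \<in> Z" "\<And>s. s \<in> Z \<Longrightarrow> inner (x - p) s = 0"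
        using orthogonal_projection_exists[OF subZ, of x] by blast
      define q where "q = x - p"
      have "q \<in> M" using xM p(1) ZM subM by (auto simp: q_def intro: subspace_diff)
      \<comment> \<open>\<open>q\<close> is orthogonal to \<open>Z\<close>, and symmetry moves one
        factor of \<open>T (T q)\<close> across, giving \<open>T q = 0\<close>.\<close>
      then have "T (T q) \<in> Z" unfolding Z_def using TM closure_subset[of "T ` M"] by blast
      then have "inner (T q) (T q) = 0" using p(2) Tsym[of q "T q"] by (simp add: q_def)
      then have "R q = \<nu> *\<^sub>R q" by (simp add: T_def)
      then have "(\<nu> *\<^sub>R q, q) \<in> A" using RA[of q] by simp
      then have "((\<mu> k)\<^sup>2 *\<^sub>R \<nu> *\<^sub>R q, (\<mu> k)\<^sup>2 *\<^sub>R q) \<in> A" by (rule scale_mem)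
      then have "q \<in> E k" using \<nu>(1) by (simp add: eigenspace_def k[symmetric])
      then have "inner q q = 0" using \<open>q \<in> M\<close> unfolding M_def by blast
      then show ?thesis using p(1) by (simp add: q_def)
    qed
    then have "g * norm x \<le> norm (R x - \<nu> *\<^sub>R x)" if "x \<in> M" for x
      using lowZ that by (auto simp: T_def norm_minus_commute)
    then show ?thesis using \<open>g > 0\<close> by blast
  qed
  then obtain k where "k > 0" "\<forall>x\<in>M. k * norm x \<le> norm (R x - \<nu> *\<^sub>R x)" by blast
  then show False
    by (intro symmetric_norm_spectral[OF R(1) Rsym subM RM \<nu>(2,3,1) _ _ \<nu>(1) plus]) auto
qed

section \<open>Eigenvector expansion and functions of the operator\<close>

definition P :: "nat \<Rightarrow> 'a \<Rightarrow> 'a" where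
  "P k x = (SOME p. p \<in> E k \<and> (\<forall>e\<in>E k. inner x e = inner p e))"

lemma P: "P k x \<in> E k" "e \<in> E k \<Longrightarrow> inner x e = inner (P k x) e"
proof -
  have "\<exists>p. p \<in> E k \<and> (\<forall>e\<in>E k. inner x e = inner p e)"
    using orthogonal_projection_exists[OF subspace_eigenspace closed_eigenspace, of "(\<mu> k)\<^sup>2" x]
    by (auto simp: inner_diff_left)
  from someI_ex[OF this] show "P k x \<in> E k" "e \<in> E k \<Longrightarrow> inner x e = inner (P k x) e"
    unfolding P_def by blast+
qed

lemma P_unique:
  assumes "a \<in> E k" "\<And>e. e \<in> E k \<Longrightarrow> inner x e = inner a e"
  shows "P k x = a"
proof -
  have d: "P k x - a \<in> E k" using P(1) assms(1) subspace_eigenspace by (rule subspace_diff[rotated])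
  have "inner (P k x - a) (P k x - a) = 0"
    using P(2)[OF d, of x] assms(2)[OF d] by (simp add: inner_diff_left)
  then show ?thesis by simp
qed

lemma P_norm: "(norm (P k x))\<^sup>2 = inner x (P k x)"
  using P(2)[OF P(1)] by (simp add: power2_norm_eq_inner)

text \<open>Bessel's inequality makes the series converge; the remainder is orthogonal to every
  eigenvector and vanishes by \<open>eigenvectors_total\<close>.\<close>

lemma P_sums: "(\<lambda>k. P k x) sums x"
proof -
  have orth: "inner (P i x) (P j x) = 0" if "i \<noteq> j" for i j
    using E_orthogonal P(1) that by blast
  have bessel: "(\<Sum>k<n. (norm (P k x))\<^sup>2) \<le> (norm x)\<^sup>2" for n
  proof -
    have 1: "(norm (\<Sum>k<n. P k x))\<^sup>2 = (\<Sum>k<n. (norm (P k x))\<^sup>2)"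
      using orth by (intro norm_sum_Pythagorean) (auto simp: pairwise_def orthogonal_def)
    have 2: "inner x (\<Sum>k<n. P k x) = (\<Sum>k<n. (norm (P k x))\<^sup>2)"
      by (simp add: inner_sum_right P_norm)
    have "0 \<le> (norm (x - (\<Sum>k<n. P k x)))\<^sup>2" by simp
    then show ?thesis unfolding polarization 1 2 by simp
  qed
  have "summable (\<lambda>k. P k x)" using orth bessel by (rule orthogonal_series_convergent)
  then have s: "(\<lambda>k. P k x) sums (\<Sum>k. P k x)" by (rule summable_sums)
  have "x - (\<Sum>k. P k x) = 0"
  proof (rule eigenvectors_total)
    fix j e assume e: "e \<in> E j"
    have "(\<lambda>k. inner (P k x) e) sums inner (\<Sum>k. P k x) e"
      using s by (rule bounded_linear.sums[OF bounded_linear_inner_left])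
    moreover have "(\<lambda>k. inner (P k x) e) sums inner (P j x) e"
      using sums_finite[of "{j}" "\<lambda>k. inner (P k x) e"] E_orthogonal[OF P(1) e] by simp
    ultimately show "inner (x - (\<Sum>k. P k x)) e = 0"
      using P(2)[OF e, of x] sums_unique2 by (fastforce simp: inner_diff_left)
  qed
  then show ?thesis using s by simp
qed

lemma parseval: "(\<lambda>k. inner (P k x) (P k y)) sums inner x y"
proof -
  have "(\<lambda>k. inner x (P k y)) sums inner x y"
    using P_sums by (rule bounded_linear.sums[OF bounded_linear_inner_right])
  moreover have "inner x (P k y) = inner (P k x) (P k y)" for k
    by (rule P(2)[OF P(1)])
  ultimately show ?thesis by (simp only:)
qed

lemma parseval_norm: "(\<lambda>k. (norm (P k x))\<^sup>2) sums (norm x)\<^sup>2"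
  using parseval[of x x] by (simp add: power2_norm_eq_inner)

text \<open>A function of \<open>A\<close> in weak form, taking the value \<open>f k\<close> on
  \<open>E k\<close>. The domain is implicit: \<open>x\<close> belongs to it exactly when some
  \<open>y\<close> has the prescribed coefficients, so no series appears in the definition.\<close>

definition diagonal :: "(nat \<Rightarrow> real) \<Rightarrow> 'a operator" where
  "diagonal f = {(x, y). \<forall>k. \<forall>e\<in>E k. inner y e = f k * inner x e}"

lemma diagonal_P: "(x, y) \<in> diagonal f \<Longrightarrow> P k y = f k *\<^sub>R P k x"
  using P(1)[of k x] P(2)[of _ k x] subspace_eigenspace
  by (intro P_unique) (simp_all add: diagonal_def subspace_scale)

lemma diagonal_symmetric:
  assumes "(x, y) \<in> diagonal f" "(x', y') \<in> diagonal f"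
  shows "inner y x' = inner x y'"
proof -
  have "inner (P k y) (P k x') = inner (P k x) (P k y')" for k
    by (simp add: diagonal_P[OF assms(1)] diagonal_P[OF assms(2)])
  then show ?thesis using parseval[of y x'] parseval[of x y'] by (simp add: sums_unique2)
qed

lemma diagonal_eigenvector: "e \<in> E k \<Longrightarrow> (e, f k *\<^sub>R e) \<in> diagonal f"
  unfolding diagonal_def mem_Collect_eq split_conv
proof (intro allI ballI)
  fix j e' assume "e \<in> E k" "e' \<in> E j"
  then show "inner (f k *\<^sub>R e) e' = f j * inner e e'"
    using E_orthogonal[of e k e' j] by (cases "j = k") auto
qed

lemma subspace_diagonal: "subspace (diagonal f)"
  unfolding subspace_def diagonal_def by (auto simp: zero_prod_def inner_add_left algebra_simps)

text \<open>Finite sums of eigenvectors give density, and testing the adjoint on eigenvectors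
  returns the defining relation, so the adjoint has no larger domain.\<close>

lemma diagonal_self_adjoint: "self_adjoint_operator (diagonal f)"
proof -
  have "single_valued (diagonal f)"
  proof (rule single_valuedI)
    fix x y y' assume "(x, y) \<in> diagonal f" "(x, y') \<in> diagonal f"
    then have "y - y' = 0" by (intro eigenvectors_total) (simp add: diagonal_def inner_diff_left)
    then show "y = y'" by simp
  qed
  moreover have "densely_defined (diagonal f)"
    unfolding densely_defined_def
  proof (intro set_eqI iffI UNIV_I)
    fix x
    have "(\<Sum>k<n. P k x, \<Sum>k<n. f k *\<^sub>R P k x) \<in> diagonal f" for n
    proof -
      have "(\<Sum>k<n. (P k x, f k *\<^sub>R P k x)) \<in> diagonal f"
        using P(1) by (intro subspace_sum subspace_diagonal diagonal_eigenvector)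
      then show ?thesis by (simp add: sum_prod)
    qed
    then have "\<forall>n. (\<Sum>k<n. P k x) \<in> Domain (diagonal f)" by blast
    then show "x \<in> closure (Domain (diagonal f))"
      using P_sums[of x] unfolding sums_def closure_sequential
      by (intro exI[of _ "\<lambda>n. \<Sum>k<n. P k x"]) auto
  qed
  moreover have "adjoint_operator (diagonal f) = diagonal f"
  proof (intro set_eqI iffI; clarify)
    fix y z assume *: "(y, z) \<in> adjoint_operator (diagonal f)"
    have "inner z e = f k * inner y e" if "e \<in> E k" for k e
    proof -
      have "inner (f k *\<^sub>R e) y = inner e z"
        using * diagonal_eigenvector[OF that, of f] unfolding adjoint_operator_def by blast
      then show ?thesis by (simp add: inner_commute)
    qed
    then show "(y, z) \<in> diagonal f" by (simp add: diagonal_def)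
  next
    fix y z assume "(y, z) \<in> diagonal f"
    then show "(y, z) \<in> adjoint_operator (diagonal f)"
      unfolding adjoint_operator_def using diagonal_symmetric by blast
  qed
  ultimately show ?thesis
    unfolding self_adjoint_operator_def linear_operator_def using subspace_diagonal by blast
qed

text \<open>Symmetry gives one inclusion, maximality of self-adjoint operators the other.\<close>

lemma A_diagonal: "A = diagonal (\<lambda>k. (\<mu> k)\<^sup>2)"
proof -
  have sub: "A \<subseteq> diagonal (\<lambda>k. (\<mu> k)\<^sup>2)"
  proof clarify
    fix x y assume xy: "(x, y) \<in> A"
    have "inner y e = (\<mu> k)\<^sup>2 * inner x e" if "e \<in> E k" for k e
      using symmetric[OF xy, of e "(\<mu> k)\<^sup>2 *\<^sub>R e"] that by (simp add: eigenspace_def)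
    then show "(x, y) \<in> diagonal (\<lambda>k. (\<mu> k)\<^sup>2)" by (simp add: diagonal_def)
  qed
  moreover have "diagonal (\<lambda>k. (\<mu> k)\<^sup>2) \<subseteq> A"
  proof clarify
    fix x y assume xy: "(x, y) \<in> diagonal (\<lambda>k. (\<mu> k)\<^sup>2)"
    show "(x, y) \<in> A"
    proof (rule memI)
      fix a w assume "(a, w) \<in> A"
      then show "inner w x = inner a y" using sub xy diagonal_symmetric by blast
    qed
  qed
  ultimately show ?thesis by blast
qed

lemma diagonal_nonnegative: "nonnegative_operator (diagonal \<mu>)"
  unfolding nonnegative_operator_def
proof clarify
  fix x y assume "(x, y) \<in> diagonal \<mu>"
  from diagonal_P[OF this] have "inner (P k y) (P k x) = \<mu> k * (norm (P k x))\<^sup>2" for k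
    by (simp add: power2_norm_eq_inner)
  then have s: "(\<lambda>k. \<mu> k * (norm (P k x))\<^sup>2) sums inner y x"
    using parseval[of y x] by simp
  show "0 \<le> inner y x"
  proof (rule sums_le[OF _ sums_zero s])
    show "0 \<le> \<mu> k * (norm (P k x))\<^sup>2" for k using \<mu>_pos[of k] by simp
  qed
qed

lemma diagonal_square: "diagonal \<mu> O diagonal \<mu> = A"
proof (intro set_eqI iffI; clarify)
  fix x y z assume "(x, y) \<in> diagonal \<mu>" "(y, z) \<in> diagonal \<mu>"
  then have "(x, z) \<in> diagonal (\<lambda>k. (\<mu> k)\<^sup>2)"
    by (simp add: diagonal_def power2_eq_square)
  then show "(x, z) \<in> A" using A_diagonal by blast
next
  fix x z assume "(x, z) \<in> A"
  then have xz: "(x, z) \<in> diagonal (\<lambda>k. (\<mu> k)\<^sup>2)" using A_diagonal by blast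
  \<comment> \<open>Candidates for the components of the intermediate vector. Their squared norms
    sum to \<open>inner z x\<close>, so the series converges although \<open>x\<close> is not yet
    known to lie in the domain of the root.\<close>
  define a where "a k = \<mu> k *\<^sub>R P k x" for k
  have aE: "a k \<in> E k" for k unfolding a_def using P(1) subspace_eigenspace by (simp add: subspace_scale)
  have "inner (P k z) (P k x) = (norm (a k))\<^sup>2" for k
    by (simp add: diagonal_P[OF xz] a_def power_mult_distrib power2_norm_eq_inner)
  then have "(\<lambda>k. (norm (a k))\<^sup>2) sums inner z x"
    using parseval[of z x] by simp
  then have "(\<Sum>k<n. (norm (a k))\<^sup>2) \<le> inner z x" for n
    using sum_le_suminf[of "\<lambda>k. (norm (a k))\<^sup>2" "{..<n}"] by (simp add: sums_iff)
  then have "summable a"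
    using E_orthogonal[OF aE aE] by (intro orthogonal_series_convergent)
  define y where "y = (\<Sum>k. a k)"
  have y: "inner y e = \<mu> k * inner x e" if e: "e \<in> E k" for k e
  proof -
    have "(\<lambda>j. inner (a j) e) sums inner y e"
      unfolding y_def using summable_sums[OF \<open>summable a\<close>]
      by (rule bounded_linear.sums[OF bounded_linear_inner_left])
    moreover have "(\<lambda>j. inner (a j) e) sums inner (a k) e"
      using sums_finite[of "{k}" "\<lambda>j. inner (a j) e"] E_orthogonal[OF aE e] by simp
    ultimately have "inner y e = inner (a k) e" by (rule sums_unique2)
    then show ?thesis using P(2)[OF e, of x] by (simp add: a_def)
  qed
  then have "(x, y) \<in> diagonal \<mu>" by (simp add: diagonal_def)
  moreover have "(y, z) \<in> diagonal \<mu>"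
    using xz y by (simp add: diagonal_def power2_eq_square mult.assoc)
  ultimately show "(x, z) \<in> diagonal \<mu> O diagonal \<mu>" by blast
qed

text \<open>Uniqueness behind the definite description: if \<open>B\<close> squares to
  \<open>A\<close> and \<open>e\<close> is an eigenvector, then \<open>d = B e - \<mu> e\<close>
  satisfies \<open>B d = - \<mu> d\<close>, and nonnegativity of \<open>B\<close> with
  \<open>\<mu> > 0\<close> forces \<open>d = 0\<close>. So \<open>B\<close> acts on eigenvectors as
  the diagonal operator; symmetry and maximality do the rest.\<close>

lemma sqrt_operator_eq: "sqrt_operator A = diagonal \<mu>"
  unfolding sqrt_operator_def
proof (rule the_equality)
  show "self_adjoint_operator (diagonal \<mu>) \<and> nonnegative_operator (diagonal \<mu>) \<and> diagonal \<mu> O diagonal \<mu> = A"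
    using diagonal_self_adjoint diagonal_nonnegative diagonal_square by blast
next
  fix B assume B: "self_adjoint_operator B \<and> nonnegative_operator B \<and> B O B = A"
  interpret B: symmetric_operator B using B by unfold_locales blast
  have eig: "(e, \<mu> k *\<^sub>R e) \<in> B" if "e \<in> E k" for k e
  proof -
    have "(e, (\<mu> k)\<^sup>2 *\<^sub>R e) \<in> B O B" using that B by (simp add: eigenspace_def)
    then obtain f where f: "(e, f) \<in> B" "(f, (\<mu> k)\<^sup>2 *\<^sub>R e) \<in> B" by blast
    define d where "d = f - \<mu> k *\<^sub>R e"
    have "(f + (- \<mu> k) *\<^sub>R e, (\<mu> k)\<^sup>2 *\<^sub>R e + (- \<mu> k) *\<^sub>R f) \<in> B"
      using f by (intro B.add_mem B.scale_mem)
    moreover have "f + (- \<mu> k) *\<^sub>R e = d" "(\<mu> k)\<^sup>2 *\<^sub>R e + (- \<mu> k) *\<^sub>R f = (- \<mu> k) *\<^sub>R d"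
      by (simp_all add: d_def power2_eq_square scaleR_right_diff_distrib)
    ultimately have "(d, (- \<mu> k) *\<^sub>R d) \<in> B" by simp
    then have "0 \<le> inner ((- \<mu> k) *\<^sub>R d) d"
      using B unfolding nonnegative_operator_def by blast
    then have "inner d d \<le> 0" using \<mu>_pos[of k] by (simp add: mult_le_0_iff)
    then have "d = 0" using inner_ge_zero[of d] by (metis antisym inner_eq_zero_iff)
    then have "f = \<mu> k *\<^sub>R e" by (simp add: d_def)
    then show ?thesis using f by simp
  qed
  have sub: "B \<subseteq> diagonal \<mu>"
  proof clarify
    fix x y assume xy: "(x, y) \<in> B"
    have "inner y e = \<mu> k * inner x e" if "e \<in> E k" for k e
      using B.symmetric[OF xy eig[OF that]] by simp
    then show "(x, y) \<in> diagonal \<mu>" by (simp add: diagonal_def)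
  qed
  moreover have "diagonal \<mu> \<subseteq> B"
  proof clarify
    fix x y assume xy: "(x, y) \<in> diagonal \<mu>"
    show "(x, y) \<in> B"
    proof (rule B.memI)
      fix a w assume "(a, w) \<in> B"
      then show "inner w x = inner a y" using sub xy diagonal_symmetric by blast
    qed
  qed
  ultimately show "B = diagonal \<mu>" by blast
qed

end

section \<open>Weak solutions\<close>

context discrete_operator
begin

lemma op_apply_diagonal: "(x, y) \<in> diagonal f \<Longrightarrow> op_apply (diagonal f) x = y"
  using diagonal_self_adjoint[of f]
  unfolding op_apply_def self_adjoint_operator_def linear_operator_def
  by (intro the_equality) (auto dest: single_valuedD)

text \<open>An eigenvector is an admissible test vector; the root contributes a factor
  \<open>\<mu> k\<close> on each side of the inner product, which makes up the square in the scalar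
  equation.\<close>

lemma weak_solution_oscillator:
  assumes sol: "weak_solution A \<delta> u v" and e: "e \<in> E k"
  shows "oscillator (\<mu> k) \<delta> (\<lambda>t. inner (u t) e) (\<lambda>t. inner (v t) e)"
proof -
  let ?B = "op_apply (diagonal \<mu>)"
  note sol' = sol[unfolded weak_solution_def sqrt_operator_eq]
  have Be: "(e, \<mu> k *\<^sub>R e) \<in> diagonal \<mu>" using e by (rule diagonal_eigenvector)
  then have eD: "e \<in> Domain (diagonal \<mu>)" by blast
  have Bu: "inner (?B (u t)) (?B e) = (\<mu> k)\<^sup>2 * inner (u t) e" if t: "t \<ge> 0" for t
  proof -
    have "u t \<in> Domain (diagonal \<mu>)" using sol' t by blast
    then obtain y where y: "(u t, y) \<in> diagonal \<mu>" by blast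
    then have "inner y e = \<mu> k * inner (u t) e" using e by (simp add: diagonal_def)
    then show ?thesis
      by (simp add: op_apply_diagonal[OF y] op_apply_diagonal[OF Be] power2_eq_square)
  qed
  have "((\<lambda>t. inner (u t) e) has_real_derivative inner (v t) e) (at t within {0..})" if t: "t \<ge> 0" for t
  proof -
    have "(u has_vector_derivative v t) (at t within {0..})" using sol' t by blast
    then show ?thesis
      unfolding has_real_derivative_iff_has_vector_derivative
      by (rule bounded_linear.has_vector_derivative[OF bounded_linear_inner_left])
  qed
  moreover have "continuous_on {0..} (\<lambda>t. inner (v t) e)"
    using sol' by (intro continuous_intros) blast
  moreover have "\<forall>T\<ge>0. absolutely_continuous_fun_on {0..T} (\<lambda>t. inner (v t) e)"
    using sol' eD by blast
  moreover have "AE t in lebesgue. t \<ge> 0 \<longrightarrow> ((\<lambda>t. inner (v t) e) has_real_derivative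
      - 2 * \<delta> t * inner (v t) e - (\<mu> k)\<^sup>2 * inner (u t) e) (at t within {0..})"
  proof -
    have "AE t in lebesgue. t \<ge> 0 \<longrightarrow>
           (\<exists>d. ((\<lambda>s. inner (v s) e) has_real_derivative d) (at t within {0..}) \<and>
                d + 2 * \<delta> t * inner (v t) e + inner (?B (u t)) (?B e) = 0)"
      using sol' eD by blast
    then show ?thesis
    proof eventually_elim
      case (elim t)
      show ?case
      proof
        assume t: "t \<ge> 0"
        then obtain d where d: "((\<lambda>s. inner (v s) e) has_real_derivative d) (at t within {0..})"
          "d + 2 * \<delta> t * inner (v t) e + inner (?B (u t)) (?B e) = 0" using elim by blast
        have "d = - 2 * \<delta> t * inner (v t) e - (\<mu> k)\<^sup>2 * inner (u t) e" using d(2) Bu[OF t] by simp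
        then show "((\<lambda>t. inner (v t) e) has_real_derivative
          - 2 * \<delta> t * inner (v t) e - (\<mu> k)\<^sup>2 * inner (u t) e) (at t within {0..})" using d(1) by simp
      qed
    qed
  qed
  ultimately show ?thesis unfolding oscillator_def by blast
qed

text \<open>The estimate for scalar components passes to the eigenspace component of a solution by means of
  an orthonormal basis of the plane spanned by the components of \<open>u t\<close> and \<open>v t\<close>.\<close>

lemma eigenspace_energy:
  assumes sol: "weak_solution A \<delta> u v" and "q \<ge> 0"
    and osc: "\<And>w h. oscillator (\<mu> k) \<delta> w h \<Longrightarrow> energy (\<mu> k) w h t \<le> q * energy (\<mu> k) w h 0"
  shows "(norm (P k (v t)))\<^sup>2 + (\<mu> k)\<^sup>2 * (norm (P k (u t)))\<^sup>2 \<le>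
     q * ((norm (P k (v 0)))\<^sup>2 + (\<mu> k)\<^sup>2 * (norm (P k (u 0)))\<^sup>2)"
proof -
  obtain e1 e2 where e: "e1 \<in> E k" "e2 \<in> E k"
    and v: "(norm (P k (v t)))\<^sup>2 = (inner (P k (v t)) e1)\<^sup>2 + (inner (P k (v t)) e2)\<^sup>2"
    and u: "(norm (P k (u t)))\<^sup>2 = (inner (P k (u t)) e1)\<^sup>2 + (inner (P k (u t)) e2)\<^sup>2"
    and bes: "\<And>x. (inner x e1)\<^sup>2 + (inner x e2)\<^sup>2 \<le> (norm x)\<^sup>2"
    by (rule orthonormal_pair_exists[OF subspace_eigenspace P(1) P(1)]) (rule that)
  let ?\<E> = "\<lambda>e s. (inner (P k (v s)) e)\<^sup>2 + (\<mu> k)\<^sup>2 * (inner (P k (u s)) e)\<^sup>2"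
  have comp: "?\<E> f t \<le> q * ?\<E> f 0" if f: "f \<in> E k" for f
  proof -
    have "inner (u s) f = inner (P k (u s)) f" "inner (v s) f = inner (P k (v s)) f" for s
      by (rule P(2)[OF f])+
    then show ?thesis
      using osc[OF weak_solution_oscillator[OF sol f]] unfolding energy_def by (simp only:)
  qed
  from comp[OF e(1)] comp[OF e(2)]
  have "?\<E> e1 t + ?\<E> e2 t \<le> q * (?\<E> e1 0 + ?\<E> e2 0)" by (simp only: distrib_left)
  also have "\<dots> \<le> q * ((norm (P k (v 0)))\<^sup>2 + (\<mu> k)\<^sup>2 * (norm (P k (u 0)))\<^sup>2)"
  proof (rule mult_left_mono[OF _ \<open>q \<ge> 0\<close>])
    have "(\<mu> k)\<^sup>2 * ((inner (P k (u 0)) e1)\<^sup>2 + (inner (P k (u 0)) e2)\<^sup>2) \<le> (\<mu> k)\<^sup>2 * (norm (P k (u 0)))\<^sup>2"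
      by (intro mult_left_mono bes) simp
    then show "?\<E> e1 0 + ?\<E> e2 0 \<le> (norm (P k (v 0)))\<^sup>2 + (\<mu> k)\<^sup>2 * (norm (P k (u 0)))\<^sup>2"
      using bes[of "P k (v 0)"] by (simp add: distrib_left)
  qed
  finally show ?thesis unfolding v u by (simp add: distrib_left)
qed

text \<open>Parseval for \<open>v\<close> and for the root applied to \<open>u\<close> splits the
  energy over the eigenspaces; the common factor \<open>q\<close> lets the separate inequalities be
  summed.\<close>

lemma energy_estimate:
  assumes sol: "weak_solution A \<delta> u v" and "q \<ge> 0" "t \<ge> 0"
    and osc: "\<And>k w h. oscillator (\<mu> k) \<delta> w h \<Longrightarrow> energy (\<mu> k) w h t \<le> q * energy (\<mu> k) w h 0"
  shows "(norm (v t))\<^sup>2 + (norm (op_apply (sqrt_operator A) (u t)))\<^sup>2 \<le>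
     ((norm (v 0))\<^sup>2 + (norm (op_apply (sqrt_operator A) (u 0)))\<^sup>2) * q"
proof -
  have s: "(\<lambda>k. (norm (P k (v s)))\<^sup>2 + (\<mu> k)\<^sup>2 * (norm (P k (u s)))\<^sup>2) sums
      ((norm (v s))\<^sup>2 + (norm (op_apply (sqrt_operator A) (u s)))\<^sup>2)" if s: "s \<ge> 0" for s
  proof -
    have "u s \<in> Domain (diagonal \<mu>)"
      using sol s unfolding weak_solution_def sqrt_operator_eq by blast
    then obtain y where y: "(u s, y) \<in> diagonal \<mu>" by blast
    have "(norm (P k y))\<^sup>2 = (\<mu> k)\<^sup>2 * (norm (P k (u s)))\<^sup>2" for k
      by (simp add: diagonal_P[OF y] power_mult_distrib)
    then show ?thesis
      using sums_add[OF parseval_norm[of "v s"] parseval_norm[of y]]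
      by (simp add: sqrt_operator_eq op_apply_diagonal[OF y])
  qed
  have "(norm (v t))\<^sup>2 + (norm (op_apply (sqrt_operator A) (u t)))\<^sup>2 \<le>
     q * ((norm (v 0))\<^sup>2 + (norm (op_apply (sqrt_operator A) (u 0)))\<^sup>2)"
    by (rule sums_le[OF eigenspace_energy[OF sol \<open>q \<ge> 0\<close> osc] s[OF \<open>t \<ge> 0\<close>] sums_mult[OF s[OF order_refl]]])
  then show ?thesis by (simp only: mult.commute)
qed

lemma ultra_exponential_damping_exists:
  assumes "damping_class C" "\<And>K. finite {l \<in> range \<mu>. l < K}"
  shows "\<exists>\<delta>\<in>C. \<exists>\<phi>. ultra_exponential_damping A \<delta> \<phi>"
proof -
  have "\<And>l. l \<in> range \<mu> \<Longrightarrow> l > 0" using \<mu>_pos by auto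
  from damping_class.universal_damping[OF assms(1) this assms(2)]
  obtain \<delta> \<phi> where \<delta>: "\<delta> \<in> C" "\<forall>t. \<delta> t \<ge> 0" "\<forall>t. \<phi> t > 0" "antimono_on {0..} \<phi>"
     "\<forall>R>0. ((\<lambda>t. \<phi> t * exp (R * t)) \<longlongrightarrow> 0) at_top"
     and osc: "\<forall>l\<in>range \<mu>. \<forall>w h. oscillator l \<delta> w h \<longrightarrow> (\<forall>t\<ge>0. energy l w h t \<le> \<phi> t * energy l w h 0)"
    by blast
  have "(norm (v t))\<^sup>2 + (norm (op_apply (sqrt_operator A) (u t)))\<^sup>2 \<le>
     ((norm (v 0))\<^sup>2 + (norm (op_apply (sqrt_operator A) (u 0)))\<^sup>2) * \<phi> t"
    if sol: "weak_solution A \<delta> u v" and t: "t \<ge> 0" for u v t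
  proof (rule energy_estimate[OF sol _ t])
    show "0 \<le> \<phi> t" using \<delta>(3) by (simp add: less_imp_le)
    show "energy (\<mu> k) w h t \<le> \<phi> t * energy (\<mu> k) w h 0" if "oscillator (\<mu> k) \<delta> w h" for k w h
      using osc that t by blast
  qed
  then have "ultra_exponential_damping A \<delta> \<phi>"
    unfolding ultra_exponential_damping_def using \<delta> by blast
  then show ?thesis using \<delta>(1) by blast
qed

end

theorem theorem2p6:
  fixes A :: "'a::{real_inner, complete_space} operator"
    and lam :: "nat \<Rightarrow> real"
  assumes "self_adjoint_operator A"
    and "nonnegative_operator A"
    and "\<forall>k\<ge>1. lam k > 0"
    and "strict_mono_on {1..} (\<lambda>k. (lam k)\<^sup>2)"
    and "\<not> bdd_above ((\<lambda>k. (lam k)\<^sup>2) ` {1..})"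
    and "spectrum A = (\<lambda>k. (lam k)\<^sup>2) ` {1..}"
  shows "(\<exists>\<delta> \<phi>. smooth_on_halfline \<delta> \<and> ultra_exponential_damping A \<delta> \<phi>) \<and>
         (\<exists>\<delta> \<phi>. piecewise_constant_on_halfline \<delta> \<and> ultra_exponential_damping A \<delta> \<phi>)"
proof -
  \<comment> \<open>Shift of the index, from \<open>k \<ge> 1\<close> to all natural
    numbers.\<close>
  define \<mu> where "\<mu> k = lam (Suc k)" for k
  have image: "(\<lambda>k. (lam k)\<^sup>2) ` {1..} = range (\<lambda>k. (\<mu> k)\<^sup>2)"
  proof -
    have "{1..} = range Suc" by (auto simp: image_iff dest: Suc_le_D)
    then show ?thesis by (simp add: \<mu>_def image_image)
  qed
  interpret discrete_operator A \<mu>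
  proof unfold_locales
    show "strict_mono (\<lambda>k. (\<mu> k)\<^sup>2)"
    proof (rule strict_monoI)
      fix i j :: nat assume "i < j"
      then show "(\<mu> i)\<^sup>2 < (\<mu> j)\<^sup>2"
        using assms(4) by (auto simp: \<mu>_def intro: strict_mono_onD)
    qed
  qed (use assms image in \<open>auto simp: \<mu>_def\<close>)
  \<comment> \<open>Unboundedness enters here: an increasing sequence that exceeds every level has
    only finitely many terms below it.\<close>
  have fin: "finite {l \<in> range \<mu>. l < K}" for K
  proof -
    obtain n where n: "K\<^sup>2 < (\<mu> n)\<^sup>2"
      using assms(5) unfolding image bdd_above_def by (auto simp: not_le)
    have "{l \<in> range \<mu>. l < K} \<subseteq> \<mu> ` {..<n}"
    proof clarify
      fix k assume "\<mu> k < K"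
      then have "(\<mu> k)\<^sup>2 < (\<mu> n)\<^sup>2" using n \<mu>_pos[of k] power_strict_mono[of "\<mu> k" K 2] by simp
      then show "\<mu> k \<in> \<mu> ` {..<n}" using strict_mono_less[OF \<mu>_mono] by simp
    qed
    then show ?thesis by (rule finite_subset) simp
  qed
  show ?thesis
    using ultra_exponential_damping_exists[OF damping_class_smooth fin]
      ultra_exponential_damping_exists[OF damping_class_step fin]
      smooth_on_reals_imp_halfline locally_step_function_imp_piecewise_constant by blast
qed

end
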